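(* Let $\Gamma=\left(M_{(1)1}^{(i)},N_{(1)j}^{(i)}\right)$ be a nonlinear connection on $E=J^1(\mathbb{R},M)$ and let $\nabla$ be a $\Gamma$-linear connection on $E$ with adapted coefficients $$\nabla\Gamma=\left(\bar G_{11}^1,\;G_{i1}^k,\;G_{(1)(j)1}^{(i)(1)},\;\bar L_{1j}^1,\;L_{ij}^k,\;L_{(1)(j)k}^{(i)(1)},\;\bar C_{1(k)}^{1(1)},\;C_{i(k)}^{j(1)},\;C_{(1)(j)(k)}^{(i)(1)(1)}\right).$$ The torsion tensor $\mathbf{T}(X,Y)=\nabla_XY-\nabla_YX-[X,Y]$ of $\nabla$ is determined by the following adapted torsion d-tensors: $$h_{\mathbb{R}}\mathbf{T}\left(\tfrac{\delta}{\delta t},\tfrac{\delta}{\delta t}\right)=0,\quad h_M\mathbf{T}\left(\tfrac{\delta}{\delta t},\tfrac{\delta}{\delta t}\right)=0,\quad v\mathbf{T}\left(\tfrac{\delta}{\delta t},\tfrac{\delta}{\delta t}\right)=0,$$ $$h_{\mathbb{R}}\mathbf{T}\left(\tfrac{\delta}{\delta x^j},\tfrac{\delta}{\delta t}\right)=\bar T_{1j}^1\tfrac{\delta}{\delta t},\quad h_M\mathbf{T}\left(\tfrac{\delta}{\delta x^j},\tfrac{\delta}{\delta t}\right)=T_{1j}^r\tfrac{\delta}{\delta x^r},\quad v\mathbf{T}\left(\tfrac{\delta}{\delta x^j},\tfrac{\delta}{\delta t}\right)=R_{(1)1j}^{(r)}\tfrac{\partial}{\partial y_1^r},$$ $$h_{\mathbb{R}}\mathbf{T}\left(\tfrac{\delta}{\delta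 x^j},\tfrac{\delta}{\delta x^i}\right)=0,\quad h_M\mathbf{T}\left(\tfrac{\delta}{\delta x^j},\tfrac{\delta}{\delta x^i}\right)=T_{ij}^r\tfrac{\delta}{\delta x^r},\quad v\mathbf{T}\left(\tfrac{\delta}{\delta x^j},\tfrac{\delta}{\delta x^i}\right)=R_{(1)ij}^{(r)}\tfrac{\partial}{\partial y_1^r},$$ $$h_{\mathbb{R}}\mathbf{T}\left(\tfrac{\partial}{\partial y_1^j},\tfrac{\delta}{\delta t}\right)=\bar P_{1(j)}^{1(1)}\tfrac{\delta}{\delta t},\quad h_M\mathbf{T}\left(\tfrac{\partial}{\partial y_1^j},\tfrac{\delta}{\delta t}\right)=0,\quad v\mathbf{T}\left(\tfrac{\partial}{\partial y_1^j},\tfrac{\delta}{\delta t}\right)=P_{(1)1(j)}^{(r)\;(1)}\tfrac{\partial}{\partial y_1^r},$$ $$h_{\mathbb{R}}\mathbf{T}\left(\tfrac{\partial}{\partial y_1^j},\tfrac{\delta}{\delta x^i}\right)=0,\quad h_M\mathbf{T}\left(\tfrac{\partial}{\partial y_1^j},\tfrac{\delta}{\delta x^i}\right)=P_{i(j)}^{r(1)}\tfrac{\delta}{\delta x^r},\quad v\mathbf{T}\left(\tfrac{\partial}{\partial y_1^j},\tfrac{\delta}{\delta x^i}\right)=P_{(1)i(j)}^{(r)\;(1)}\tfrac{\partial}{\partial y_1^r},$$ $$h_{\mathbb{R}}\mathbf{T}\left(\tfrac{\partial}{\partial y_1^j},\tfrac{\partial}{\partial y_1^i}\right)=0,\quad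 h_M\mathbf{T}\left(\tfrac{\partial}{\partial y_1^j},\tfrac{\partial}{\partial y_1^i}\right)=0,\quad v\mathbf{T}\left(\tfrac{\partial}{\partial y_1^j},\tfrac{\partial}{\partial y_1^i}\right)=S_{(1)(i)(j)}^{(r)(1)(1)}\tfrac{\partial}{\partial y_1^r},$$ where $$\bar T_{1j}^1=\bar L_{1j}^1,\quad T_{1j}^r=-G_{j1}^r,\quad T_{ij}^r=L_{ij}^r-L_{ji}^r,\quad \bar P_{1(j)}^{1(1)}=\bar C_{1(j)}^{1(1)},$$ $$P_{i(j)}^{r(1)}=C_{i(j)}^{r(1)},\quad S_{(1)(i)(j)}^{(r)(1)(1)}=C_{(1)(i)(j)}^{(r)(1)(1)}-C_{(1)(j)(i)}^{(r)(1)(1)},$$ $$P_{(1)1(j)}^{(r)\;(1)}=\frac{\partial M_{(1)1}^{(r)}}{\partial y_1^j}-G_{(1)(j)1}^{(r)(1)},\qquad P_{(1)i(j)}^{(r)\;(1)}=\frac{\partial N_{(1)i}^{(r)}}{\partial y_1^j}-L_{(1)(j)i}^{(r)(1)},$$ and $$R_{(1)1j}^{(r)}=\frac{\delta M_{(1)1}^{(r)}}{\delta x^j}-\frac{\delta N_{(1)j}^{(r)}}{\delta t},\qquad R_{(1)ij}^{(r)}=\frac{\delta N_{(1)i}^{(r)}}{\delta x^j}-\frac{\delta N_{(1)j}^{(r)}}{\delta x^i}.$$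
   Context: $M$ is a smooth $n$-dimensional manifold with local coordinates $(x^i)_{i=\overline{1,n}}$, $\mathbb{R}$ is the time manifold with coordinate $t$, and $E=J^1(\mathbb{R},M)\to\mathbb{R}\times M$ is the 1-jet vector bundle, with local coordinates $(t,x^i,y_1^i)$ transforming by $$\tilde t=\tilde t(t),\quad \tilde x^i=\tilde x^i(x^j),\quad \tilde y_1^i=\frac{\partial\tilde x^i}{\partial x^j}\frac{dt}{d\tilde t}\,y_1^j .$$ Latin indices run over $1,\dots,n$ and repeated Latin indices are summed; the index $1$ refers to the single time direction. A nonlinear connection $\Gamma=\left(M_{(1)1}^{(i)},N_{(1)j}^{(i)}\right)$ on $E$ is a family of local functions on the charts of $E$ transforming by $$\tilde M_{(1)1}^{(k)}=M_{(1)1}^{(j)}\left(\frac{dt}{d\tilde t}\right)^2\frac{\partial\tilde x^k}{\partial x^j}-\frac{dt}{d\tilde t}\frac{\partial\tilde y_1^k}{\partial t},\qquad \tilde N_{(1)l}^{(k)}=N_{(1)i}^{(j)}\frac{dt}{d\tilde t}\frac{\partial x^i}{\partial\tilde x^l}\frac{\partial\tilde x^k}{\partial x^j}-\frac{\partial x^i}{\partial\tilde x^l}\frac{\partial\tilde y_1^k}{\partial x^i}.$$ The adapted basis of vector fields is $$\frac{\delta}{\delta t}=\frac{\partial}{\partial t}-M_{(1)1}^{(j)}\frac{\partial}{\partial y_1^j},\quad \frac{\delta}{\delta x^i}=\frac{\partial}{\partial x^i}-N_{(1)i}^{(j)}\frac{\partial}{\partial y_1^j},\quad \frac{\partial}{\partial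 y_1^i}.$$ $h_{\mathbb{R}}$, $h_M$, $v$ denote the projections of $\mathcal{X}(E)$ onto the summands locally spanned respectively by $\frac{\delta}{\delta t}$, by the $\frac{\delta}{\delta x^i}$, by the $\frac{\partial}{\partial y_1^i}$. A $\Gamma$-linear connection on $E$ is a linear connection $\nabla$ on $E$ with $\nabla h_{\mathbb{R}}=0$, $\nabla h_M=0$, $\nabla v=0$, i.e. $\nabla_X(hY)=h(\nabla_XY)$ for $h\in\{h_{\mathbb{R}},h_M,v\}$. Its adapted coefficients in a chart are the local functions defined by $$\nabla_{\frac{\delta}{\delta t}}\frac{\delta}{\delta t}=\bar G_{11}^1\frac{\delta}{\delta t},\quad \nabla_{\frac{\delta}{\delta t}}\frac{\delta}{\delta x^i}=G_{i1}^k\frac{\delta}{\delta x^k},\quad \nabla_{\frac{\delta}{\delta t}}\frac{\partial}{\partial y_1^i}=G_{(1)(i)1}^{(k)(1)}\frac{\partial}{\partial y_1^k},$$ $$\nabla_{\frac{\delta}{\delta x^j}}\frac{\delta}{\delta t}=\bar L_{1j}^1\frac{\delta}{\delta t},\quad \nabla_{\frac{\delta}{\delta x^j}}\frac{\delta}{\delta x^i}=L_{ij}^k\frac{\delta}{\delta x^k},\quad \nabla_{\frac{\delta}{\delta x^j}}\frac{\partial}{\partial y_1^i}=L_{(1)(i)j}^{(k)(1)}\frac{\partial}{\partial y_1^k},$$ $$\nabla_{\frac{\partial}{\partial y_1^j}}\frac{\delta}{\delta t}=\bar C_{1(j)}^{1(1)}\frac{\delta}{\delta t},\quad \nabla_{\frac{\partial}{\partial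 y_1^j}}\frac{\delta}{\delta x^i}=C_{i(j)}^{k(1)}\frac{\delta}{\delta x^k},\quad \nabla_{\frac{\partial}{\partial y_1^j}}\frac{\partial}{\partial y_1^i}=C_{(1)(i)(j)}^{(k)(1)(1)}\frac{\partial}{\partial y_1^k}.$$ A d-tensor field on $E$ is a geometrical object $D=\left(D_{1k(1)(l)\ldots}^{1i(j)(1)\ldots}\right)$ whose local components transform by $$D_{1k(1)(l)\ldots}^{1i(j)(1)\ldots}=\tilde D_{1r(1)(s)\ldots}^{1p(m)(1)\ldots}\frac{dt}{d\tilde t}\frac{\partial x^i}{\partial\tilde x^p}\left(\frac{\partial x^j}{\partial\tilde x^m}\frac{d\tilde t}{dt}\right)\frac{d\tilde t}{dt}\frac{\partial\tilde x^r}{\partial x^k}\left(\frac{\partial\tilde x^s}{\partial x^l}\frac{dt}{d\tilde t}\right)\cdots,$$ where an upper $(j)$ paired with a lower $(1)$ is a vertical contravariant index and a lower $(l)$ paired with an upper $(1)$ is a vertical covariant index. *)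

theory Defs
  imports "HOL-Analysis.Analysis"
begin

section \<open>Smooth functions and smooth manifolds\<close>

text \<open>Both predicates below are meant for open sets only.\<close>

fun ck_on :: "nat \<Rightarrow> 'a::euclidean_space set \<Rightarrow> ('a \<Rightarrow> 'b::real_normed_vector) \<Rightarrow> bool" where
  "ck_on 0 S f \<longleftrightarrow> continuous_on S f"
| "ck_on (Suc k) S f \<longleftrightarrow>
     (\<forall>x\<in>S. f differentiable (at x)) \<and> (\<forall>v. ck_on k S (\<lambda>x. frechet_derivative f (at x) v))"

definition smooth_on :: "'a::euclidean_space set \<Rightarrow> ('a \<Rightarrow> 'b::real_normed_vector) \<Rightarrow> bool" where
  "smooth_on S f \<longleftrightarrow> (\<forall>k. ck_on k S f)"

text \<open>A chart is a pair of a domain and a coordinate map; the values of the coordinate map outside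
  the domain are irrelevant.\<close>

type_synonym ('x, 'v) chart = "'x set \<times> ('x \<Rightarrow> 'v)"

definition is_chart :: "('x::topological_space, 'v::euclidean_space) chart \<Rightarrow> bool" where
  "is_chart = (\<lambda>(U, \<phi>). open U \<and> open (\<phi> ` U) \<and> homeomorphism U (\<phi> ` U) \<phi> (inv_into U \<phi>))"

definition smooth_compatible :: "('x, 'v::euclidean_space) chart \<Rightarrow> ('x, 'v) chart \<Rightarrow> bool" where
  "smooth_compatible = (\<lambda>(U, \<phi>) (V, \<psi>).
     smooth_on (\<phi> ` (U \<inter> V)) (\<lambda>z. \<psi> (inv_into U \<phi> z)) \<and>
     smooth_on (\<psi> ` (U \<inter> V)) (\<lambda>z. \<phi> (inv_into V \<psi> z)))"

text \<open>A maximal smooth atlas on the whole type \<open>'m\<close>, of dimension \<open>n = CARD('n)\<close>.\<close>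

definition smooth_structure :: "('m::topological_space, real^'n) chart set \<Rightarrow> bool" where
  "smooth_structure A \<longleftrightarrow>
     (\<forall>c\<in>A. is_chart c) \<and> (\<Union>c\<in>A. fst c) = UNIV \<and>
     (\<forall>c\<in>A. \<forall>d\<in>A. smooth_compatible c d) \<and>
     (\<forall>c. is_chart c \<and> (\<forall>d\<in>A. smooth_compatible c d) \<longrightarrow> c \<in> A)"

text \<open>All local coordinates \<open>t\<close> of the time manifold, i.e. the standard smooth structure of the
  real line.\<close>

definition time_charts :: "(real, real) chart set" where
  "time_charts = {c. is_chart c \<and> smooth_compatible c (UNIV, \<lambda>s. s)}"

section \<open>The 1-jet space\<close>

definition smooth_curve_near :: "('m::topological_space, real^'n) chart set \<Rightarrow> real \<Rightarrow> (real \<Rightarrow> 'm) \<Rightarrow> bool" where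
  "smooth_curve_near A s \<gamma> \<longleftrightarrow> (\<exists>J. open J \<and> s \<in> J \<and> continuous_on J \<gamma> \<and>
     (\<forall>(U, \<phi>)\<in>A. smooth_on (J \<inter> \<gamma> -` U) (\<lambda>r. \<phi> (\<gamma> r))))"

definition same_first_order :: "('m::topological_space, real^'n) chart set \<Rightarrow> real \<Rightarrow> (real \<Rightarrow> 'm) \<Rightarrow> (real \<Rightarrow> 'm) \<Rightarrow> bool" where
  "same_first_order A s \<gamma> \<eta> \<longleftrightarrow> \<gamma> s = \<eta> s \<and>
     (\<forall>(U, \<phi>)\<in>A. \<gamma> s \<in> U \<longrightarrow>
        vector_derivative (\<lambda>r. \<phi> (\<gamma> r)) (at s) = vector_derivative (\<lambda>r. \<phi> (\<eta> r)) (at s))"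

text \<open>The 1-jet at time \<open>s\<close> of a curve that is smooth near \<open>s\<close>: the time together with the
  class of all curves having first order contact with it at \<open>s\<close>.\<close>

type_synonym 'm jet = "real \<times> (real \<Rightarrow> 'm) set"

definition jet_of :: "('m::topological_space, real^'n) chart set \<Rightarrow> real \<Rightarrow> (real \<Rightarrow> 'm) \<Rightarrow> 'm jet" where
  "jet_of A s \<gamma> = (s, {\<eta>. smooth_curve_near A s \<eta> \<and> same_first_order A s \<gamma> \<eta>})"

definition jet_space :: "('m::topological_space, real^'n) chart set \<Rightarrow> 'm jet set" where
  "jet_space A = {jet_of A s \<gamma> | s \<gamma>. smooth_curve_near A s \<gamma>}"

definition jet_rep :: "'m jet \<Rightarrow> real \<Rightarrow> 'm" where
  "jet_rep e = (SOME \<gamma>. \<gamma> \<in> snd e)"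

definition jet_point :: "'m jet \<Rightarrow> 'm" where
  "jet_point e = jet_rep e (fst e)"

text \<open>An induced chart of the jet space is given by a chart of time and a chart of \<open>M\<close>. Its
  coordinates are \<open>(t, x, y)\<close> with \<open>y = dx/dt\<close>, the derivative being taken with respect to the
  coordinate \<open>t\<close> of the time chart.\<close>

type_synonym ('m, 'n) jchart = "(real, real) chart \<times> ('m, real^'n) chart"

definition jcharts :: "('m, real^'n) chart set \<Rightarrow> ('m, 'n) jchart set" where
  "jcharts A = time_charts \<times> A"

definition jdom :: "('m::topological_space, real^'n) chart set \<Rightarrow> ('m, 'n) jchart \<Rightarrow> 'm jet set" where
  "jdom A C = {e \<in> jet_space A. fst e \<in> fst (fst C) \<and> jet_point e \<in> fst (snd C)}"

definition tco :: "('m, 'n) jchart \<Rightarrow> 'm jet \<Rightarrow> real" where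
  "tco C e = snd (fst C) (fst e)"

definition xco :: "('m, 'n) jchart \<Rightarrow> 'n::finite \<Rightarrow> 'm jet \<Rightarrow> real" where
  "xco C i e = snd (snd C) (jet_point e) $ i"

definition yco :: "('m, 'n) jchart \<Rightarrow> 'n::finite \<Rightarrow> 'm jet \<Rightarrow> real" where
  "yco C i e = vector_derivative
     (\<lambda>r. snd (snd C) (jet_rep e (inv_into (fst (fst C)) (snd (fst C)) r))) (at (tco C e)) $ i"

definition jcoord :: "('m, 'n::finite) jchart \<Rightarrow> 'm jet \<Rightarrow> real \<times> (real^'n) \<times> (real^'n)" where
  "jcoord C e = (tco C e, (\<chi> i. xco C i e), (\<chi> i. yco C i e))"

definition jinv :: "('m::topological_space, real^'n) chart set \<Rightarrow> ('m, 'n) jchart \<Rightarrow>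
    real \<times> (real^'n) \<times> (real^'n) \<Rightarrow> 'm jet" where
  "jinv A C = inv_into (jdom A C) (jcoord C)"

definition jopen :: "('m::topological_space, real^'n) chart set \<Rightarrow> 'm jet set \<Rightarrow> bool" where
  "jopen A W \<longleftrightarrow> W \<subseteq> jet_space A \<and> (\<forall>C\<in>jcharts A. open (jcoord C ` (W \<inter> jdom A C)))"

definition jsmooth_on :: "('m::topological_space, real^'n) chart set \<Rightarrow> 'm jet set \<Rightarrow> ('m jet \<Rightarrow> real) \<Rightarrow> bool" where
  "jsmooth_on A W f \<longleftrightarrow>
     (\<forall>C\<in>jcharts A. smooth_on (jcoord C ` (W \<inter> jdom A C)) (\<lambda>z. f (jinv A C z)))"

definition jsmooth_near :: "('m::topological_space, real^'n) chart set \<Rightarrow> 'm jet \<Rightarrow> ('m jet \<Rightarrow> real) \<Rightarrow> bool" where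
  "jsmooth_near A p f \<longleftrightarrow> (\<exists>V. jopen A V \<and> p \<in> V \<and> jsmooth_on A V f)"

section \<open>Vector fields on the jet space\<close>

text \<open>Tangent vectors at \<open>p\<close> are directional derivatives at \<open>p\<close>, acting on the functions that are
  smooth near \<open>p\<close>; to make the functional unique they are set to zero on all other functions.
  Likewise all (local) vector fields are set to zero outside their domain of definition.\<close>

type_synonym 'm jvec = "('m jet \<Rightarrow> real) \<Rightarrow> real"
type_synonym 'm jfield = "'m jet \<Rightarrow> 'm jvec"

definition coord_deriv :: "('m::topological_space, real^'n) chart set \<Rightarrow> ('m, 'n) jchart \<Rightarrow>
    real \<times> (real^'n) \<times> (real^'n) \<Rightarrow> 'm jfield" where
  "coord_deriv A C u p f =
     (if p \<in> jdom A C \<and> jsmooth_near A p f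
      then frechet_derivative (\<lambda>z. f (jinv A C z)) (at (jcoord C p)) u else 0)"

definition tangent_space :: "('m::topological_space, real^'n) chart set \<Rightarrow> 'm jet \<Rightarrow> 'm jvec set" where
  "tangent_space A p = {coord_deriv A C u p | C u. C \<in> jcharts A \<and> p \<in> jdom A C}"

text \<open>\<open>\<partial>/\<partial>t\<close>, \<open>\<partial>/\<partial>x\<^sup>i\<close> and \<open>\<partial>/\<partial>y\<^sup>i\<close>.\<close>

definition pd_t :: "('m::topological_space, real^'n) chart set \<Rightarrow> ('m, 'n) jchart \<Rightarrow> 'm jfield" where
  "pd_t A C = coord_deriv A C (1, 0, 0)"

definition pd_x :: "('m::topological_space, real^'n) chart set \<Rightarrow> ('m, 'n) jchart \<Rightarrow> 'n \<Rightarrow> 'm jfield" where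
  "pd_x A C i = coord_deriv A C (0, axis i 1, 0)"

definition pd_y :: "('m::topological_space, real^'n) chart set \<Rightarrow> ('m, 'n) jchart \<Rightarrow> 'n \<Rightarrow> 'm jfield" where
  "pd_y A C i = coord_deriv A C (0, 0, axis i 1)"

definition vector_fields :: "('m::topological_space, real^'n) chart set \<Rightarrow> 'm jfield set" where
  "vector_fields A = {X.
     (\<forall>p\<in>jet_space A. X p \<in> tangent_space A p) \<and>
     (\<forall>p. p \<notin> jet_space A \<longrightarrow> X p = (\<lambda>_. 0)) \<and>
     (\<forall>V f. jopen A V \<and> jsmooth_on A V f \<longrightarrow> jsmooth_on A V (\<lambda>p. X p f))}"

definition lie_bracket :: "('m::topological_space, real^'n) chart set \<Rightarrow> 'm jfield \<Rightarrow> 'm jfield \<Rightarrow> 'm jfield" where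
  "lie_bracket A X Y p f =
     (if jsmooth_near A p f then X p (\<lambda>q. Y q f) - Y p (\<lambda>q. X q f) else 0)"

section \<open>Linear connections\<close>

definition linear_connection ::
  "('m::topological_space, real^'n) chart set \<Rightarrow> ('m jfield \<Rightarrow> 'm jfield \<Rightarrow> 'm jfield) \<Rightarrow> bool" where
  "linear_connection A D \<longleftrightarrow>
     (\<forall>X\<in>vector_fields A. \<forall>Y\<in>vector_fields A. D X Y \<in> vector_fields A) \<and>
     (\<forall>X\<in>vector_fields A. \<forall>Y\<in>vector_fields A. \<forall>Z\<in>vector_fields A.
        D (\<lambda>p f. X p f + Y p f) Z = (\<lambda>p f. D X Z p f + D Y Z p f) \<and>
        D X (\<lambda>p f. Y p f + Z p f) = (\<lambda>p f. D X Y p f + D X Z p f)) \<and>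
     (\<forall>X\<in>vector_fields A. \<forall>Y\<in>vector_fields A. \<forall>g. jsmooth_on A (jet_space A) g \<longrightarrow>
        D (\<lambda>p f. g p * X p f) Y = (\<lambda>p f. g p * D X Y p f) \<and>
        D X (\<lambda>p f. g p * Y p f) = (\<lambda>p f. X p g * Y p f + g p * D X Y p f))"

text \<open>The action of a linear connection on vector fields defined only on an open set: at \<open>p\<close>, apply
  it to global vector fields that agree with the given ones near \<open>p\<close>. The value at \<open>p\<close> does not
  depend on this choice.\<close>

definition global_ext :: "('m::topological_space, real^'n) chart set \<Rightarrow> 'm jet \<Rightarrow> 'm jfield \<Rightarrow> 'm jfield" where
  "global_ext A p X = (SOME X'. X' \<in> vector_fields A \<and>
     (\<exists>V. jopen A V \<and> p \<in> V \<and> (\<forall>q\<in>V. X' q = X q)))"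

definition localized :: "('m::topological_space, real^'n) chart set \<Rightarrow>
    ('m jfield \<Rightarrow> 'm jfield \<Rightarrow> 'm jfield) \<Rightarrow> 'm jfield \<Rightarrow> 'm jfield \<Rightarrow> 'm jfield" where
  "localized A D X Y p = D (global_ext A p X) (global_ext A p Y) p"

definition torsion :: "('m::topological_space, real^'n) chart set \<Rightarrow>
    ('m jfield \<Rightarrow> 'm jfield \<Rightarrow> 'm jfield) \<Rightarrow> 'm jfield \<Rightarrow> 'm jfield \<Rightarrow> 'm jfield" where
  "torsion A D X Y = (\<lambda>p f. D X Y p f - D Y X p f - lie_bracket A X Y p f)"

section \<open>Nonlinear connections and adapted frames\<close>

text \<open>In \<open>\<Gamma> = (M, N)\<close>, \<open>M C j\<close> is the function with upper index \<open>j\<close> in the chart \<open>C\<close>, and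
  \<open>N C j i\<close> is the one with upper index \<open>j\<close> and lower index \<open>i\<close>.\<close>

type_synonym ('m, 'n) nlc =
  "(('m, 'n) jchart \<Rightarrow> 'n \<Rightarrow> 'm jet \<Rightarrow> real) \<times> (('m, 'n) jchart \<Rightarrow> 'n \<Rightarrow> 'n \<Rightarrow> 'm jet \<Rightarrow> real)"

definition nonlinear_connection ::
  "('m::topological_space, real^'n) chart set \<Rightarrow> ('m, 'n) nlc \<Rightarrow> bool" where
  "nonlinear_connection A = (\<lambda>(M, N).
     (\<forall>C\<in>jcharts A. \<forall>i j. jsmooth_on A (jdom A C) (M C i) \<and> jsmooth_on A (jdom A C) (N C i j)) \<and>
     (\<forall>C\<in>jcharts A. \<forall>C'\<in>jcharts A. \<forall>p\<in>jdom A C \<inter> jdom A C'.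
        (\<forall>k. M C' k p =
             (\<Sum>j\<in>UNIV. M C j p * (pd_t A C' p (tco C))\<^sup>2 * pd_x A C j p (xco C' k))
             - pd_t A C' p (tco C) * pd_t A C p (yco C' k)) \<and>
        (\<forall>k l. N C' k l p =
             (\<Sum>i\<in>UNIV. \<Sum>j\<in>UNIV. N C j i p * pd_t A C' p (tco C) *
                pd_x A C' l p (xco C i) * pd_x A C j p (xco C' k))
             - (\<Sum>i\<in>UNIV. pd_x A C' l p (xco C i) * pd_x A C i p (yco C' k)))))"

definition delta_t :: "('m::topological_space, real^'n) chart set \<Rightarrow> ('m, 'n) nlc \<Rightarrow> ('m, 'n) jchart \<Rightarrow> 'm jfield" where
  "delta_t A \<Gamma> C = (\<lambda>p f. pd_t A C p f - (\<Sum>j\<in>UNIV. fst \<Gamma> C j p * pd_y A C j p f))"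

definition delta_x :: "('m::topological_space, real^'n) chart set \<Rightarrow> ('m, 'n) nlc \<Rightarrow> ('m, 'n) jchart \<Rightarrow> 'n \<Rightarrow> 'm jfield" where
  "delta_x A \<Gamma> C i = (\<lambda>p f. pd_x A C i p f - (\<Sum>j\<in>UNIV. snd \<Gamma> C j i p * pd_y A C j p f))"

text \<open>The fibres at \<open>p\<close> of the three summands.\<close>

definition summand_R :: "('m::topological_space, real^'n) chart set \<Rightarrow> ('m, 'n) nlc \<Rightarrow> 'm jet \<Rightarrow> 'm jvec set" where
  "summand_R A \<Gamma> p = {\<lambda>f. a * delta_t A \<Gamma> C p f | C a. C \<in> jcharts A \<and> p \<in> jdom A C}"

definition summand_M :: "('m::topological_space, real^'n) chart set \<Rightarrow> ('m, 'n) nlc \<Rightarrow> 'm jet \<Rightarrow> 'm jvec set" where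
  "summand_M A \<Gamma> p =
     {\<lambda>f. \<Sum>i\<in>UNIV. b i * delta_x A \<Gamma> C i p f | C b. C \<in> jcharts A \<and> p \<in> jdom A C}"

definition summand_V :: "('m::topological_space, real^'n) chart set \<Rightarrow> 'm jet \<Rightarrow> 'm jvec set" where
  "summand_V A p = {\<lambda>f. \<Sum>i\<in>UNIV. c i * pd_y A C i p f | C c. C \<in> jcharts A \<and> p \<in> jdom A C}"

definition parts :: "('m::topological_space, real^'n) chart set \<Rightarrow> ('m, 'n) nlc \<Rightarrow> 'm jet \<Rightarrow>
    'm jvec \<Rightarrow> 'm jvec \<times> 'm jvec \<times> 'm jvec" where
  "parts A \<Gamma> p w = (THE (w1, w2, w3). w1 \<in> summand_R A \<Gamma> p \<and> w2 \<in> summand_M A \<Gamma> p \<and>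
     w3 \<in> summand_V A p \<and> w = (\<lambda>f. w1 f + w2 f + w3 f))"

definition h_R :: "('m::topological_space, real^'n) chart set \<Rightarrow> ('m, 'n) nlc \<Rightarrow> 'm jfield \<Rightarrow> 'm jfield" where
  "h_R A \<Gamma> X p = (if p \<in> jet_space A then fst (parts A \<Gamma> p (X p)) else (\<lambda>_. 0))"

definition h_M :: "('m::topological_space, real^'n) chart set \<Rightarrow> ('m, 'n) nlc \<Rightarrow> 'm jfield \<Rightarrow> 'm jfield" where
  "h_M A \<Gamma> X p = (if p \<in> jet_space A then fst (snd (parts A \<Gamma> p (X p))) else (\<lambda>_. 0))"

definition v_proj :: "('m::topological_space, real^'n) chart set \<Rightarrow> ('m, 'n) nlc \<Rightarrow> 'm jfield \<Rightarrow> 'm jfield" where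
  "v_proj A \<Gamma> X p = (if p \<in> jet_space A then snd (snd (parts A \<Gamma> p (X p))) else (\<lambda>_. 0))"

section \<open>\<open>\<Gamma>\<close>-linear connections and their adapted coefficients\<close>

definition gamma_linear_connection :: "('m::topological_space, real^'n) chart set \<Rightarrow> ('m, 'n) nlc \<Rightarrow>
    ('m jfield \<Rightarrow> 'm jfield \<Rightarrow> 'm jfield) \<Rightarrow> bool" where
  "gamma_linear_connection A \<Gamma> D \<longleftrightarrow> linear_connection A D \<and>
     (\<forall>h\<in>{h_R A \<Gamma>, h_M A \<Gamma>, v_proj A \<Gamma>}.
        \<forall>X\<in>vector_fields A. \<forall>Y\<in>vector_fields A. D X (h Y) = h (D X Y))"

text \<open>Components of a tangent vector with respect to one vector, or to a family of vectors.\<close>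

definition comp1 :: "'m jvec \<Rightarrow> 'm jvec \<Rightarrow> real" where
  "comp1 e w = (THE a. w = (\<lambda>f. a * e f))"

definition compn :: "('n::finite \<Rightarrow> 'm jvec) \<Rightarrow> 'm jvec \<Rightarrow> 'n \<Rightarrow> real" where
  "compn e w = (THE a. w = (\<lambda>f. \<Sum>k\<in>UNIV. a k * e k f))"

text \<open>In the nine coefficients the indices after the chart are the upper one (if any) followed by
  the lower ones from left to right, skipping the time index: \<open>coef_G\<close>
  has arguments \<open>k i\<close> for \<open>G\<^sup>k\<^sub>i\<^sub>1\<close>, \<open>coef_L\<close> has arguments \<open>k i j\<close> for \<open>L\<^sup>k\<^sub>i\<^sub>j\<close>. The suffix \<open>v\<close> marks the coefficients acting on the vertical
  summand. \<open>coef_Cv\<close> does not involve \<open>\<Gamma>\<close>.\<close>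

context
  fixes A :: "('m::topological_space, real^'n) chart set" and \<Gamma> :: "('m, 'n) nlc"
    and D :: "'m jfield \<Rightarrow> 'm jfield \<Rightarrow> 'm jfield"
begin

definition coef_Gbar :: "('m, 'n) jchart \<Rightarrow> 'm jet \<Rightarrow> real" where
  "coef_Gbar C p = comp1 (delta_t A \<Gamma> C p) (localized A D (delta_t A \<Gamma> C) (delta_t A \<Gamma> C) p)"

definition coef_G :: "('m, 'n) jchart \<Rightarrow> 'n \<Rightarrow> 'n \<Rightarrow> 'm jet \<Rightarrow> real" where
  "coef_G C k i p =
     compn (\<lambda>r. delta_x A \<Gamma> C r p) (localized A D (delta_t A \<Gamma> C) (delta_x A \<Gamma> C i) p) k"

definition coef_Gv :: "('m, 'n) jchart \<Rightarrow> 'n \<Rightarrow> 'n \<Rightarrow> 'm jet \<Rightarrow> real" where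
  "coef_Gv C k i p =
     compn (\<lambda>r. pd_y A C r p) (localized A D (delta_t A \<Gamma> C) (pd_y A C i) p) k"

definition coef_Lbar :: "('m, 'n) jchart \<Rightarrow> 'n \<Rightarrow> 'm jet \<Rightarrow> real" where
  "coef_Lbar C j p =
     comp1 (delta_t A \<Gamma> C p) (localized A D (delta_x A \<Gamma> C j) (delta_t A \<Gamma> C) p)"

definition coef_L :: "('m, 'n) jchart \<Rightarrow> 'n \<Rightarrow> 'n \<Rightarrow> 'n \<Rightarrow> 'm jet \<Rightarrow> real" where
  "coef_L C k i j p =
     compn (\<lambda>r. delta_x A \<Gamma> C r p) (localized A D (delta_x A \<Gamma> C j) (delta_x A \<Gamma> C i) p) k"

definition coef_Lv :: "('m, 'n) jchart \<Rightarrow> 'n \<Rightarrow> 'n \<Rightarrow> 'n \<Rightarrow> 'm jet \<Rightarrow> real" where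
  "coef_Lv C k i j p =
     compn (\<lambda>r. pd_y A C r p) (localized A D (delta_x A \<Gamma> C j) (pd_y A C i) p) k"

definition coef_Cbar :: "('m, 'n) jchart \<Rightarrow> 'n \<Rightarrow> 'm jet \<Rightarrow> real" where
  "coef_Cbar C j p =
     comp1 (delta_t A \<Gamma> C p) (localized A D (pd_y A C j) (delta_t A \<Gamma> C) p)"

definition coef_C :: "('m, 'n) jchart \<Rightarrow> 'n \<Rightarrow> 'n \<Rightarrow> 'n \<Rightarrow> 'm jet \<Rightarrow> real" where
  "coef_C C k i j p =
     compn (\<lambda>r. delta_x A \<Gamma> C r p) (localized A D (pd_y A C j) (delta_x A \<Gamma> C i) p) k"

definition coef_Cv :: "('m, 'n) jchart \<Rightarrow> 'n \<Rightarrow> 'n \<Rightarrow> 'n \<Rightarrow> 'm jet \<Rightarrow> real" where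
  "coef_Cv C k i j p =
     compn (\<lambda>r. pd_y A C r p) (localized A D (pd_y A C j) (pd_y A C i) p) k"

end

section \<open>d-tensor fields\<close>

text \<open>The kinds of indices of a d-tensor: the time index \<open>1\<close>, a Latin index, and a vertical index
  (a Latin index in parentheses together with its paired \<open>(1)\<close>), each of them contravariant
  (\<open>_up\<close>) or covariant (\<open>_lo\<close>). In a list of index values, \<open>None\<close> stands for the index \<open>1\<close> and
  \<open>Some i\<close> for a Latin index.\<close>

datatype index_kind = T_up | T_lo | H_up | H_lo | V_up | V_lo

fun index_range :: "index_kind \<Rightarrow> 'n option set" where
  "index_range T_up = {None}"
| "index_range T_lo = {None}"
| "index_range _ = range Some"

text \<open>The factor contributed by the index \<open>i\<close> of the component in the chart \<open>C\<close> and the summation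
  index \<open>m\<close> of the component in the chart \<open>C'\<close> (the one with tilde).\<close>

fun index_factor :: "('m::topological_space, real^'n) chart set \<Rightarrow> ('m, 'n) jchart \<Rightarrow> ('m, 'n) jchart \<Rightarrow>
    'm jet \<Rightarrow> index_kind \<Rightarrow> 'n option \<Rightarrow> 'n option \<Rightarrow> real" where
  "index_factor A C C' p T_up i m = pd_t A C' p (tco C)"
| "index_factor A C C' p T_lo i m = pd_t A C p (tco C')"
| "index_factor A C C' p H_up i m = pd_x A C' (the m) p (xco C (the i))"
| "index_factor A C C' p H_lo i m = pd_x A C (the i) p (xco C' (the m))"
| "index_factor A C C' p V_up i m = pd_x A C' (the m) p (xco C (the i)) * pd_t A C p (tco C')"
| "index_factor A C C' p V_lo i m = pd_x A C (the i) p (xco C' (the m)) * pd_t A C' p (tco C)"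

definition d_tensor :: "('m::topological_space, real^'n) chart set \<Rightarrow> index_kind list \<Rightarrow>
    (('m, 'n) jchart \<Rightarrow> 'n option list \<Rightarrow> 'm jet \<Rightarrow> real) \<Rightarrow> bool" where
  "d_tensor A ks T \<longleftrightarrow>
     (\<forall>C\<in>jcharts A. \<forall>is\<in>listset (map index_range ks). jsmooth_on A (jdom A C) (T C is)) \<and>
     (\<forall>C\<in>jcharts A. \<forall>C'\<in>jcharts A. \<forall>p\<in>jdom A C \<inter> jdom A C'. \<forall>is\<in>listset (map index_range ks).
        T C is p = (\<Sum>ms\<in>listset (map index_range ks).
          T C' ms p * (\<Prod>a<length ks. index_factor A C C' p (ks ! a) (is ! a) (ms ! a))))"

text \<open>The tangent vector at \<open>p\<close> with components \<open>a\<close>, \<open>b\<close>, \<open>c\<close> in the adapted basis.\<close>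

definition adapted_vec :: "('m::topological_space, real^'n) chart set \<Rightarrow> ('m, 'n) nlc \<Rightarrow>
    ('m, 'n) jchart \<Rightarrow> 'm jet \<Rightarrow> real \<Rightarrow> ('n \<Rightarrow> real) \<Rightarrow> ('n \<Rightarrow> real) \<Rightarrow> 'm jvec" where
  "adapted_vec A \<Gamma> C p a b c = (\<lambda>f. a * delta_t A \<Gamma> C p f
     + (\<Sum>i\<in>UNIV. b i * delta_x A \<Gamma> C i p f) + (\<Sum>i\<in>UNIV. c i * pd_y A C i p f))"

end

theory Submission
  imports Defs
begin

text \<open>
  The torsion \<open>T(X,Y) = \<nabla>\<^sub>X Y - \<nabla>\<^sub>Y X - [X,Y]\<close> is linear over the smooth functions, because the terms
  that contain a derivative of a factor of \<open>X\<close> cancel (\<open>torsion_scale_left\<close>). Hence its value at a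
  point depends only on the values of \<open>X\<close> and \<open>Y\<close> at that point (\<open>torsion_pointwise\<close>), and it is known
  once it is known on a frame (\<open>torsion_expand\<close>). The frame to use is the adapted one. Two computations
  give the torsion there.

  The connection part: \<open>\<nabla>\<close> commutes with the three projections, so the derivative of a frame field stays
  in the summand of that field, and its components are the nine adapted coefficients
  (\<open>localized_frame\<close>, \<open>coef_conn\<close>). The bracket part: the coordinate fields commute, so the bracket of
  two adapted fields is vertical and its components are derivatives of \<open>M\<close> and \<open>N\<close> along adapted fields
  (\<open>bracket_frame\<close>). Subtracting gives all the components (\<open>tors_values\<close>), and their projections onto
  the summands give the table of the theorem.

  The transformation law of the nonlinear connection is equivalent to the adapted frame changing by a
  block diagonal matrix, with blocks \<open>dt'/dt\<close>, \<open>\<partial>x'/\<partial>x\<close> and \<open>(\<partial>x'/\<partial>x) (dt/dt')\<close> (\<open>fr_change\<close>). This makes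
  the three summands independent of the chart (\<open>parts_frame\<close>). Expanding the torsion in the frames of
  two charts turns its bilinearity into the d-tensor law of the components (\<open>tors_change\<close>,
  \<open>d_tensor_tors\<close>), since the index factors of that law are the entries of those blocks.

  Adapted fields live on the domain of a chart only, whereas \<open>\<nabla>\<close> acts on global fields. The passage
  between the two rests on bump functions (\<open>jet_bump\<close>): by them \<open>\<nabla>\<close> is local (\<open>D_local\<close>), and a field
  on a chart agrees near any given point with a global one. For this, and for the chain rules, the first
  half of the text develops the calculus of smooth functions on open sets of Euclidean spaces and the
  induced charts of the jet space, in which a jet is determined by its time, its point and its velocity
  (\<open>jcoord_inj\<close>, \<open>jcoord_image\<close>, \<open>jcoord_change\<close>).
\<close>


section \<open>Calculus of smooth functions on open sets\<close>

lemma ck_on_subset: "ck_on k S f \<Longrightarrow> T \<subseteq> S \<Longrightarrow> ck_on k T f"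
  by (induction k arbitrary: f) (auto intro: continuous_on_subset)

lemma frechet_derivative_eqI: "(f has_derivative f') (at x) \<Longrightarrow> frechet_derivative f (at x) = f'"
  by (rule frechet_derivative_at[symmetric])

lemma ck_on_Suc_imp_differentiable: "ck_on (Suc k) S f \<Longrightarrow> x \<in> S \<Longrightarrow>
    (f has_derivative frechet_derivative f (at x)) (at x)"
  by (simp add: frechet_derivative_works)

lemma ck_on_cong:
  assumes "open S" and "\<And>x. x \<in> S \<Longrightarrow> f x = g x" and "ck_on k S f"
  shows "ck_on k S g"
  using assms(2,3)
proof (induction k arbitrary: f g)
  case 0
  then show ?case by (simp cong: continuous_on_cong)
next
  case (Suc k)
  have der: "(g has_derivative frechet_derivative f (at x)) (at x)" if "x \<in> S" for x
    using ck_on_Suc_imp_differentiable[OF Suc.prems(2) that] assms(1) that Suc.prems(1)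
    by (rule has_derivative_transform_within_open)
  have "ck_on k S (\<lambda>x. frechet_derivative g (at x) v)" for v
  proof (rule Suc.IH)
    show "ck_on k S (\<lambda>x. frechet_derivative f (at x) v)" using Suc.prems(2) by simp
  qed (simp add: frechet_derivative_eqI[OF der])
  then show ?case using der by (auto simp: differentiable_def)
qed

text \<open>The definition of \<open>ck_on\<close> speaks of \<open>frechet_derivative\<close>, which on an open set may be
  replaced by any explicit derivative; the closure properties below are inductions with this rule.\<close>

lemma ck_on_SucI:
  assumes "open S" and "\<And>x. x \<in> S \<Longrightarrow> (f has_derivative f' x) (at x)"
    and "\<And>v. ck_on k S (\<lambda>x. f' x v)"
  shows "ck_on (Suc k) S f"
proof -
  have "ck_on k S (\<lambda>x. frechet_derivative f (at x) v)" for v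
    by (rule ck_on_cong[OF assms(1) _ assms(3)]) (simp add: frechet_derivative_eqI[OF assms(2)])
  then show ?thesis using assms(2) by (auto simp: differentiable_def)
qed

lemma ck_on_SucD: "ck_on (Suc k) S f \<Longrightarrow> ck_on k S f"
proof (induction k arbitrary: f)
  case 0
  then show ?case
    by (auto intro!: continuous_at_imp_continuous_on differentiable_imp_continuous_within)
next
  case (Suc k)
  then show ?case by simp
qed

lemma ck_on_local:
  assumes "\<And>x. x \<in> S \<Longrightarrow> \<exists>T. open T \<and> x \<in> T \<and> ck_on k T f"
  shows "ck_on k S f"
  using assms
proof (induction k arbitrary: f)
  case 0
  show ?case
    unfolding ck_on.simps
  proof (rule continuous_at_imp_continuous_on, rule ballI)
    fix x assume "x \<in> S"
    then obtain T where "open T" "x \<in> T" "continuous_on T f"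
      using 0[of x] unfolding ck_on.simps by blast
    then show "isCont f x" by (simp add: continuous_on_eq_continuous_at)
  qed
next
  case (Suc k)
  have "f differentiable (at x)" if "x \<in> S" for x
    using Suc.prems[OF that] unfolding ck_on.simps by blast
  moreover have "ck_on k S (\<lambda>x. frechet_derivative f (at x) v)" for v
  proof (rule Suc.IH)
    fix x assume "x \<in> S"
    then show "\<exists>T. open T \<and> x \<in> T \<and> ck_on k T (\<lambda>x. frechet_derivative f (at x) v)"
      using Suc.prems[of x] unfolding ck_on.simps by blast
  qed
  ultimately show ?case by simp
qed

lemma ck_on_const: "ck_on k S (\<lambda>x. c)"
  by (induction k arbitrary: c) (auto)

lemma ck_on_bounded_linear_comp:
  assumes "open S" and "bounded_linear h" and "ck_on k S f"
  shows "ck_on k S (\<lambda>x. h (f x))"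
  using assms(3)
proof (induction k arbitrary: f)
  case 0
  then show ?case using assms(2) by (auto intro: bounded_linear.continuous_on)
next
  case (Suc k)
  show ?case
  proof (rule ck_on_SucI[OF assms(1)])
    show "((\<lambda>x. h (f x)) has_derivative (\<lambda>v. h (frechet_derivative f (at x) v))) (at x)" if "x \<in> S" for x
      by (rule bounded_linear.has_derivative[OF assms(2) ck_on_Suc_imp_differentiable[OF Suc.prems that]])
  qed (use Suc in auto)
qed

lemma ck_on_bounded_linear:
  assumes "open S" "bounded_linear h"
  shows "ck_on k S h"
proof (cases k)
  case 0
  then show ?thesis using assms by (simp add: linear_continuous_on)
next
  case (Suc l)
  show ?thesis unfolding Suc
    by (rule ck_on_SucI[OF assms(1)]) (use assms in \<open>auto intro: bounded_linear_imp_has_derivative ck_on_const\<close>)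
qed

lemma ck_on_add:
  assumes "open S" and "ck_on k S f" and "ck_on k S g"
  shows "ck_on k S (\<lambda>x. f x + g x)"
  using assms(2,3)
proof (induction k arbitrary: f g)
  case 0
  then show ?case by (auto intro: continuous_on_add)
next
  case (Suc k)
  show ?case
  proof (rule ck_on_SucI[OF assms(1)])
    show "((\<lambda>x. f x + g x) has_derivative
        (\<lambda>v. frechet_derivative f (at x) v + frechet_derivative g (at x) v)) (at x)" if "x \<in> S" for x
      by (intro has_derivative_add Suc.prems[THEN ck_on_Suc_imp_differentiable, OF that])
  qed (use Suc in auto)
qed

lemma ck_on_bounded_bilinear:
  assumes "open S" and "bounded_bilinear pr" and "ck_on k S f" and "ck_on k S g"
  shows "ck_on k S (\<lambda>x. pr (f x) (g x))"
  using assms(3,4)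
proof (induction k arbitrary: f g)
  case 0
  then show ?case by (auto intro: bounded_bilinear.continuous_on[OF assms(2)])
next
  case (Suc k)
  show ?case
  proof (rule ck_on_SucI[OF assms(1)])
    note fg = Suc.prems[THEN ck_on_SucD]
    fix v
    show "ck_on k S (\<lambda>x. pr (f x) (frechet_derivative g (at x) v) + pr (frechet_derivative f (at x) v) (g x))"
      by (intro ck_on_add[OF assms(1)] Suc.IH fg) (use Suc.prems in auto)
  next
    show "((\<lambda>x. pr (f x) (g x)) has_derivative (\<lambda>v. pr (f x) (frechet_derivative g (at x) v)
        + pr (frechet_derivative f (at x) v) (g x))) (at x)" if "x \<in> S" for x
      by (rule bounded_bilinear.FDERIV[OF assms(2) Suc.prems[THEN ck_on_Suc_imp_differentiable, OF that]])
  qed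
qed

lemma ck_on_sum:
  assumes "open S" "\<And>i. i \<in> I \<Longrightarrow> ck_on k S (f i)"
  shows "ck_on k S (\<lambda>x. \<Sum>i\<in>I. f i x)"
  using assms(2) by (induction I rule: infinite_finite_induct) (auto intro: ck_on_add ck_on_const assms(1))

lemma linear_componentwise_expansion:
  fixes L :: "'c::euclidean_space \<Rightarrow> 'b::real_vector"
  assumes "linear L"
  shows "(\<Sum>b\<in>Basis. (w \<bullet> b) *\<^sub>R L b) = L w"
proof -
  have "L (\<Sum>b\<in>Basis. (w \<bullet> b) *\<^sub>R b) = (\<Sum>b\<in>Basis. (w \<bullet> b) *\<^sub>R L b)"
    by (simp add: linear_sum[OF assms] linear_cmul[OF assms])
  then show ?thesis by (simp only: euclidean_representation)
qed

text \<open>The derivative of a composite is expanded over a basis, so that the induction only meets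
  derivatives in constant directions.\<close>

lemma ck_on_compose:
  fixes f :: "'a::euclidean_space \<Rightarrow> 'c::euclidean_space"
  assumes "open S" and "open T" and "f ` S \<subseteq> T" and "ck_on k T g" and "ck_on k S f"
  shows "ck_on k S (\<lambda>x. g (f x))"
  using assms(4,5)
proof (induction k arbitrary: g)
  case 0
  then show ?case using assms(3) by (auto intro: continuous_on_compose2)
next
  case (Suc k)
  show ?case
  proof (rule ck_on_SucI[OF assms(1)])
    fix x assume x: "x \<in> S"
    then have fx: "f x \<in> T" using assms(3) by auto
    let ?f' = "frechet_derivative f (at x)" and ?g' = "frechet_derivative g (at (f x))"
    have dg: "(g has_derivative ?g') (at (f x))"
      by (rule ck_on_Suc_imp_differentiable[OF Suc.prems(1) fx])
    show "((\<lambda>x. g (f x)) has_derivative (\<lambda>v. \<Sum>b\<in>Basis. (?f' v \<bullet> b) *\<^sub>R ?g' b)) (at x)"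
      using has_derivative_compose[OF ck_on_Suc_imp_differentiable[OF Suc.prems(2) x] dg]
      by (simp add: linear_componentwise_expansion[OF has_derivative_linear[OF dg]])
  next
    fix v
    show "ck_on k S (\<lambda>x. \<Sum>b\<in>Basis. (frechet_derivative f (at x) v \<bullet> b) *\<^sub>R frechet_derivative g (at (f x)) b)"
    proof (intro ck_on_sum[OF assms(1)] ck_on_bounded_bilinear[OF assms(1) bounded_bilinear_scaleR])
      fix b :: 'c
      show "ck_on k S (\<lambda>x. frechet_derivative f (at x) v \<bullet> b)"
        by (rule ck_on_bounded_linear_comp[OF assms(1) bounded_linear_inner_left]) (use Suc.prems in auto)
      show "ck_on k S (\<lambda>x. frechet_derivative g (at (f x)) b)"
        using Suc.prems by (intro Suc.IH ck_on_SucD[OF Suc.prems(2)]) auto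
    qed
  qed
qed

lemma ck_on_inverse:
  fixes f :: "'a::euclidean_space \<Rightarrow> real"
  assumes "open S" and "\<And>x. x \<in> S \<Longrightarrow> f x \<noteq> 0" and "ck_on k S f"
  shows "ck_on k S (\<lambda>x. inverse (f x))"
  using assms(3)
proof (induction k)
  case 0
  then show ?case using assms(2) by (auto intro: continuous_on_inverse)
next
  case (Suc k)
  show ?case
  proof (rule ck_on_SucI[OF assms(1)])
    show "((\<lambda>x. inverse (f x)) has_derivative
        (\<lambda>v. - (inverse (f x) * frechet_derivative f (at x) v * inverse (f x)))) (at x)" if "x \<in> S" for x
      by (rule Deriv.has_derivative_inverse[OF assms(2)[OF that] ck_on_Suc_imp_differentiable[OF Suc.prems that]])
    have i: "ck_on k S (\<lambda>x. inverse (f x))" by (rule Suc.IH[OF ck_on_SucD[OF Suc.prems]])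
    fix v
    have d: "ck_on k S (\<lambda>x. frechet_derivative f (at x) v)" using Suc.prems by simp
    note m = ck_on_bounded_bilinear[OF assms(1) bounded_bilinear_mult]
    have "ck_on k S (\<lambda>x. (- 1) * (inverse (f x) * frechet_derivative f (at x) v * inverse (f x)))"
      by (intro m i d ck_on_const)
    then show "ck_on k S (\<lambda>x. - (inverse (f x) * frechet_derivative f (at x) v * inverse (f x)))"
      by simp
  qed
qed

lemma smooth_onD: "smooth_on S f \<Longrightarrow> ck_on k S f"
  by (simp add: smooth_on_def)

lemma smooth_on_subset: "smooth_on S f \<Longrightarrow> T \<subseteq> S \<Longrightarrow> smooth_on T f"
  unfolding smooth_on_def by (blast intro: ck_on_subset)

lemma smooth_on_empty [simp]: "smooth_on {} f"
  unfolding smooth_on_def by (intro allI ck_on_local) simp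

lemma smooth_on_cong:
  assumes "open S" and "\<And>x. x \<in> S \<Longrightarrow> f x = g x" and "smooth_on S f"
  shows "smooth_on S g"
  unfolding smooth_on_def
  by (intro allI ck_on_cong[OF assms(1,2) smooth_onD[OF assms(3)]])

lemma smooth_on_local:
  assumes "\<And>x. x \<in> S \<Longrightarrow> \<exists>T. open T \<and> x \<in> T \<and> smooth_on T f"
  shows "smooth_on S f"
  unfolding smooth_on_def
proof (intro allI ck_on_local)
  fix k x assume "x \<in> S"
  then show "\<exists>T. open T \<and> x \<in> T \<and> ck_on k T f" using assms[of x] smooth_onD by blast
qed

lemma smooth_on_imp_has_derivative:
  "smooth_on S f \<Longrightarrow> x \<in> S \<Longrightarrow> (f has_derivative frechet_derivative f (at x)) (at x)"
  using smooth_onD[of S f "Suc 0"] ck_on_Suc_imp_differentiable by blast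

lemma smooth_on_imp_continuous_on: "smooth_on S f \<Longrightarrow> continuous_on S f"
  using smooth_onD[of S f 0] by simp

lemma smooth_on_const: "smooth_on S (\<lambda>x. c)"
  by (simp add: smooth_on_def ck_on_const)

lemma smooth_on_bounded_linear: "open S \<Longrightarrow> bounded_linear h \<Longrightarrow> smooth_on S h"
  by (simp add: smooth_on_def ck_on_bounded_linear)

lemma smooth_on_bounded_linear_comp:
  "open S \<Longrightarrow> bounded_linear h \<Longrightarrow> smooth_on S f \<Longrightarrow> smooth_on S (\<lambda>x. h (f x))"
  by (simp add: smooth_on_def ck_on_bounded_linear_comp)

lemma smooth_on_bounded_bilinear:
  "open S \<Longrightarrow> bounded_bilinear pr \<Longrightarrow> smooth_on S f \<Longrightarrow> smooth_on S g \<Longrightarrow>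
    smooth_on S (\<lambda>x. pr (f x) (g x))"
  by (simp add: smooth_on_def ck_on_bounded_bilinear)

lemma smooth_on_add:
  "open S \<Longrightarrow> smooth_on S f \<Longrightarrow> smooth_on S g \<Longrightarrow> smooth_on S (\<lambda>x. f x + g x)"
  by (simp add: smooth_on_def ck_on_add)

lemma smooth_on_minus:
  assumes "open S" and "smooth_on S f"
  shows "smooth_on S (\<lambda>x. - f x)"
  by (rule smooth_on_bounded_linear_comp[OF assms(1) _ assms(2)])
    (rule bounded_linear_minus[OF bounded_linear_ident])

lemma smooth_on_diff:
  "open S \<Longrightarrow> smooth_on S f \<Longrightarrow> smooth_on S g \<Longrightarrow> smooth_on S (\<lambda>x. f x - g x)"
  using smooth_on_add[of S f "\<lambda>x. - g x"] smooth_on_minus[of S g] by simp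

lemma smooth_on_sum:
  "open S \<Longrightarrow> (\<And>i. i \<in> I \<Longrightarrow> smooth_on S (f i)) \<Longrightarrow> smooth_on S (\<lambda>x. \<Sum>i\<in>I. f i x)"
  by (simp add: smooth_on_def ck_on_sum)

lemma smooth_on_mult:
  fixes f g :: "'a::euclidean_space \<Rightarrow> real"
  shows "open S \<Longrightarrow> smooth_on S f \<Longrightarrow> smooth_on S g \<Longrightarrow> smooth_on S (\<lambda>x. f x * g x)"
  by (rule smooth_on_bounded_bilinear[OF _ bounded_bilinear_mult])

lemma smooth_on_inverse:
  fixes f :: "'a::euclidean_space \<Rightarrow> real"
  shows "open S \<Longrightarrow> (\<And>x. x \<in> S \<Longrightarrow> f x \<noteq> 0) \<Longrightarrow> smooth_on S f \<Longrightarrow> smooth_on S (\<lambda>x. inverse (f x))"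
  by (simp add: smooth_on_def ck_on_inverse)

lemma smooth_on_compose:
  fixes f :: "'a::euclidean_space \<Rightarrow> 'c::euclidean_space"
  assumes "open S" "open T" "smooth_on T g" "smooth_on S f" "\<And>x. x \<in> S \<Longrightarrow> f x \<in> T"
  shows "smooth_on S (\<lambda>x. g (f x))"
  unfolding smooth_on_def
proof
  fix k
  have "f ` S \<subseteq> T" using assms(5) by auto
  then show "ck_on k S (\<lambda>x. g (f x))"
    by (rule ck_on_compose[OF assms(1,2) _ smooth_onD[OF assms(3)] smooth_onD[OF assms(4)]])
qed

lemma smooth_on_Pair:
  assumes "open S" "smooth_on S f" "smooth_on S g"
  shows "smooth_on S (\<lambda>x. (f x, g x))"
proof -
  have "bounded_linear (\<lambda>y. (y, 0))" "bounded_linear (\<lambda>y. (0, y))"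
    by (intro bounded_linear_Pair bounded_linear_ident bounded_linear_zero)+
  from smooth_on_add[OF assms(1) smooth_on_bounded_linear_comp[OF assms(1) this(1) assms(2)]
      smooth_on_bounded_linear_comp[OF assms(1) this(2) assms(3)]]
  show ?thesis by simp
qed

lemma smooth_on_frechet_derivative:
  assumes "smooth_on S f"
  shows "smooth_on S (\<lambda>x. frechet_derivative f (at x) v)"
  unfolding smooth_on_def
proof
  fix k show "ck_on k S (\<lambda>x. frechet_derivative f (at x) v)"
    using smooth_onD[OF assms, of "Suc k"] by simp
qed

text \<open>Here both the point and the direction vary, as they do in the law \<open>y' = (dt/dt') (\<partial>x'/\<partial>x) y\<close>
  for the velocity coordinates.\<close>

lemma smooth_on_frechet_derivative_along:
  fixes a v :: "'a::euclidean_space \<Rightarrow> 'c::euclidean_space"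
  assumes "open S" "open T" "smooth_on T g" "smooth_on S a" "smooth_on S v" "\<And>x. x \<in> S \<Longrightarrow> a x \<in> T"
  shows "smooth_on S (\<lambda>x. frechet_derivative g (at (a x)) (v x))"
proof -
  have eq: "(\<Sum>b\<in>Basis. (v x \<bullet> b) *\<^sub>R frechet_derivative g (at (a x)) b) = frechet_derivative g (at (a x)) (v x)"
    if "x \<in> S" for x
  proof -
    show ?thesis
      by (rule linear_componentwise_expansion[OF has_derivative_linear])
        (rule smooth_on_imp_has_derivative[OF assms(3) assms(6)[OF that]])
  qed
  show ?thesis
  proof (rule smooth_on_cong[OF assms(1) eq])
    show "smooth_on S (\<lambda>x. \<Sum>b\<in>Basis. (v x \<bullet> b) *\<^sub>R frechet_derivative g (at (a x)) b)"
      by (rule smooth_on_sum[OF assms(1)],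
          rule smooth_on_bounded_bilinear[OF assms(1) bounded_bilinear_scaleR
            smooth_on_bounded_linear_comp[OF assms(1) bounded_linear_inner_left assms(5)]
            smooth_on_compose[OF assms(1,2) smooth_on_frechet_derivative[OF assms(3)] assms(4) assms(6)]])
  qed
qed

text \<open>The mean value theorem, applied in the direction \<open>u\<close> and then in the direction \<open>v\<close>. The second
  difference is symmetric in \<open>u\<close> and \<open>v\<close>, so dividing by \<open>h\<^sup>2\<close> and letting \<open>h\<close> tend to \<open>0\<close> yields
  the symmetry of second derivatives.\<close>

lemma second_difference_mean_value:
  fixes f :: "'a::euclidean_space \<Rightarrow> real"
  assumes h: "0 < h" and sm: "smooth_on S f"
    and S: "\<And>s t. 0 \<le> s \<Longrightarrow> s \<le> h \<Longrightarrow> 0 \<le> t \<Longrightarrow> t \<le> h \<Longrightarrow> x + s *\<^sub>R u + t *\<^sub>R v \<in> S"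
  shows "\<exists>s t. 0 \<le> s \<and> s \<le> h \<and> 0 \<le> t \<and> t \<le> h \<and>
    f (x + h *\<^sub>R u + h *\<^sub>R v) - f (x + h *\<^sub>R u) - f (x + h *\<^sub>R v) + f x =
    h * h * frechet_derivative (\<lambda>z. frechet_derivative f (at z) u) (at (x + s *\<^sub>R u + t *\<^sub>R v)) v"
proof -
  let ?F = "\<lambda>z. frechet_derivative f (at z)"
  have line: "((\<lambda>s. g (y + s *\<^sub>R w)) has_derivative (\<lambda>r. r * frechet_derivative g (at (y + s *\<^sub>R w)) w)) (at s)"
    if "smooth_on S g" "y + s *\<^sub>R w \<in> S" for g :: "'a \<Rightarrow> real" and y w s
  proof -
    let ?D = "frechet_derivative g (at (y + s *\<^sub>R w))"
    have d: "(g has_derivative ?D) (at (y + s *\<^sub>R w))" by (rule smooth_on_imp_has_derivative[OF that])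
    have "((\<lambda>s. y + s *\<^sub>R w) has_derivative (\<lambda>r. r *\<^sub>R w)) (at s)"
      by (auto intro!: derivative_eq_intros)
    from has_derivative_compose[OF this d] show ?thesis
      by (simp add: linear_cmul[OF has_derivative_linear[OF d]])
  qed
  define \<phi> where "\<phi> s = f ((x + h *\<^sub>R v) + s *\<^sub>R u) - f (x + s *\<^sub>R u)" for s
  have "\<exists>s. 0 < s \<and> s < h \<and> \<phi> h - \<phi> 0 = (h - 0) * (?F ((x + h *\<^sub>R v) + s *\<^sub>R u) u - ?F (x + s *\<^sub>R u) u)"
  proof (rule MVT2[OF h])
    fix s assume s: "0 \<le> s" "s \<le> h"
    have in_S: "(x + h *\<^sub>R v) + s *\<^sub>R u \<in> S" "x + s *\<^sub>R u \<in> S"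
      using S[OF s, of h] S[OF s, of 0] h by (simp_all add: algebra_simps)
    have eq: "(*) (?F ((x + h *\<^sub>R v) + s *\<^sub>R u) u - ?F (x + s *\<^sub>R u) u) =
        (\<lambda>r. r * ?F ((x + h *\<^sub>R v) + s *\<^sub>R u) u - r * ?F (x + s *\<^sub>R u) u)"
      by (simp add: fun_eq_iff algebra_simps)
    show "(\<phi> has_real_derivative ?F ((x + h *\<^sub>R v) + s *\<^sub>R u) u - ?F (x + s *\<^sub>R u) u) (at s)"
      unfolding \<phi>_def has_field_derivative_def eq
      by (rule has_derivative_diff[OF line[OF sm in_S(1)] line[OF sm in_S(2)]])
  qed
  then obtain s where s: "0 < s" "s < h"
    and 1: "\<phi> h - \<phi> 0 = h * (?F ((x + s *\<^sub>R u) + h *\<^sub>R v) u - ?F (x + s *\<^sub>R u) u)"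
    by (auto simp: algebra_simps)
  have "\<exists>t. 0 < t \<and> t < h \<and> ?F ((x + s *\<^sub>R u) + h *\<^sub>R v) u - ?F ((x + s *\<^sub>R u) + 0 *\<^sub>R v) u
      = (h - 0) * frechet_derivative (\<lambda>z. ?F z u) (at ((x + s *\<^sub>R u) + t *\<^sub>R v)) v"
  proof (rule MVT2[OF h])
    fix t assume t: "0 \<le> t" "t \<le> h"
    have "(x + s *\<^sub>R u) + t *\<^sub>R v \<in> S" using S[of s t] s t by simp
    note der = line[OF smooth_on_frechet_derivative[OF sm] this]
    have "(*) c = (\<lambda>r. r * c)" for c :: real by (simp add: fun_eq_iff)
    from der[folded this]
    show "((\<lambda>t. ?F ((x + s *\<^sub>R u) + t *\<^sub>R v) u) has_real_derivative
        frechet_derivative (\<lambda>z. ?F z u) (at ((x + s *\<^sub>R u) + t *\<^sub>R v)) v) (at t)"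
      by (simp only: has_field_derivative_def)
  qed
  then obtain t where t: "0 < t" "t < h"
    and 2: "?F ((x + s *\<^sub>R u) + h *\<^sub>R v) u - ?F (x + s *\<^sub>R u) u
      = h * frechet_derivative (\<lambda>z. ?F z u) (at ((x + s *\<^sub>R u) + t *\<^sub>R v)) v" by auto
  have "\<phi> h - \<phi> 0 = f (x + h *\<^sub>R u + h *\<^sub>R v) - f (x + h *\<^sub>R u) - f (x + h *\<^sub>R v) + f x"
    by (simp add: \<phi>_def algebra_simps)
  with 1 2 s t show ?thesis by (intro exI[of _ s] exI[of _ t]) auto
qed

lemma frechet_derivative_commute:
  fixes f :: "'a::euclidean_space \<Rightarrow> real"
  assumes "open S" "smooth_on S f" "x \<in> S"
  shows "frechet_derivative (\<lambda>z. frechet_derivative f (at z) u) (at x) v =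
    frechet_derivative (\<lambda>z. frechet_derivative f (at z) v) (at x) u"
proof -
  define P where "P = (\<lambda>z. frechet_derivative (\<lambda>z. frechet_derivative f (at z) u) (at z) v)"
  define Q where "Q = (\<lambda>z. frechet_derivative (\<lambda>z. frechet_derivative f (at z) v) (at z) u)"
  have "continuous_on S P" "continuous_on S Q"
    unfolding P_def Q_def
    by (intro smooth_on_imp_continuous_on smooth_on_frechet_derivative assms)+
  then have cont: "isCont P x" "isCont Q x" using assms by (auto simp: continuous_on_eq_continuous_at)
  have "\<bar>P x - Q x\<bar> \<le> e" if e: "e > 0" for e
  proof -
    obtain d1 where d1: "d1 > 0" "\<And>y. dist y x < d1 \<Longrightarrow> dist (P y) (P x) < e / 2"
      using cont(1)[unfolded continuous_at_eps_delta, rule_format, of "e / 2"] e by auto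
    obtain d2 where d2: "d2 > 0" "\<And>y. dist y x < d2 \<Longrightarrow> dist (Q y) (Q x) < e / 2"
      using cont(2)[unfolded continuous_at_eps_delta, rule_format, of "e / 2"] e by auto
    obtain d3 where d3: "d3 > 0" "ball x d3 \<subseteq> S" using assms by (meson open_contains_ball)
    define d where "d = min d1 (min d2 d3)"
    have d: "d > 0" using d1 d2 d3 by (simp add: d_def)
    define h where "h = d / (norm u + norm v + 1)"
    have h: "h > 0" using d by (simp add: h_def add_nonneg_pos)
    have near: "dist (x + s *\<^sub>R u + t *\<^sub>R v) x < d" if "0 \<le> s" "s \<le> h" "0 \<le> t" "t \<le> h" for s t
    proof -
      have "norm (s *\<^sub>R u + t *\<^sub>R v) \<le> s * norm u + t * norm v"
        using norm_triangle_ineq[of "s *\<^sub>R u" "t *\<^sub>R v"] that by simp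
      also have "\<dots> \<le> h * norm u + h * norm v"
        using that by (intro add_mono mult_right_mono) auto
      also have "\<dots> < h * (norm u + norm v + 1)" using h by (simp add: algebra_simps)
      also have "h * (norm u + norm v + 1) = d"
      proof -
        have "norm u + norm v + 1 \<noteq> 0" using norm_ge_zero[of u] norm_ge_zero[of v] by linarith
        then show ?thesis by (simp add: h_def)
      qed
      finally show ?thesis by (simp add: dist_norm add.assoc)
    qed
    have inS: "x + s *\<^sub>R u + t *\<^sub>R v \<in> S" if "0 \<le> s" "s \<le> h" "0 \<le> t" "t \<le> h" for s t
      using near[OF that] d3 by (auto simp: d_def dist_commute subset_eq)
    have inS': "x + s *\<^sub>R v + t *\<^sub>R u \<in> S" if "0 \<le> s" "s \<le> h" "0 \<le> t" "t \<le> h" for s t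
      using inS[OF that(3,4,1,2)] by (simp add: algebra_simps)
    let ?\<Delta> = "f (x + h *\<^sub>R u + h *\<^sub>R v) - f (x + h *\<^sub>R u) - f (x + h *\<^sub>R v) + f x"
    obtain s t where st: "0 \<le> s" "s \<le> h" "0 \<le> t" "t \<le> h" "?\<Delta> = h * h * P (x + s *\<^sub>R u + t *\<^sub>R v)"
      using second_difference_mean_value[OF h assms(2) inS] unfolding P_def by blast
    obtain t' s' where st': "0 \<le> s'" "s' \<le> h" "0 \<le> t'" "t' \<le> h"
      "f (x + h *\<^sub>R v + h *\<^sub>R u) - f (x + h *\<^sub>R v) - f (x + h *\<^sub>R u) + f x = h * h * Q (x + t' *\<^sub>R v + s' *\<^sub>R u)"
      using second_difference_mean_value[OF h assms(2) inS'] unfolding Q_def by blast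
    have "?\<Delta> = h * h * Q (x + s' *\<^sub>R u + t' *\<^sub>R v)" using st'(5) by (simp add: algebra_simps)
    with st(5) h have "P (x + s *\<^sub>R u + t *\<^sub>R v) = Q (x + s' *\<^sub>R u + t' *\<^sub>R v)" by simp
    moreover have "dist (P (x + s *\<^sub>R u + t *\<^sub>R v)) (P x) < e / 2"
      using near[OF st(1-4)] by (intro d1) (simp add: d_def)
    moreover have "dist (Q (x + s' *\<^sub>R u + t' *\<^sub>R v)) (Q x) < e / 2"
      using near[OF st'(1-4)] by (intro d2) (simp add: d_def)
    ultimately show ?thesis unfolding dist_real_def by linarith
  qed
  then have "\<bar>P x - Q x\<bar> \<le> 0" by (rule dense_ge)
  then show ?thesis by (simp add: P_def Q_def)
qed

section \<open>Bump functions\<close>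

text \<open>The function \<open>exp (- 1 / x) / x ^ k\<close>, extended by \<open>0\<close>. With the powers of \<open>x\<close> in the denominator the
  span of the family is closed under differentiation, so that all its members are smooth as soon as
  they are differentiable.\<close>

definition flat :: "nat \<Rightarrow> real \<Rightarrow> real" where
  "flat k x = (if x > 0 then inverse x ^ k / exp (inverse x) else 0)"

lemma flat_tendsto_0: "(flat k \<longlongrightarrow> 0) (at 0)"
proof -
  have "((\<lambda>x. inverse x ^ k / exp (inverse x)) \<longlongrightarrow> 0) (at_right (0::real))"
    by (rule filterlim_compose[OF tendsto_power_div_exp_0 filterlim_inverse_at_top_right])
  then have r: "(flat k \<longlongrightarrow> 0) (at_right 0)"
    by (rule Lim_transform_eventually) (auto simp: flat_def eventually_at_filter)
  have l: "(flat k \<longlongrightarrow> 0) (at_left 0)"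
    by (rule tendsto_eventually) (auto simp: flat_def eventually_at_filter)
  show ?thesis by (rule filterlim_split_at[OF l r])
qed

lemma has_real_derivative_flat:
  "(flat k has_real_derivative flat (k + 2) x - real k * flat (k + 1) x) (at x)"
proof -
  consider "x < 0" | "x = 0" | "x > 0" by linarith
  then show ?thesis
  proof cases
    case 1
    have "((\<lambda>x. 0) has_real_derivative 0) (at x)" by simp
    then have "(flat k has_real_derivative 0) (at x)"
      by (rule has_field_derivative_transform_within_open[where S = "{..<0}"])
        (use 1 in \<open>auto simp: flat_def\<close>)
    then show ?thesis using 1 by (simp add: flat_def)
  next
    case 2
    have "(flat k (0 + h) - flat k 0) / h = flat (k + 1) h" for h
      by (simp add: flat_def field_simps)
    then have "(flat k has_real_derivative 0) (at 0)"
      unfolding DERIV_def using flat_tendsto_0[of "k + 1"] by simp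
    then show ?thesis using 2 by (simp add: flat_def)
  next
    case 3
    define y where "y = inverse x"
    have "(inverse has_real_derivative - (y\<^sup>2)) (at x)"
      using DERIV_inverse[of x UNIV] 3 by (simp add: y_def numeral_2_eq_2)
    from DERIV_mult[OF DERIV_power[OF this, of k] DERIV_fun_exp[OF DERIV_minus[OF this]]]
    have "((\<lambda>x. inverse x ^ k * exp (- inverse x)) has_real_derivative
        real k * (- (y\<^sup>2) * y ^ (k - Suc 0)) * exp (- y) + exp (- y) * - (- (y\<^sup>2)) * y ^ k) (at x)"
      by (simp add: y_def)
    moreover have "real k * (- (y\<^sup>2) * y ^ (k - Suc 0)) * exp (- y) + exp (- y) * - (- (y\<^sup>2)) * y ^ k =
        flat (k + 2) x - real k * flat (k + 1) x"
      using 3 by (cases k)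
        (simp_all add: flat_def y_def[symmetric] exp_minus divide_inverse power2_eq_square algebra_simps)
    ultimately have "((\<lambda>x. inverse x ^ k * exp (- inverse x)) has_real_derivative
        flat (k + 2) x - real k * flat (k + 1) x) (at x)" by simp
    then show ?thesis
      by (rule has_field_derivative_transform_within_open[where S = "{0<..}"])
        (use 3 in \<open>auto simp: flat_def exp_minus field_simps\<close>)
  qed
qed

lemma smooth_on_flat: "smooth_on UNIV (flat k)"
proof -
  have "ck_on n UNIV (flat k)" for n k
  proof (induction n arbitrary: k)
    case 0
    show ?case unfolding ck_on.simps
      by (rule continuous_at_imp_continuous_on) (blast intro: DERIV_isCont has_real_derivative_flat)
  next
    case (Suc n)
    show ?case
    proof (rule ck_on_SucI[OF open_UNIV])
      show "(flat k has_derivative (*) (flat (k + 2) x - real k * flat (k + 1) x)) (at x)" for x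
        using has_real_derivative_flat[of k x] by (simp only: has_field_derivative_def)
      fix v
      have "ck_on n UNIV (\<lambda>x. (flat (k + 2) x + (- real k) * flat (k + 1) x) * v)"
        by (rule ck_on_bounded_bilinear[OF open_UNIV bounded_bilinear_mult
            ck_on_add[OF open_UNIV Suc.IH
              ck_on_bounded_bilinear[OF open_UNIV bounded_bilinear_mult ck_on_const Suc.IH]] ck_on_const])
      then show "ck_on n UNIV (\<lambda>x. (flat (k + 2) x - real k * flat (k + 1) x) * v)" by simp
    qed
  qed
  then show ?thesis by (simp add: smooth_on_def)
qed

lemma bump_function:
  fixes z\<^sub>0 :: "'a::euclidean_space"
  assumes "r > 0"
  obtains b :: "'a \<Rightarrow> real" where "smooth_on UNIV b"
    and "\<And>z. dist z z\<^sub>0 < r / 2 \<Longrightarrow> b z = 1" and "\<And>z. r \<le> dist z z\<^sub>0 \<Longrightarrow> b z = 0"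
proof
  \<comment> \<open>\<open>step\<close> is \<open>0\<close> on \<open>x \<le> 0\<close> and \<open>1\<close> on \<open>x \<ge> 1\<close>; it is applied to an affine function of the squared distance\<close>
  define step where "step x = flat 0 x * inverse (flat 0 x + flat 0 (1 - x))" for x
  have pos: "flat 0 x + flat 0 (1 - x) \<noteq> 0" for x
    by (auto simp: flat_def add_pos_pos less_imp_neq[symmetric])
  have lin: "smooth_on UNIV (\<lambda>x::real. 1 - x)"
    by (rule smooth_on_diff[OF open_UNIV smooth_on_const smooth_on_bounded_linear[OF open_UNIV bounded_linear_ident]])
  have "smooth_on UNIV step"
    unfolding step_def
    by (rule smooth_on_mult[OF open_UNIV smooth_on_flat smooth_on_inverse[OF open_UNIV pos
          smooth_on_add[OF open_UNIV smooth_on_flat smooth_on_compose[OF open_UNIV open_UNIV smooth_on_flat lin UNIV_I]]]])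
  define q where "q z = 2 - ((z - z\<^sub>0) \<bullet> (z - z\<^sub>0)) * (2 / r\<^sup>2)" for z
  have id: "smooth_on UNIV (\<lambda>z. z - z\<^sub>0)"
    by (rule smooth_on_diff[OF open_UNIV smooth_on_bounded_linear[OF open_UNIV bounded_linear_ident] smooth_on_const])
  have "smooth_on UNIV q"
    unfolding q_def
    by (rule smooth_on_diff[OF open_UNIV smooth_on_const smooth_on_mult[OF open_UNIV
          smooth_on_bounded_bilinear[OF open_UNIV bounded_bilinear_inner id id] smooth_on_const]])
  then show "smooth_on UNIV (\<lambda>z. step (q z))"
    by (rule smooth_on_compose[OF open_UNIV open_UNIV \<open>smooth_on UNIV step\<close> _ UNIV_I])
  have q: "q z = 2 - 2 * ((dist z z\<^sub>0)\<^sup>2 / r\<^sup>2)" for z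
    by (simp add: q_def dist_norm power2_norm_eq_inner)
  show "step (q z) = 1" if "dist z z\<^sub>0 < r / 2" for z
  proof -
    have "(dist z z\<^sub>0)\<^sup>2 \<le> (r / 2)\<^sup>2" using that by (intro power_mono) auto
    then have "4 * (dist z z\<^sub>0)\<^sup>2 \<le> r\<^sup>2" by (simp add: power_divide)
    moreover have "0 \<le> (dist z z\<^sub>0)\<^sup>2" by simp
    ultimately have "2 * (dist z z\<^sub>0)\<^sup>2 \<le> r\<^sup>2" by linarith
    then have "q z \<ge> 1" using assms by (simp add: q divide_le_eq)
    then show ?thesis by (simp add: step_def flat_def)
  qed
  show "step (q z) = 0" if "r \<le> dist z z\<^sub>0" for z
  proof -
    have "r\<^sup>2 \<le> (dist z z\<^sub>0)\<^sup>2" using that assms by (intro power_mono) auto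
    then have "q z \<le> 0" using assms by (simp add: q le_divide_eq)
    then show ?thesis by (simp add: step_def flat_def)
  qed
qed

section \<open>Charts and jets of curves\<close>

lemma is_chartD:
  assumes "is_chart (U, \<phi>)"
  shows "open U" "open (\<phi> ` U)" "inj_on \<phi> U" "continuous_on U \<phi>"
    "continuous_on (\<phi> ` U) (inv_into U \<phi>)"
  using assms unfolding is_chart_def homeomorphism_def
  by (auto intro: inj_on_inverseI)

lemma is_chart_open_image:
  assumes "is_chart (U, \<phi>)" "open V" "V \<subseteq> U"
  shows "open (\<phi> ` V)"
proof -
  note c = is_chartD[OF assms(1)]
  have "\<phi> ` V = {z \<in> \<phi> ` U. inv_into U \<phi> z \<in> V}"
    using assms(3) c(3) by (auto simp: inv_into_f_f subset_iff)
  moreover have "open (\<phi> ` U \<inter> inv_into U \<phi> -` V)"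
    by (rule continuous_open_preimage[OF c(5,2) assms(2)])
  ultimately show ?thesis by (simp add: vimage_def Int_def)
qed

lemma time_chartD:
  assumes "(I, \<tau>) \<in> time_charts"
  shows "is_chart (I, \<tau>)" "smooth_on I \<tau>" "smooth_on (\<tau> ` I) (inv_into I \<tau>)"
proof -
  have "inv_into UNIV (\<lambda>s::real. s) z = z" for z
    using inv_into_f_f[of "\<lambda>s. s" UNIV z] by simp
  then show "is_chart (I, \<tau>)" "smooth_on I \<tau>" "smooth_on (\<tau> ` I) (inv_into I \<tau>)"
    using assms unfolding time_charts_def smooth_compatible_def by simp_all
qed

text \<open>The speed \<open>ds/dt\<close> of the standard time \<open>s\<close> with respect to the time coordinate \<open>t\<close>.\<close>

definition clock_rate :: "(real, real) chart \<Rightarrow> real \<Rightarrow> real" where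
  "clock_rate c s = frechet_derivative (inv_into (fst c) (snd c)) (at (snd c s)) 1"

lemma linear_real_eq:
  fixes L :: "real \<Rightarrow> 'a::real_vector"
  assumes "linear L"
  shows "L = (\<lambda>h. h *\<^sub>R L 1)"
proof
  fix h
  have "L (h *\<^sub>R 1) = h *\<^sub>R L 1" by (rule linear_cmul[OF assms])
  then show "L h = h *\<^sub>R L 1" by simp
qed

lemma has_derivative_imp_has_vector_derivative:
  assumes "(f has_derivative L) (at s)"
  shows "(f has_vector_derivative L 1) (at s)"
proof -
  have eq: "(\<lambda>h. h *\<^sub>R L 1) = L" by (rule linear_real_eq[OF has_derivative_linear[OF assms], symmetric])
  show ?thesis unfolding has_vector_derivative_def eq by (rule assms)
qed

lemma has_vector_derivative_clock:
  assumes "(I, \<tau>) \<in> time_charts" "s \<in> I"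
  shows "(inv_into I \<tau> has_vector_derivative clock_rate (I, \<tau>) s) (at (\<tau> s))"
    and "(\<tau> has_vector_derivative inverse (clock_rate (I, \<tau>) s)) (at s)"
    and "clock_rate (I, \<tau>) s \<noteq> 0"
proof -
  note c = time_chartD[OF assms(1)]
  let ?\<kappa> = "clock_rate (I, \<tau>) s" and ?d = "frechet_derivative \<tau> (at s) 1"
  have "(inv_into I \<tau> has_derivative frechet_derivative (inv_into I \<tau>) (at (\<tau> s))) (at (\<tau> s))"
    using smooth_on_imp_has_derivative[OF c(3), of "\<tau> s"] assms(2) by blast
  then show 1: "(inv_into I \<tau> has_vector_derivative ?\<kappa>) (at (\<tau> s))"
    unfolding clock_rate_def fst_conv snd_conv by (rule has_derivative_imp_has_vector_derivative)
  have "(\<tau> has_derivative frechet_derivative \<tau> (at s)) (at s)"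
    using smooth_on_imp_has_derivative[OF c(2) assms(2)] .
  then have 2: "(\<tau> has_vector_derivative ?d) (at s)"
    by (rule has_derivative_imp_has_vector_derivative)
  have "((inv_into I \<tau> \<circ> \<tau>) has_vector_derivative ?d *\<^sub>R ?\<kappa>) (at s)"
    by (rule vector_diff_chain_at[OF 2 1])
  moreover have "((inv_into I \<tau> \<circ> \<tau>) has_vector_derivative 1) (at s)"
    by (rule has_vector_derivative_transform_within_open[where f = "\<lambda>s. s" and S = I])
      (use assms(2) is_chartD[OF c(1)] in \<open>auto simp: inv_into_f_f\<close>)
  ultimately have d\<kappa>: "?d * ?\<kappa> = 1" using vector_derivative_unique_at by force
  then show "?\<kappa> \<noteq> 0" by auto
  with d\<kappa> have "?d = inverse ?\<kappa>" by (simp add: field_simps)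
  with 2 show "(\<tau> has_vector_derivative inverse ?\<kappa>) (at s)" by simp
qed

lemma smooth_on_clock_rate:
  assumes "(I, \<tau>) \<in> time_charts"
  shows "smooth_on (\<tau> ` I) (\<lambda>t. clock_rate (I, \<tau>) (inv_into I \<tau> t))"
proof (rule smooth_on_cong[OF is_chartD(2)[OF time_chartD(1)[OF assms]]])
  show "smooth_on (\<tau> ` I) (\<lambda>t. frechet_derivative (inv_into I \<tau>) (at t) 1)"
    by (rule smooth_on_frechet_derivative[OF time_chartD(3)[OF assms]])
qed (auto simp: clock_rate_def f_inv_into_f)

locale smooth_manifold =
  fixes A :: "('m::t2_space, real^'n) chart set"
  assumes smooth_structure: "smooth_structure A"
begin

lemma chart: "c \<in> A \<Longrightarrow> is_chart c"
  using smooth_structure by (simp add: smooth_structure_def)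

lemma charts_cover: obtains c where "c \<in> A" "x \<in> fst c"
  using smooth_structure unfolding smooth_structure_def by blast

lemma chart_change_smooth:
  assumes "(U, \<phi>) \<in> A" "(V, \<psi>) \<in> A"
  shows "smooth_on (\<phi> ` (U \<inter> V)) (\<lambda>z. \<psi> (inv_into U \<phi> z))"
proof -
  have "smooth_compatible (U, \<phi>) (V, \<psi>)"
    using smooth_structure assms unfolding smooth_structure_def by blast
  then show ?thesis by (simp add: smooth_compatible_def)
qed

lemma curve_has_vector_derivative:
  assumes "smooth_curve_near A s \<gamma>" "(U, \<phi>) \<in> A" "\<gamma> s \<in> U"
  shows "((\<lambda>r. \<phi> (\<gamma> r)) has_vector_derivative vector_derivative (\<lambda>r. \<phi> (\<gamma> r)) (at s)) (at s)"
proof -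
  obtain J where J: "open J" "s \<in> J" "continuous_on J \<gamma>" "smooth_on (J \<inter> \<gamma> -` U) (\<lambda>r. \<phi> (\<gamma> r))"
    using assms(1,2) unfolding smooth_curve_near_def by fastforce
  then show ?thesis
    using smooth_on_imp_has_derivative[OF J(4), of s] assms(3)
    by (auto simp: vector_derivative_works[symmetric] differentiable_def)
qed

lemma curve_continuous: "smooth_curve_near A s \<gamma> \<Longrightarrow> isCont \<gamma> s"
  unfolding smooth_curve_near_def by (auto simp: continuous_on_eq_continuous_at)

text \<open>The chain rule for the change of charts, valid because a curve through a chart domain stays
  in it for a short time.\<close>

lemma velocity_chart_change:
  assumes "smooth_curve_near A s \<gamma>" "(U, \<phi>) \<in> A" "(V, \<psi>) \<in> A" "\<gamma> s \<in> U" "\<gamma> s \<in> V"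
  shows "vector_derivative (\<lambda>r. \<psi> (\<gamma> r)) (at s) =
    frechet_derivative (\<lambda>z. \<psi> (inv_into U \<phi> z)) (at (\<phi> (\<gamma> s))) (vector_derivative (\<lambda>r. \<phi> (\<gamma> r)) (at s))"
proof -
  let ?\<Phi> = "\<lambda>z. \<psi> (inv_into U \<phi> z)"
  note \<phi> = is_chartD[OF chart[OF assms(2)]]
  have "(?\<Phi> has_derivative frechet_derivative ?\<Phi> (at (\<phi> (\<gamma> s)))) (at (\<phi> (\<gamma> s)))"
    by (rule smooth_on_imp_has_derivative[OF chart_change_smooth[OF assms(2,3)]]) (use assms in auto)
  from vector_derivative_diff_chain_within[OF curve_has_vector_derivative[OF assms(1,2,4)]
      has_derivative_at_withinI[OF this]]
  have "((?\<Phi> \<circ> (\<lambda>r. \<phi> (\<gamma> r))) has_vector_derivative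
      frechet_derivative ?\<Phi> (at (\<phi> (\<gamma> s))) (vector_derivative (\<lambda>r. \<phi> (\<gamma> r)) (at s))) (at s)" .
  moreover have "eventually (\<lambda>r. \<gamma> r \<in> U) (nhds s)"
    using curve_continuous[OF assms(1)] \<phi>(1) assms(4)
    unfolding continuous_at_open eventually_nhds by blast
  then have "eventually (\<lambda>r. (?\<Phi> \<circ> (\<lambda>r. \<phi> (\<gamma> r))) r = \<psi> (\<gamma> r)) (nhds s)"
    by eventually_elim (simp add: inv_into_f_f[OF \<phi>(3)])
  ultimately have "((\<lambda>r. \<psi> (\<gamma> r)) has_vector_derivative
      frechet_derivative ?\<Phi> (at (\<phi> (\<gamma> s))) (vector_derivative (\<lambda>r. \<phi> (\<gamma> r)) (at s))) (at s)"
    by (subst (asm) has_vector_derivative_cong_ev) (auto simp: inv_into_f_f[OF \<phi>(3)] assms)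
  then show ?thesis by (rule vector_derivative_at)
qed

text \<open>Velocities in different charts determine each other by \<open>velocity_chart_change\<close>.\<close>

lemma same_first_orderI:
  assumes "smooth_curve_near A s \<gamma>" "smooth_curve_near A s \<eta>" "\<gamma> s = \<eta> s" "(U, \<phi>) \<in> A" "\<gamma> s \<in> U"
    "vector_derivative (\<lambda>r. \<phi> (\<gamma> r)) (at s) = vector_derivative (\<lambda>r. \<phi> (\<eta> r)) (at s)"
  shows "same_first_order A s \<gamma> \<eta>"
proof -
  have "vector_derivative (\<lambda>r. \<psi> (\<gamma> r)) (at s) = vector_derivative (\<lambda>r. \<psi> (\<eta> r)) (at s)"
    if V: "(V, \<psi>) \<in> A" "\<gamma> s \<in> V" for V \<psi>
    unfolding velocity_chart_change[OF assms(1,4) V(1) assms(5) V(2)]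
      velocity_chart_change[OF assms(2,4) V(1) assms(5)[unfolded assms(3)] V(2)[unfolded assms(3)]]
    by (simp only: assms(3,6))
  then show ?thesis using assms(3) by (auto simp: same_first_order_def)
qed

lemma jet_of_rep:
  assumes "smooth_curve_near A s \<gamma>"
  defines "e \<equiv> jet_of A s \<gamma>"
  shows "e \<in> jet_space A" "fst e = s" "smooth_curve_near A s (jet_rep e)"
    "same_first_order A s \<gamma> (jet_rep e)" "jet_point e = \<gamma> s"
proof -
  show "e \<in> jet_space A" "fst e = s" using assms by (auto simp: jet_space_def jet_of_def)
  have "same_first_order A s \<gamma> \<gamma>" by (auto simp: same_first_order_def)
  then have "\<gamma> \<in> snd e" using assms by (simp add: jet_of_def)
  then have "jet_rep e \<in> snd e" unfolding jet_rep_def by (rule someI[of "\<lambda>\<gamma>. \<gamma> \<in> snd e"])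
  then show "smooth_curve_near A s (jet_rep e)" "same_first_order A s \<gamma> (jet_rep e)"
    by (auto simp: e_def jet_of_def)
  then show "jet_point e = \<gamma> s" using \<open>fst e = s\<close> by (simp add: jet_point_def same_first_order_def)
qed

lemma jet_rep_smooth: "e \<in> jet_space A \<Longrightarrow> smooth_curve_near A (fst e) (jet_rep e)"
  using jet_of_rep(2,3) by (auto simp: jet_space_def)

lemma jet_eqI:
  assumes "e \<in> jet_space A" "e' \<in> jet_space A" "fst e = fst e'"
    "same_first_order A (fst e) (jet_rep e) (jet_rep e')"
  shows "e = e'"
proof -
  have trans: "same_first_order A s \<gamma> \<zeta>" if "same_first_order A s \<gamma> \<eta>" "same_first_order A s \<eta> \<zeta>" for s \<gamma> \<eta> \<zeta>
    using that by (fastforce simp: same_first_order_def)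
  have sym: "same_first_order A s \<eta> \<gamma>" if "same_first_order A s \<gamma> \<eta>" for s \<gamma> \<eta>
    using that by (fastforce simp: same_first_order_def)
  obtain \<gamma> where \<gamma>: "e = jet_of A (fst e) \<gamma>" "smooth_curve_near A (fst e) \<gamma>"
    using assms(1) jet_of_rep(2) by (auto simp: jet_space_def)
  obtain \<eta> where \<eta>: "e' = jet_of A (fst e) \<eta>" "smooth_curve_near A (fst e) \<eta>"
    using assms(2,3) jet_of_rep(2) by (auto simp: jet_space_def)
  have "same_first_order A (fst e) \<gamma> \<eta>"
    using jet_of_rep(4)[OF \<gamma>(2)] jet_of_rep(4)[OF \<eta>(2)] assms(4)
    unfolding \<gamma>(1)[symmetric] \<eta>(1)[symmetric] by (blast intro: trans sym)
  then have "same_first_order A (fst e) \<gamma> \<zeta> \<longleftrightarrow> same_first_order A (fst e) \<eta> \<zeta>" for \<zeta>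
    using trans sym by blast
  then have "jet_of A (fst e) \<gamma> = jet_of A (fst e) \<eta>"
    unfolding jet_of_def by simp
  then show ?thesis using \<gamma>(1) \<eta>(1) by simp
qed

section \<open>Induced charts of the jet space\<close>

lemma jchartsD:
  assumes "C \<in> jcharts A"
  obtains I \<tau> U \<phi> where "C = ((I, \<tau>), (U, \<phi>))" "(I, \<tau>) \<in> time_charts" "(U, \<phi>) \<in> A"
  using assms by (auto simp: jcharts_def)

text \<open>The velocity with respect to the standard time, independent of the time coordinate.\<close>

definition velocity :: "('m, real^'n) chart \<Rightarrow> 'm jet \<Rightarrow> real^'n" where
  "velocity c e = vector_derivative (\<lambda>r. snd c (jet_rep e r)) (at (fst e))"

lemma jcoord_eq:
  assumes "C \<in> jcharts A" "e \<in> jdom A C"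
  shows "jcoord C e = (snd (fst C) (fst e), snd (snd C) (jet_point e),
    clock_rate (fst C) (fst e) *\<^sub>R velocity (snd C) e)"
proof -
  obtain I \<tau> U \<phi> where C: "C = ((I, \<tau>), (U, \<phi>))" "(I, \<tau>) \<in> time_charts" "(U, \<phi>) \<in> A"
    using assms(1) by (rule jchartsD)
  let ?s = "fst e"
  have e: "e \<in> jet_space A" "?s \<in> I" "jet_rep e ?s \<in> U"
    using assms(2) by (auto simp: jdom_def C jet_point_def)
  have inv: "inv_into I \<tau> (\<tau> ?s) = ?s"
    using is_chartD(3)[OF time_chartD(1)[OF C(2)]] e(2) by (rule inv_into_f_f)
  have "((\<lambda>r. \<phi> (jet_rep e r)) has_vector_derivative velocity (U, \<phi>) e) (at (inv_into I \<tau> (\<tau> ?s)))"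
    using curve_has_vector_derivative[OF jet_rep_smooth[OF e(1)] C(3) e(3)] by (simp add: velocity_def inv)
  from vector_diff_chain_at[OF has_vector_derivative_clock(1)[OF C(2) e(2)] this]
  have "vector_derivative (\<lambda>r. \<phi> (jet_rep e (inv_into I \<tau> r))) (at (\<tau> ?s)) =
      clock_rate (I, \<tau>) ?s *\<^sub>R velocity (U, \<phi>) e"
    by (simp add: vector_derivative_at o_def)
  then show ?thesis
    by (simp add: jcoord_def C tco_def xco_def yco_def vec_eq_iff)
qed

lemma jet_space_covered:
  assumes "e \<in> jet_space A"
  obtains C where "C \<in> jcharts A" "e \<in> jdom A C"
proof -
  obtain c where "c \<in> A" "jet_point e \<in> fst c" by (rule charts_cover)
  moreover have "(UNIV, \<lambda>s. s) \<in> time_charts"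
  proof -
    have "inv_into UNIV (\<lambda>s::real. s) = (\<lambda>z. z)"
      using inv_into_f_f[of "\<lambda>s. s" UNIV] by auto
    then show ?thesis
      by (auto simp: time_charts_def is_chart_def smooth_compatible_def homeomorphism_def
          intro!: smooth_on_bounded_linear bounded_linear_ident)
  qed
  ultimately show ?thesis using assms that[of "((UNIV, \<lambda>s. s), c)"] by (auto simp: jcharts_def jdom_def)
qed

definition jets_over :: "real set \<Rightarrow> 'm set \<Rightarrow> 'm jet set" where
  "jets_over I U = {e \<in> jet_space A. fst e \<in> I \<and> jet_point e \<in> U}"

lemma jdom_eq: "jdom A C = jets_over (fst (fst C)) (fst (snd C))"
  by (simp add: jdom_def jets_over_def)

text \<open>The image is all of the product because every velocity is attained, by the curve that is a
  straight line in the chart of \<open>M\<close>.\<close>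

lemma jcoord_image:
  assumes C: "(I, \<tau>) \<in> time_charts" "(U, \<phi>) \<in> A" and sub: "I' \<subseteq> I" "U' \<subseteq> U"
  shows "jcoord ((I, \<tau>), (U, \<phi>)) ` jets_over I' U' = (\<tau> ` I') \<times> (\<phi> ` U') \<times> UNIV"
proof
  have CA: "((I, \<tau>), (U, \<phi>)) \<in> jcharts A" using C by (simp add: jcharts_def)
  have dom: "e \<in> jdom A ((I, \<tau>), (U, \<phi>))" if "e \<in> jets_over I' U'" for e
    using that sub by (auto simp: jets_over_def jdom_def)
  show "jcoord ((I, \<tau>), (U, \<phi>)) ` jets_over I' U' \<subseteq> (\<tau> ` I') \<times> (\<phi> ` U') \<times> UNIV"
    by (auto simp: jcoord_eq[OF CA dom]) (auto simp: jets_over_def)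
  note \<phi> = is_chartD[OF chart[OF C(2)]]
  show "(\<tau> ` I') \<times> (\<phi> ` U') \<times> UNIV \<subseteq> jcoord ((I, \<tau>), (U, \<phi>)) ` jets_over I' U'"
  proof
    fix z assume "z \<in> (\<tau> ` I') \<times> (\<phi> ` U') \<times> (UNIV :: (real^'n) set)"
    then obtain s x y where z: "z = (\<tau> s, \<phi> x, y)" "s \<in> I'" "x \<in> U'" by auto
    define v where "v = inverse (clock_rate (I, \<tau>) s) *\<^sub>R y"
    define ray where "ray r = \<phi> x + (r - s) *\<^sub>R v" for r
    define \<gamma> where "\<gamma> r = inv_into U \<phi> (ray r)" for r
    define J where "J = ray -` (\<phi> ` U)"
    have \<gamma>s: "\<gamma> s = x" using z sub \<phi>(3) by (auto simp: \<gamma>_def ray_def inv_into_f_f)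
    have cont_ray: "continuous_on UNIV ray" unfolding ray_def by (intro continuous_intros)
    have J: "open J" "s \<in> J" using open_vimage[OF \<phi>(2) cont_ray] z sub by (auto simp: J_def ray_def)
    have cont\<gamma>: "continuous_on J \<gamma>" unfolding \<gamma>_def
      by (rule continuous_on_compose2[OF \<phi>(5) continuous_on_subset[OF cont_ray]]) (auto simp: J_def)
    have "smooth_on UNIV (\<lambda>r. r *\<^sub>R v + (\<phi> x - s *\<^sub>R v))"
      by (rule smooth_on_add[OF open_UNIV smooth_on_bounded_linear[OF open_UNIV bounded_linear_scaleR_left] smooth_on_const])
    then have sm_ray: "smooth_on UNIV ray"
      by (rule smooth_on_cong[OF open_UNIV, rotated]) (simp add: ray_def algebra_simps)
    have "smooth_on (J \<inter> \<gamma> -` V) (\<lambda>r. \<psi> (\<gamma> r))" if V: "(V, \<psi>) \<in> A" for V \<psi>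
      unfolding \<gamma>_def
    proof (rule smooth_on_compose[OF _ _ chart_change_smooth[OF C(2) V] smooth_on_subset[OF sm_ray subset_UNIV]])
      show "open (J \<inter> (\<lambda>r. inv_into U \<phi> (ray r)) -` V)"
        using continuous_open_preimage[OF cont\<gamma> J(1) is_chartD(1)[OF chart[OF V]]]
        by (simp add: \<gamma>_def[abs_def])
      show "open (\<phi> ` (U \<inter> V))"
        by (rule is_chart_open_image[OF chart[OF C(2)]]) (use \<phi>(1) is_chartD(1)[OF chart[OF V]] in auto)
      fix r assume r: "r \<in> J \<inter> (\<lambda>r. inv_into U \<phi> (ray r)) -` V"
      then have "ray r \<in> \<phi> ` U" by (simp add: J_def)
      then have "\<phi> (inv_into U \<phi> (ray r)) = ray r" "inv_into U \<phi> (ray r) \<in> U"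
        by (auto intro: f_inv_into_f inv_into_into)
      then show "ray r \<in> \<phi> ` (U \<inter> V)" using r by (metis Int_iff image_eqI vimageD)
    qed
    then have sm: "smooth_curve_near A s \<gamma>"
      using J cont\<gamma> unfolding smooth_curve_near_def by auto
    define e where "e = jet_of A s \<gamma>"
    note e = jet_of_rep[OF sm, folded e_def]
    have "vector_derivative (\<lambda>r. \<phi> (\<gamma> r)) (at s) = v"
    proof (rule vector_derivative_at)
      have "(ray has_vector_derivative v) (at s)" unfolding ray_def
        by (auto intro!: derivative_eq_intros simp: has_vector_derivative_def)
      then show "((\<lambda>r. \<phi> (\<gamma> r)) has_vector_derivative v) (at s)"
        by (rule has_vector_derivative_transform_within_open[OF _ J])
          (auto simp: J_def \<gamma>_def f_inv_into_f)
    qed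
    then have "velocity (U, \<phi>) e = v"
      using e C(2) \<gamma>s z sub by (auto simp: velocity_def same_first_order_def)
    moreover have over: "e \<in> jets_over I' U'" using e z \<gamma>s by (auto simp: jets_over_def)
    moreover have "clock_rate (I, \<tau>) s \<noteq> 0"
      using has_vector_derivative_clock(3)[OF C(1)] z sub by blast
    ultimately have "jcoord ((I, \<tau>), (U, \<phi>)) e = z"
      using e \<gamma>s by (simp add: jcoord_eq[OF CA dom[OF over]] z v_def)
    then show "z \<in> jcoord ((I, \<tau>), (U, \<phi>)) ` jets_over I' U'" using over by blast
  qed
qed

text \<open>A jet consists of all curves with a given time, point and velocity, and the coordinates fix these
  three data.\<close>

lemma jcoord_inj:
  assumes "C \<in> jcharts A"
  shows "inj_on (jcoord C) (jdom A C)"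
proof (rule inj_onI)
  fix e e' assume e: "e \<in> jdom A C" and e': "e' \<in> jdom A C" and eq: "jcoord C e = jcoord C e'"
  obtain I \<tau> U \<phi> where C: "C = ((I, \<tau>), (U, \<phi>))" "(I, \<tau>) \<in> time_charts" "(U, \<phi>) \<in> A"
    using assms by (rule jchartsD)
  have d: "e \<in> jet_space A" "fst e \<in> I" "jet_rep e (fst e) \<in> U"
    "e' \<in> jet_space A" "fst e' \<in> I" "jet_rep e' (fst e') \<in> U"
    using e e' by (auto simp: jdom_def C jet_point_def)
  have coord: "\<tau> (fst e) = \<tau> (fst e')" "\<phi> (jet_point e) = \<phi> (jet_point e')"
    "clock_rate (I, \<tau>) (fst e) *\<^sub>R velocity (U, \<phi>) e = clock_rate (I, \<tau>) (fst e') *\<^sub>R velocity (U, \<phi>) e'"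
    using eq unfolding jcoord_eq[OF assms e] jcoord_eq[OF assms e'] by (auto simp: C)
  have s: "fst e = fst e'"
    using coord(1) d is_chartD(3)[OF time_chartD(1)[OF C(2)]] by (meson inj_onD)
  have x: "jet_rep e (fst e) = jet_rep e' (fst e)"
    using coord(2) d is_chartD(3)[OF chart[OF C(3)]] unfolding jet_point_def s by (meson inj_onD)
  have "velocity (U, \<phi>) e = velocity (U, \<phi>) e'"
    using coord(3) has_vector_derivative_clock(3)[OF C(2) d(2)] s by simp
  then have "same_first_order A (fst e) (jet_rep e) (jet_rep e')"
    using jet_rep_smooth[OF d(1)] jet_rep_smooth[OF d(4)] s x d C(3)
    by (intro same_first_orderI[of _ _ _ U \<phi>]) (auto simp: velocity_def)
  then show "e = e'" by (rule jet_eqI[OF d(1,4) s])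
qed

lemma jinv_jcoord: "C \<in> jcharts A \<Longrightarrow> e \<in> jdom A C \<Longrightarrow> jinv A C (jcoord C e) = e"
  unfolding jinv_def by (rule inv_into_f_f[OF jcoord_inj])

end

context smooth_manifold begin

section \<open>Topology and smooth functions of the jet space\<close>

lemma jopen_jets_over:
  assumes "open I'" "open U'"
  shows "jopen A (jets_over I' U')"
  unfolding jopen_def
proof (intro conjI ballI)
  show "jets_over I' U' \<subseteq> jet_space A" by (auto simp: jets_over_def)
  fix C assume "C \<in> jcharts A"
  then obtain I \<tau> U \<phi> where C: "C = ((I, \<tau>), (U, \<phi>))" "(I, \<tau>) \<in> time_charts" "(U, \<phi>) \<in> A"
    by (rule jchartsD)
  note \<tau> = time_chartD(1)[OF C(2)] and \<phi> = chart[OF C(3)]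
  have "jets_over I' U' \<inter> jdom A C = jets_over (I' \<inter> I) (U' \<inter> U)"
    by (auto simp: jdom_eq C(1) jets_over_def)
  moreover have "open (\<tau> ` (I' \<inter> I))" "open (\<phi> ` (U' \<inter> U))"
    by (rule is_chart_open_image[OF \<tau>] is_chart_open_image[OF \<phi>];
        use assms is_chartD(1)[OF \<tau>] is_chartD(1)[OF \<phi>] in auto)+
  ultimately show "open (jcoord C ` (jets_over I' U' \<inter> jdom A C))"
    by (simp add: C(1) jcoord_image[OF C(2,3)] open_Times)
qed

lemma jopen_jdom: "C \<in> jcharts A \<Longrightarrow> jopen A (jdom A C)"
  by (erule jchartsD)
    (auto simp: jdom_eq intro!: jopen_jets_over intro: is_chartD(1)[OF time_chartD(1)] is_chartD(1)[OF chart])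

lemma jopen_jet_space: "jopen A (jet_space A)"
proof -
  have "jet_space A = jets_over UNIV UNIV" by (auto simp: jets_over_def)
  then show ?thesis using jopen_jets_over[of UNIV UNIV] by simp
qed

lemma jopen_subset: "jopen A W \<Longrightarrow> W \<subseteq> jet_space A"
  by (simp add: jopen_def)

lemma jopen_Int:
  assumes "jopen A V" "jopen A W"
  shows "jopen A (V \<inter> W)"
  unfolding jopen_def
proof (intro conjI ballI)
  show "V \<inter> W \<subseteq> jet_space A" using jopen_subset[OF assms(1)] by auto
  fix C assume C: "C \<in> jcharts A"
  have "jcoord C ` ((V \<inter> jdom A C) \<inter> (W \<inter> jdom A C)) =
      jcoord C ` (V \<inter> jdom A C) \<inter> jcoord C ` (W \<inter> jdom A C)"
    by (rule inj_on_image_Int[OF jcoord_inj[OF C]]) auto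
  moreover have "(V \<inter> jdom A C) \<inter> (W \<inter> jdom A C) = V \<inter> W \<inter> jdom A C" by auto
  ultimately show "open (jcoord C ` (V \<inter> W \<inter> jdom A C))"
    using assms C by (simp add: jopen_def open_Int)
qed

lemma jopen_Un:
  assumes "jopen A V" "jopen A W"
  shows "jopen A (V \<union> W)"
  using assms unfolding jopen_def by (auto simp: Int_Un_distrib2 image_Un open_Un)

lemma open_jcoord_image: "jopen A W \<Longrightarrow> C \<in> jcharts A \<Longrightarrow> open (jcoord C ` (W \<inter> jdom A C))"
  by (simp add: jopen_def)

definition place_change :: "('m, 'n) jchart \<Rightarrow> ('m, 'n) jchart \<Rightarrow> real^'n \<Rightarrow> real^'n" where
  "place_change C C' x = snd (snd C') (inv_into (fst (snd C)) (snd (snd C)) x)"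

definition time_of :: "('m, 'n) jchart \<Rightarrow> real \<Rightarrow> real" where
  "time_of C = inv_into (fst (fst C)) (snd (fst C))"

text \<open>The change of coordinates \<open>t' = t'(t)\<close>, \<open>x' = x'(x)\<close>, \<open>y' = (dt/dt') (\<partial>x'/\<partial>x) y\<close>. The factor
  \<open>dt/dt'\<close> is written as \<open>(ds/dt') / (ds/dt)\<close> with the standard time \<open>s\<close>.\<close>

definition jet_change :: "('m, 'n) jchart \<Rightarrow> ('m, 'n) jchart \<Rightarrow>
    real \<times> (real^'n) \<times> (real^'n) \<Rightarrow> real \<times> (real^'n) \<times> (real^'n)" where
  "jet_change C C' z = (snd (fst C') (time_of C (fst z)), place_change C C' (fst (snd z)),
    (clock_rate (fst C') (time_of C (fst z)) * inverse (clock_rate (fst C) (time_of C (fst z)))) *\<^sub>R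
      frechet_derivative (place_change C C') (at (fst (snd z))) (snd (snd z)))"

lemma jcoord_change:
  assumes "C \<in> jcharts A" "C' \<in> jcharts A" "e \<in> jdom A C" "e \<in> jdom A C'"
  shows "jcoord C' e = jet_change C C' (jcoord C e)"
proof -
  obtain I \<tau> U \<phi> where C: "C = ((I, \<tau>), (U, \<phi>))" "(I, \<tau>) \<in> time_charts" "(U, \<phi>) \<in> A"
    using assms(1) by (rule jchartsD)
  obtain I' \<tau>' U' \<phi>' where C': "C' = ((I', \<tau>'), (U', \<phi>'))" "(I', \<tau>') \<in> time_charts" "(U', \<phi>') \<in> A"
    using assms(2) by (rule jchartsD)
  have e: "e \<in> jet_space A" "fst e \<in> I" "jet_rep e (fst e) \<in> U" "jet_rep e (fst e) \<in> U'"
    using assms(3,4) by (auto simp: jdom_def C(1) C'(1) jet_point_def)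
  have t: "time_of C (\<tau> (fst e)) = fst e"
    using inv_into_f_f[OF is_chartD(3)[OF time_chartD(1)[OF C(2)]] e(2)] by (simp add: time_of_def C(1))
  have x: "place_change C C' (\<phi> (jet_point e)) = \<phi>' (jet_point e)"
    using inv_into_f_f[OF is_chartD(3)[OF chart[OF C(3)]] e(3)]
    by (simp add: place_change_def C(1) C'(1) jet_point_def)
  let ?D = "frechet_derivative (place_change C C') (at (\<phi> (jet_point e)))"
  have pc: "place_change C C' = (\<lambda>z. \<phi>' (inv_into U \<phi> z))"
    by (simp add: fun_eq_iff place_change_def C(1) C'(1))
  have v: "velocity (U', \<phi>') e = ?D (velocity (U, \<phi>) e)"
    unfolding pc velocity_def jet_point_def snd_conv
    by (rule velocity_chart_change[OF jet_rep_smooth[OF e(1)] C(3) C'(3) e(3,4)])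
  have "\<phi> (jet_point e) \<in> \<phi> ` (U \<inter> U')" using e by (auto simp: jet_point_def)
  then have "linear ?D"
    unfolding pc
    by (intro has_derivative_linear[OF smooth_on_imp_has_derivative[OF chart_change_smooth[OF C(3) C'(3)]]])
  then have "?D (clock_rate (I, \<tau>) (fst e) *\<^sub>R velocity (U, \<phi>) e) =
      clock_rate (I, \<tau>) (fst e) *\<^sub>R velocity (U', \<phi>') e"
    by (simp add: linear_cmul v)
  moreover have "fst C = (I, \<tau>)" "snd C = (U, \<phi>)" "fst C' = (I', \<tau>')" "snd C' = (U', \<phi>')"
    by (simp_all add: C(1) C'(1))
  ultimately show ?thesis
    using has_vector_derivative_clock(3)[OF C(2) e(2)]
    unfolding jcoord_eq[OF assms(1,3)] jcoord_eq[OF assms(2,4)] jet_change_def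
    by (simp add: t x)
qed

lemma smooth_on_jet_change:
  assumes "C \<in> jcharts A" "C' \<in> jcharts A"
  shows "smooth_on (jcoord C ` (jdom A C' \<inter> jdom A C)) (jet_change C C')"
proof -
  obtain I \<tau> U \<phi> where C: "C = ((I, \<tau>), (U, \<phi>))" "(I, \<tau>) \<in> time_charts" "(U, \<phi>) \<in> A"
    using assms(1) by (rule jchartsD)
  obtain I' \<tau>' U' \<phi>' where C': "C' = ((I', \<tau>'), (U', \<phi>'))" "(I', \<tau>') \<in> time_charts" "(U', \<phi>') \<in> A"
    using assms(2) by (rule jchartsD)
  note \<tau> = time_chartD[OF C(2)] and \<tau>' = time_chartD[OF C'(2)]
  note c\<tau> = is_chartD[OF \<tau>(1)] and c\<tau>' = is_chartD[OF \<tau>'(1)]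
  let ?S = "jcoord C ` (jdom A C' \<inter> jdom A C)"
  let ?T = "\<tau> ` (I \<inter> I')" and ?X = "\<phi> ` (U \<inter> U')"
  have "jdom A C' \<inter> jdom A C = jets_over (I \<inter> I') (U \<inter> U')"
    by (auto simp: jdom_eq C(1) C'(1) jets_over_def)
  then have S: "?S = ?T \<times> ?X \<times> UNIV"
    by (simp add: C(1) jcoord_image[OF C(2,3)])
  have openS: "open ?S" by (rule open_jcoord_image[OF jopen_jdom[OF assms(2)] assms(1)])
  have openT: "open ?T" by (rule is_chart_open_image[OF \<tau>(1)]) (use c\<tau>(1) c\<tau>'(1) in auto)
  have openX: "open ?X"
    by (rule is_chart_open_image[OF chart[OF C(3)]])
      (use is_chartD(1)[OF chart[OF C(3)]] is_chartD(1)[OF chart[OF C'(3)]] in auto)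
  have pr: "smooth_on ?S fst" "smooth_on ?S (\<lambda>z. fst (snd z))" "smooth_on ?S (\<lambda>z. snd (snd z))"
    by (rule smooth_on_bounded_linear[OF openS];
        intro bounded_linear_fst bounded_linear_compose[OF bounded_linear_fst bounded_linear_snd]
          bounded_linear_compose[OF bounded_linear_snd bounded_linear_snd])+
  have inT: "fst z \<in> ?T" "fst (snd z) \<in> ?X" if "z \<in> ?S" for z
    using that unfolding S by auto
  have T_sub: "?T \<subseteq> \<tau> ` I" by auto
  have in_I': "time_of C t \<in> I'" if "t \<in> ?T" for t
    using that by (auto simp: time_of_def C(1) inv_into_f_f[OF c\<tau>(3)])
  have time_sm: "smooth_on ?T (time_of C)"
    using smooth_on_subset[OF \<tau>(3) T_sub] by (simp add: time_of_def C(1))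
  have tt': "smooth_on ?T (\<lambda>t. \<tau>' (time_of C t))"
    by (rule smooth_on_compose[OF openT c\<tau>'(1) \<tau>'(2) time_sm in_I'])
  have k: "smooth_on ?T (\<lambda>t. clock_rate (I, \<tau>) (time_of C t))"
    using smooth_on_subset[OF smooth_on_clock_rate[OF C(2)] T_sub] by (simp add: time_of_def C(1))
  have "smooth_on ?T (\<lambda>t. clock_rate (I', \<tau>') (inv_into I' \<tau>' (\<tau>' (time_of C t))))"
    by (rule smooth_on_compose[OF openT c\<tau>'(2) smooth_on_clock_rate[OF C'(2)] tt'])
      (use in_I' in blast)
  then have k': "smooth_on ?T (\<lambda>t. clock_rate (I', \<tau>') (time_of C t))"
    by (rule smooth_on_cong[OF openT, rotated]) (simp add: inv_into_f_f[OF c\<tau>'(3) in_I'])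
  have nz: "clock_rate (I, \<tau>) (time_of C t) \<noteq> 0" if "t \<in> ?T" for t
    using that has_vector_derivative_clock(3)[OF C(2)]
    by (auto simp: time_of_def C(1) inv_into_f_f[OF c\<tau>(3)])
  have pc: "smooth_on ?X (place_change C C')"
    using chart_change_smooth[OF C(3) C'(3)]
    by (simp add: place_change_def[abs_def] C(1) C'(1))
  have kk: "smooth_on ?T (\<lambda>t. clock_rate (I', \<tau>') (time_of C t) * inverse (clock_rate (I, \<tau>) (time_of C t)))"
    by (rule smooth_on_mult[OF openT k' smooth_on_inverse[OF openT nz k]])
  have "smooth_on ?S (\<lambda>z. (\<tau>' (time_of C (fst z)), place_change C C' (fst (snd z)),
    (clock_rate (I', \<tau>') (time_of C (fst z)) * inverse (clock_rate (I, \<tau>) (time_of C (fst z)))) *\<^sub>R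
      frechet_derivative (place_change C C') (at (fst (snd z))) (snd (snd z))))"
    by (rule smooth_on_Pair[OF openS smooth_on_compose[OF openS openT tt' pr(1) inT(1)]
        smooth_on_Pair[OF openS smooth_on_compose[OF openS openX pc pr(2) inT(2)]
          smooth_on_bounded_bilinear[OF openS bounded_bilinear_scaleR
            smooth_on_compose[OF openS openT kk pr(1) inT(1)]
            smooth_on_frechet_derivative_along[OF openS openX pc pr(2,3) inT(2)]]]])
  then show ?thesis by (simp add: jet_change_def[abs_def] C'(1) C(1)[symmetric]) (simp add: C(1))
qed

text \<open>The image of \<open>W\<close> in another chart is the preimage of its image in \<open>C\<close> under the continuous
  change of coordinates.\<close>

lemma jopen_chart:
  assumes C: "C \<in> jcharts A" and W: "W \<subseteq> jdom A C" "open (jcoord C ` W)"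
  shows "jopen A W"
  unfolding jopen_def
proof (intro conjI ballI)
  show "W \<subseteq> jet_space A" using W(1) by (auto simp: jdom_def)
  fix C' assume C': "C' \<in> jcharts A"
  let ?S = "jcoord C' ` (jdom A C \<inter> jdom A C')"
  have "open (?S \<inter> jet_change C' C -` (jcoord C ` W))"
    by (rule continuous_open_preimage[OF smooth_on_imp_continuous_on[OF smooth_on_jet_change[OF C' C]]
        open_jcoord_image[OF jopen_jdom[OF C] C'] W(2)])
  moreover have "?S \<inter> jet_change C' C -` (jcoord C ` W) = jcoord C' ` (W \<inter> jdom A C')"
  proof
    show "jcoord C' ` (W \<inter> jdom A C') \<subseteq> ?S \<inter> jet_change C' C -` (jcoord C ` W)"
    proof
      fix z assume "z \<in> jcoord C' ` (W \<inter> jdom A C')"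
      then obtain e where e: "z = jcoord C' e" "e \<in> W" "e \<in> jdom A C'" by blast
      then have "jet_change C' C z = jcoord C e"
        using jcoord_change[OF C' C, of e] W(1) by auto
      then show "z \<in> ?S \<inter> jet_change C' C -` (jcoord C ` W)" using e W(1) by auto
    qed
    show "?S \<inter> jet_change C' C -` (jcoord C ` W) \<subseteq> jcoord C' ` (W \<inter> jdom A C')"
    proof
      fix z assume "z \<in> ?S \<inter> jet_change C' C -` (jcoord C ` W)"
      then obtain e e' where e: "z = jcoord C' e" "e \<in> jdom A C" "e \<in> jdom A C'"
        "jet_change C' C z = jcoord C e'" "e' \<in> W" by blast
      then have "jcoord C e = jcoord C e'" using jcoord_change[OF C' C, of e] by simp
      then have "e = e'" using inj_onD[OF jcoord_inj[OF C]] e W(1) by blast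
      then show "z \<in> jcoord C' ` (W \<inter> jdom A C')" using e by blast
    qed
  qed
  ultimately show "open (jcoord C' ` (W \<inter> jdom A C'))" by simp
qed

text \<open>Changes of coordinates are smooth, so a function on the domain of \<open>C\<close> that is smooth in this one
  chart is smooth in all of them.\<close>

lemma jsmooth_on_chartI:
  assumes C: "C \<in> jcharts A" and W: "jopen A W" "W \<subseteq> jdom A C"
    and F: "smooth_on (jcoord C ` W) F" "\<And>e. e \<in> W \<Longrightarrow> f e = F (jcoord C e)"
  shows "jsmooth_on A W f"
  unfolding jsmooth_on_def
proof
  fix C' assume C': "C' \<in> jcharts A"
  let ?S = "jcoord C' ` (W \<inter> jdom A C')"
  have opS: "open ?S" by (rule open_jcoord_image[OF W(1) C'])
  have "W \<inter> jdom A C = W" using W(2) by auto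
  with open_jcoord_image[OF W(1) C] have opW: "open (jcoord C ` W)" by simp
  have eq: "F (jet_change C' C z) = f (jinv A C' z)" "jet_change C' C z \<in> jcoord C ` W" if z: "z \<in> ?S" for z
  proof -
    obtain e where e: "z = jcoord C' e" "e \<in> W" "e \<in> jdom A C'" using z by blast
    then have "jet_change C' C z = jcoord C e"
      using jcoord_change[OF C' C, of e] W(2) by auto
    then show "F (jet_change C' C z) = f (jinv A C' z)" "jet_change C' C z \<in> jcoord C ` W"
      using e F(2) jinv_jcoord[OF C'] by auto
  qed
  have "?S \<subseteq> jcoord C' ` (jdom A C \<inter> jdom A C')" using W(2) by auto
  then have "smooth_on ?S (jet_change C' C)" by (rule smooth_on_subset[OF smooth_on_jet_change[OF C' C]])
  from smooth_on_compose[OF opS opW F(1) this eq(2)]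
  show "smooth_on ?S (\<lambda>z. f (jinv A C' z))"
    by (rule smooth_on_cong[OF opS eq(1), rotated])
qed

lemma jsmooth_onD:
  "jsmooth_on A W f \<Longrightarrow> C \<in> jcharts A \<Longrightarrow> smooth_on (jcoord C ` (W \<inter> jdom A C)) (\<lambda>z. f (jinv A C z))"
  by (simp add: jsmooth_on_def)

lemma jsmooth_on_local:
  assumes "\<And>p. p \<in> V \<Longrightarrow> \<exists>W. jopen A W \<and> p \<in> W \<and> jsmooth_on A W f"
  shows "jsmooth_on A V f"
  unfolding jsmooth_on_def
proof (intro ballI smooth_on_local)
  fix C z assume C: "C \<in> jcharts A" and "z \<in> jcoord C ` (V \<inter> jdom A C)"
  then obtain p where p: "z = jcoord C p" "p \<in> V" "p \<in> jdom A C" by blast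
  then obtain W where "jopen A W" "p \<in> W" "jsmooth_on A W f" using assms by blast
  then show "\<exists>T. open T \<and> z \<in> T \<and> smooth_on T (\<lambda>z. f (jinv A C z))"
    using open_jcoord_image[OF _ C] jsmooth_onD[OF _ C] p by blast
qed

lemma jsmooth_on_subset: "jsmooth_on A W f \<Longrightarrow> V \<subseteq> W \<Longrightarrow> jsmooth_on A V f"
  unfolding jsmooth_on_def by (blast intro: smooth_on_subset)

lemma jsmooth_on_cong:
  assumes "jopen A W" "\<And>p. p \<in> W \<Longrightarrow> f p = g p" "jsmooth_on A W f"
  shows "jsmooth_on A W g"
  unfolding jsmooth_on_def
proof
  fix C assume C: "C \<in> jcharts A"
  show "smooth_on (jcoord C ` (W \<inter> jdom A C)) (\<lambda>z. g (jinv A C z))"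
    by (rule smooth_on_cong[OF open_jcoord_image[OF assms(1) C] _ jsmooth_onD[OF assms(3) C]])
      (auto simp: jinv_jcoord[OF C] assms(2))
qed

lemma jsmooth_on_const: "jsmooth_on A W (\<lambda>_. c)"
  by (simp add: jsmooth_on_def smooth_on_const)

lemma jsmooth_on_add:
  "jopen A W \<Longrightarrow> jsmooth_on A W f \<Longrightarrow> jsmooth_on A W g \<Longrightarrow> jsmooth_on A W (\<lambda>p. f p + g p)"
  by (simp add: jsmooth_on_def jopen_def smooth_on_add)

lemma jsmooth_on_minus:
  "jopen A W \<Longrightarrow> jsmooth_on A W f \<Longrightarrow> jsmooth_on A W (\<lambda>p. - f p)"
  by (simp add: jsmooth_on_def jopen_def smooth_on_minus)

lemma jsmooth_on_diff:
  "jopen A W \<Longrightarrow> jsmooth_on A W f \<Longrightarrow> jsmooth_on A W g \<Longrightarrow> jsmooth_on A W (\<lambda>p. f p - g p)"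
  by (simp add: jsmooth_on_def jopen_def smooth_on_diff)

lemma jsmooth_on_mult:
  "jopen A W \<Longrightarrow> jsmooth_on A W f \<Longrightarrow> jsmooth_on A W g \<Longrightarrow> jsmooth_on A W (\<lambda>p. f p * g p)"
  by (simp add: jsmooth_on_def jopen_def smooth_on_mult)

lemma jsmooth_on_sum:
  "jopen A W \<Longrightarrow> (\<And>i. i \<in> I \<Longrightarrow> jsmooth_on A W (f i)) \<Longrightarrow> jsmooth_on A W (\<lambda>p. \<Sum>i\<in>I. f i p)"
  by (simp add: jsmooth_on_def jopen_def smooth_on_sum)

lemma jsmooth_nearI: "jopen A V \<Longrightarrow> p \<in> V \<Longrightarrow> jsmooth_on A V f \<Longrightarrow> jsmooth_near A p f"
  by (auto simp: jsmooth_near_def)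

text \<open>A bump function in the coordinates, extended by zero outside the chart. The extension is smooth
  because, \<open>M\<close> being Hausdorff, its support lies over a compact, hence closed, set of times and
  points: the complement \<open>Z\<close> of what lies over that set is open and, together with the chart, covers
  the jet space.\<close>

lemma jet_bump:
  assumes C: "C \<in> jcharts A" and V: "jopen A V" "p \<in> V" "V \<subseteq> jdom A C"
  obtains b W where "jsmooth_on A (jet_space A) b" "jopen A W" "p \<in> W" "W \<subseteq> V"
    "\<And>q. q \<in> W \<Longrightarrow> b q = 1" "\<And>q. q \<notin> V \<Longrightarrow> b q = 0"
    "\<exists>Z. jopen A Z \<and> Z \<union> jdom A C = jet_space A \<and> (\<forall>q\<in>Z. b q = 0)"
proof -
  obtain I \<tau> U \<phi> where C_eq: "C = ((I, \<tau>), (U, \<phi>))" "(I, \<tau>) \<in> time_charts" "(U, \<phi>) \<in> A"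
    using C by (rule jchartsD)
  note \<tau> = is_chartD[OF time_chartD(1)[OF C_eq(2)]] and \<phi> = is_chartD[OF chart[OF C_eq(3)]]
  have "V \<inter> jdom A C = V" using V(3) by auto
  with open_jcoord_image[OF V(1) C] have opV: "open (jcoord C ` V)" by simp
  let ?z = "jcoord C p"
  obtain r where r: "r > 0" "cball ?z r \<subseteq> jcoord C ` V"
    using opV V(2) unfolding open_contains_cball by blast
  obtain \<beta> :: "real \<times> (real^'n) \<times> (real^'n) \<Rightarrow> real" where \<beta>: "smooth_on UNIV \<beta>"
    "\<And>z. dist z ?z < r / 2 \<Longrightarrow> \<beta> z = 1" "\<And>z. r \<le> dist z ?z \<Longrightarrow> \<beta> z = 0"
    using bump_function[OF r(1)] by blast
  define b where "b q = (if q \<in> jdom A C then \<beta> (jcoord C q) else 0)" for q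
  define W where "W = {q \<in> jdom A C. jcoord C q \<in> ball ?z (r / 2)}"
  have ball_sub: "ball ?z (r / 2) \<subseteq> jcoord C ` jdom A C"
    using r V(3) by (force simp: subset_eq)
  then have "jcoord C ` W = ball ?z (r / 2)" by (auto simp: W_def)
  then have W: "jopen A W" by (intro jopen_chart[OF C]) (auto simp: W_def)
  have in_V: "q \<in> V" if "q \<in> jdom A C" "dist (jcoord C q) ?z \<le> r" for q
  proof -
    have "jcoord C q \<in> jcoord C ` V" using r(2) that(2) by (auto simp: dist_commute subset_eq)
    then show ?thesis using inj_onD[OF jcoord_inj[OF C]] that(1) V(3) by blast
  qed
  let ?t = "fst ?z" and ?x = "fst (snd ?z)"
  define K where "K = inv_into I \<tau> ` cball ?t r"
  define L where "L = inv_into U \<phi> ` cball ?x r"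
  have prod_sub: "cball ?z r \<subseteq> (\<tau> ` I) \<times> (\<phi> ` U) \<times> UNIV"
  proof -
    have "jcoord C ` V \<subseteq> jcoord C ` jets_over I U" using V(3) by (auto simp: jdom_eq C_eq(1))
    then show ?thesis using r(2) jcoord_image[OF C_eq(2,3) order_refl order_refl] by (auto simp: C_eq(1))
  qed
  have "cball ?t r \<subseteq> \<tau> ` I"
  proof
    fix t assume "t \<in> cball ?t r"
    then have "(t, snd ?z) \<in> cball ?z r" by (cases ?z) (auto simp: dist_Pair_Pair)
    then show "t \<in> \<tau> ` I" using prod_sub by blast
  qed
  then have "compact K" unfolding K_def
    by (intro compact_continuous_image continuous_on_subset[OF \<tau>(5)] compact_cball)
  have "cball ?x r \<subseteq> \<phi> ` U"
  proof
    fix x assume "x \<in> cball ?x r"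
    then have "(?t, x, snd (snd ?z)) \<in> cball ?z r" by (cases ?z) (auto simp: dist_Pair_Pair)
    then show "x \<in> \<phi> ` U" using prod_sub by blast
  qed
  then have "compact L" unfolding L_def
    by (intro compact_continuous_image continuous_on_subset[OF \<phi>(5)] compact_cball)
  define Z where "Z = jets_over (- K) UNIV \<union> jets_over UNIV (- L)"
  have Z: "jopen A Z" unfolding Z_def
    by (intro jopen_Un jopen_jets_over open_Compl compact_imp_closed \<open>compact K\<close> \<open>compact L\<close> open_UNIV)
  have far: "b q = 0" if "q \<in> Z" for q
  proof (cases "q \<in> jdom A C")
    case True
    have q: "fst q \<in> I" "jet_point q \<in> U" using True by (auto simp: jdom_def C_eq(1))
    have co: "fst (jcoord C q) = \<tau> (fst q)" "fst (snd (jcoord C q)) = \<phi> (jet_point q)"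
      unfolding jcoord_eq[OF C True] by (simp_all add: C_eq(1))
    have "r \<le> dist (jcoord C q) ?z"
    proof (rule ccontr)
      assume "\<not> r \<le> dist (jcoord C q) ?z"
      then have d: "dist (jcoord C q) ?z \<le> r" by simp
      have "dist ?t (\<tau> (fst q)) \<le> r"
        using order_trans[OF dist_fst_le d] by (simp add: co dist_commute)
      then have "fst q \<in> K" unfolding K_def
        by (intro image_eqI[of _ _ "\<tau> (fst q)"]) (simp_all add: inv_into_f_f[OF \<tau>(3) q(1)])
      moreover have "dist ?x (\<phi> (jet_point q)) \<le> r"
        using order_trans[OF dist_fst_le order_trans[OF dist_snd_le d]] by (simp add: co dist_commute)
      then have "jet_point q \<in> L" unfolding L_def
        by (intro image_eqI[of _ _ "\<phi> (jet_point q)"]) (simp_all add: inv_into_f_f[OF \<phi>(3) q(2)])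
      ultimately show False using that by (auto simp: Z_def jets_over_def)
    qed
    then show ?thesis using \<beta>(3) by (simp add: b_def)
  qed (simp add: b_def)
  have "K \<subseteq> I" "L \<subseteq> U"
    using \<open>cball ?t r \<subseteq> \<tau> ` I\<close> \<open>cball ?x r \<subseteq> \<phi> ` U\<close>
    by (auto simp: K_def L_def dest!: subsetD intro: inv_into_into)
  then have cover: "Z \<union> jdom A C = jet_space A"
    by (auto simp: Z_def jdom_eq jets_over_def C_eq(1))
  have smooth: "jsmooth_on A (jet_space A) b"
  proof (rule jsmooth_on_local)
    fix q assume "q \<in> jet_space A"
    then consider "q \<in> Z" | "q \<in> jdom A C" using cover by blast
    then show "\<exists>W. jopen A W \<and> q \<in> W \<and> jsmooth_on A W b"
    proof cases
      case 1
      have "jsmooth_on A Z b" by (rule jsmooth_on_cong[OF Z _ jsmooth_on_const[of _ 0]]) (simp add: far)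
      then show ?thesis using Z 1 by blast
    next
      case 2
      have "jsmooth_on A (jdom A C) b"
        by (rule jsmooth_on_chartI[OF C jopen_jdom[OF C] order_refl smooth_on_subset[OF \<beta>(1) subset_UNIV]])
          (simp add: b_def)
      then show ?thesis using jopen_jdom[OF C] 2 by blast
    qed
  qed
  show thesis
  proof
    show "jsmooth_on A (jet_space A) b" "jopen A W" by fact+
    show "p \<in> W" using V r by (auto simp: W_def)
    show "W \<subseteq> V" using in_V r(1) by (auto simp: W_def dist_commute)
    show "b q = 1" if "q \<in> W" for q
      using that \<beta>(2) by (simp add: W_def b_def dist_commute)
    show "b q = 0" if "q \<notin> V" for q
      using that in_V[of q] \<beta>(3)[of "jcoord C q"]
      by (cases "dist (jcoord C q) ?z \<le> r") (auto simp: b_def)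
    show "\<exists>Z. jopen A Z \<and> Z \<union> jdom A C = jet_space A \<and> (\<forall>q\<in>Z. b q = 0)"
      using Z cover far by blast
  qed
qed

end

section \<open>Tangent vectors\<close>

text \<open>Labels for the coordinates of the jet space and for the vectors of the frames below. One index
  type for the three blocks lets every frame identity be stated and proved once.\<close>

datatype 'n dir = Time | Place 'n | Fibre 'n

lemma UNIV_dir: "UNIV = insert Time (range Place \<union> range Fibre)"
proof (intro equalityI subsetI)
  fix \<kappa> :: "'n dir"
  show "\<kappa> \<in> insert Time (range Place \<union> range Fibre)" by (cases \<kappa>) auto
qed simp

instance dir :: (finite) finite
  by standard (simp add: UNIV_dir)

lemma sum_dir:
  fixes g :: "'n::finite dir \<Rightarrow> 'b::comm_monoid_add"
  shows "(\<Sum>\<kappa>\<in>UNIV. g \<kappa>) = g Time + (\<Sum>i\<in>UNIV. g (Place i)) + (\<Sum>i\<in>UNIV. g (Fibre i))"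
proof -
  have "sum g (range Place \<union> range Fibre) = sum g (range Place) + sum g (range Fibre)"
    by (rule sum.union_disjoint) auto
  moreover have "sum g (range Place) = (\<Sum>i\<in>UNIV. g (Place i))" "sum g (range Fibre) = (\<Sum>i\<in>UNIV. g (Fibre i))"
    by (simp_all add: sum.reindex inj_def)
  moreover have "sum g (insert Time (range Place \<union> range Fibre)) = g Time + sum g (range Place \<union> range Fibre)"
    by (rule sum.insert) auto
  ultimately show ?thesis unfolding UNIV_dir by (simp only: add.assoc)
qed

fun dir_vec :: "'n::finite dir \<Rightarrow> real \<times> (real^'n) \<times> (real^'n)" where
  "dir_vec Time = (1, 0, 0)"
| "dir_vec (Place i) = (0, axis i 1, 0)"
| "dir_vec (Fibre i) = (0, 0, axis i 1)"

fun dir_coord :: "'n::finite dir \<Rightarrow> real \<times> (real^'n) \<times> (real^'n) \<Rightarrow> real" where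
  "dir_coord Time z = fst z"
| "dir_coord (Place i) z = fst (snd z) $ i"
| "dir_coord (Fibre i) z = snd (snd z) $ i"

lemma bounded_linear_dir_coord:
  fixes \<kappa> :: "'n::finite dir"
  shows "bounded_linear (dir_coord \<kappa>)"
proof -
  have "dir_coord (Time :: 'n dir) = fst" "dir_coord (Place i) = (\<lambda>z. fst (snd z) $ i)"
    "dir_coord (Fibre i) = (\<lambda>z. snd (snd z) $ i)" for i :: 'n
    by (simp_all add: fun_eq_iff)
  then show ?thesis
    by (cases \<kappa>) (simp_all only: bounded_linear_fst
        bounded_linear_compose[OF bounded_linear_vec_nth bounded_linear_compose[OF bounded_linear_fst bounded_linear_snd]]
        bounded_linear_compose[OF bounded_linear_vec_nth bounded_linear_compose[OF bounded_linear_snd bounded_linear_snd]])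
qed

lemma dir_coord_dir_vec: "dir_coord \<kappa> (dir_vec \<mu>) = (if \<kappa> = \<mu> then 1 else 0)"
  by (cases \<kappa>; cases \<mu>) (auto simp: axis_def)

lemma dir_expansion:
  fixes z :: "real \<times> (real^'n) \<times> (real^'n)"
  shows "(\<Sum>\<kappa>\<in>UNIV. dir_coord \<kappa> z *\<^sub>R dir_vec \<kappa>) = z"
proof -
  have "(\<Sum>i\<in>UNIV. (x $ i) *\<^sub>R axis i (1::real)) = x" for x :: "real^'n"
    by (simp add: vec_eq_iff sum_component axis_def if_distrib cong: if_cong)
  moreover have "(\<Sum>i\<in>UNIV. (0::real, f i :: real^'n, 0::real^'n)) = (0, sum f UNIV, 0)"
    "(\<Sum>i\<in>UNIV. (0::real, 0::real^'n, f i :: real^'n)) = (0, 0, sum f UNIV)" for f :: "'n \<Rightarrow> real^'n"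
    by (simp_all add: prod_eq_iff fst_sum snd_sum)
  ultimately show ?thesis by (cases z) (simp add: sum_dir)
qed

fun co :: "('m, 'n) jchart \<Rightarrow> 'n::finite dir \<Rightarrow> 'm jet \<Rightarrow> real" where
  "co C Time = tco C"
| "co C (Place i) = xco C i"
| "co C (Fibre i) = yco C i"

lemma co_eq: "co C \<kappa> e = dir_coord \<kappa> (jcoord C e)"
  by (cases \<kappa>) (simp_all add: jcoord_def)

context smooth_manifold begin

abbreviation pd :: "('m, 'n) jchart \<Rightarrow> 'n dir \<Rightarrow> 'm jfield" where
  "pd C \<kappa> \<equiv> coord_deriv A C (dir_vec \<kappa>)"

lemma pd_simps: "pd_t A C = pd C Time" "pd_x A C i = pd C (Place i)" "pd_y A C i = pd C (Fibre i)"
  by (simp_all add: pd_t_def pd_x_def pd_y_def)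

lemma jsmooth_on_co:
  assumes "C \<in> jcharts A"
  shows "jsmooth_on A (jdom A C) (co C \<kappa>)"
proof (rule jsmooth_on_chartI[OF assms jopen_jdom[OF assms] order_refl, where F = "dir_coord \<kappa>"])
  have "open (jcoord C ` jdom A C)"
    using open_jcoord_image[OF jopen_jdom[OF assms] assms] by simp
  then show "smooth_on (jcoord C ` jdom A C) (dir_coord \<kappa>)"
    by (rule smooth_on_bounded_linear[OF _ bounded_linear_dir_coord])
qed (rule co_eq)

lemma chart_has_derivative:
  assumes "C \<in> jcharts A" "p \<in> jdom A C" "jsmooth_near A p f"
  shows "((\<lambda>z. f (jinv A C z)) has_derivative
    frechet_derivative (\<lambda>z. f (jinv A C z)) (at (jcoord C p))) (at (jcoord C p))"
proof -
  obtain V where V: "jopen A V" "p \<in> V" "jsmooth_on A V f" using assms(3) by (auto simp: jsmooth_near_def)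
  then have "jcoord C p \<in> jcoord C ` (V \<inter> jdom A C)" using assms(2) by blast
  then show ?thesis by (rule smooth_on_imp_has_derivative[OF jsmooth_onD[OF V(3) assms(1)]])
qed

lemma coord_deriv_eqI:
  assumes "p \<in> jdom A C" "jsmooth_near A p f"
    and "((\<lambda>z. f (jinv A C z)) has_derivative L) (at (jcoord C p))"
  shows "coord_deriv A C u p f = L u"
  using assms by (simp add: coord_deriv_def frechet_derivative_eqI)

lemma jsmooth_near_cong:
  assumes "jopen A V" "p \<in> V" "\<And>q. q \<in> V \<Longrightarrow> f q = g q" "jsmooth_near A p f"
  shows "jsmooth_near A p g"
proof -
  obtain W where W: "jopen A W" "p \<in> W" "jsmooth_on A W f" using assms(4) by (auto simp: jsmooth_near_def)
  have "jsmooth_on A (V \<inter> W) g"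
    by (rule jsmooth_on_cong[OF jopen_Int[OF assms(1) W(1)] _ jsmooth_on_subset[OF W(3)]]) (use assms(3) in auto)
  then show ?thesis using jsmooth_nearI[OF jopen_Int[OF assms(1) W(1)]] assms(2) W(2) by blast
qed

lemma jsmooth_near_pair:
  assumes "jsmooth_near A p f" "jsmooth_near A p g"
  obtains V where "jopen A V" "p \<in> V" "jsmooth_on A V f" "jsmooth_on A V g"
proof -
  obtain V W where V: "jopen A V" "p \<in> V" "jsmooth_on A V f" and W: "jopen A W" "p \<in> W" "jsmooth_on A W g"
    using assms unfolding jsmooth_near_def by blast
  show thesis
    by (rule that[OF jopen_Int[OF V(1) W(1)] _ jsmooth_on_subset[OF V(3) Int_lower1] jsmooth_on_subset[OF W(3) Int_lower2]])
      (use V(2) W(2) in blast)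
qed

lemma jsmooth_near_add:
  assumes "jsmooth_near A p f" "jsmooth_near A p g"
  shows "jsmooth_near A p (\<lambda>q. f q + g q)"
proof -
  obtain V where V: "jopen A V" "p \<in> V" "jsmooth_on A V f" "jsmooth_on A V g" using assms by (rule jsmooth_near_pair)
  show ?thesis by (rule jsmooth_nearI[OF V(1,2) jsmooth_on_add[OF V(1,3,4)]])
qed

lemma jsmooth_near_mult:
  assumes "jsmooth_near A p f" "jsmooth_near A p g"
  shows "jsmooth_near A p (\<lambda>q. f q * g q)"
proof -
  obtain V where V: "jopen A V" "p \<in> V" "jsmooth_on A V f" "jsmooth_on A V g" using assms by (rule jsmooth_near_pair)
  show ?thesis by (rule jsmooth_nearI[OF V(1,2) jsmooth_on_mult[OF V(1,3,4)]])
qed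

lemma jsmooth_near_const: "p \<in> jet_space A \<Longrightarrow> jsmooth_near A p (\<lambda>_. c)"
  by (rule jsmooth_nearI[OF jopen_jet_space _ jsmooth_on_const])

lemma jsmooth_near_sum:
  assumes "p \<in> jet_space A" "\<And>i. i \<in> I \<Longrightarrow> jsmooth_near A p (f i)"
  shows "jsmooth_near A p (\<lambda>q. \<Sum>i\<in>I. f i q)"
  using assms(2)
  by (induction I rule: infinite_finite_induct) (auto intro: jsmooth_near_add jsmooth_near_const[OF assms(1)])

text \<open>Both sides may be the default value \<open>0\<close>: being smooth near \<open>p\<close> depends on the germ only.\<close>

lemma coord_deriv_germ:
  assumes "C \<in> jcharts A" "jopen A V" "p \<in> V" "\<And>q. q \<in> V \<Longrightarrow> f q = g q"
  shows "coord_deriv A C u p f = coord_deriv A C u p g"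
proof (cases "p \<in> jdom A C \<and> jsmooth_near A p f")
  case True
  then have p: "p \<in> jdom A C" "jsmooth_near A p f" by auto
  have g: "jsmooth_near A p g" by (rule jsmooth_near_cong[OF assms(2-4) p(2)])
  have "((\<lambda>z. g (jinv A C z)) has_derivative
      frechet_derivative (\<lambda>z. f (jinv A C z)) (at (jcoord C p))) (at (jcoord C p))"
    by (rule has_derivative_transform_within_open[OF chart_has_derivative[OF assms(1) p]
          open_jcoord_image[OF assms(2,1)]])
      (use p(1) assms(3,4) in \<open>auto simp: jinv_jcoord[OF assms(1)]\<close>)
  then have "coord_deriv A C u p g = frechet_derivative (\<lambda>z. f (jinv A C z)) (at (jcoord C p)) u"
    by (rule coord_deriv_eqI[OF p(1) g])
  then show ?thesis using p by (simp add: coord_deriv_def)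
next
  case False
  have "jsmooth_near A p g \<Longrightarrow> jsmooth_near A p f"
    by (rule jsmooth_near_cong[OF assms(2,3)]) (simp add: assms(4))
  with False show ?thesis by (auto simp: coord_deriv_def)
qed

lemma coord_deriv_expand:
  assumes "C \<in> jcharts A"
  shows "coord_deriv A C u p f = (\<Sum>\<kappa>\<in>UNIV. dir_coord \<kappa> u * pd C \<kappa> p f)"
proof (cases "p \<in> jdom A C \<and> jsmooth_near A p f")
  case True
  let ?L = "frechet_derivative (\<lambda>z. f (jinv A C z)) (at (jcoord C p))"
  have lin: "linear ?L" using chart_has_derivative[OF assms] True by (blast intro: has_derivative_linear)
  have "?L u = ?L (\<Sum>\<kappa>\<in>UNIV. dir_coord \<kappa> u *\<^sub>R dir_vec \<kappa>)" by (simp only: dir_expansion)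
  also have "\<dots> = (\<Sum>\<kappa>\<in>UNIV. dir_coord \<kappa> u * ?L (dir_vec \<kappa>))"
    by (simp only: linear_sum[OF lin] linear_cmul[OF lin] real_scaleR_def)
  finally show ?thesis using True by (simp add: coord_deriv_def)
qed (auto simp: coord_deriv_def)

lemma coord_deriv_co:
  assumes "C \<in> jcharts A" "p \<in> jdom A C"
  shows "coord_deriv A C u p (co C \<kappa>) = dir_coord \<kappa> u"
proof (rule coord_deriv_eqI[OF assms(2) jsmooth_nearI[OF jopen_jdom[OF assms(1)] assms(2) jsmooth_on_co[OF assms(1)]]])
  have op: "open (jcoord C ` (jdom A C \<inter> jdom A C))" by (rule open_jcoord_image[OF jopen_jdom[OF assms(1)] assms(1)])
  show "((\<lambda>z. co C \<kappa> (jinv A C z)) has_derivative dir_coord \<kappa>) (at (jcoord C p))"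
    by (rule has_derivative_transform_within_open[OF bounded_linear_imp_has_derivative[OF bounded_linear_dir_coord] op])
      (use assms in \<open>auto simp: jinv_jcoord co_eq\<close>)
qed

lemma pd_co: "C \<in> jcharts A \<Longrightarrow> p \<in> jdom A C \<Longrightarrow> pd C \<mu> p (co C \<kappa>) = (if \<kappa> = \<mu> then 1 else 0)"
  by (simp add: coord_deriv_co dir_coord_dir_vec)

lemma coord_deriv_change:
  assumes "C \<in> jcharts A" "C' \<in> jcharts A" "p \<in> jdom A C" "p \<in> jdom A C'"
  shows "coord_deriv A C' u p = coord_deriv A C (frechet_derivative (jet_change C' C) (at (jcoord C' p)) u) p"
proof
  fix f
  let ?J = "frechet_derivative (jet_change C' C) (at (jcoord C' p))"
  show "coord_deriv A C' u p f = coord_deriv A C (?J u) p f"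
  proof (cases "jsmooth_near A p f")
    case True
    let ?L = "frechet_derivative (\<lambda>z. f (jinv A C z)) (at (jcoord C p))"
    let ?S = "jcoord C' ` (jdom A C \<inter> jdom A C')"
    have pS: "jcoord C' p \<in> ?S" using assms by blast
    have J: "(jet_change C' C has_derivative ?J) (at (jcoord C' p))"
      by (rule smooth_on_imp_has_derivative[OF smooth_on_jet_change[OF assms(2,1)] pS])
    have "((\<lambda>z. f (jinv A C z)) has_derivative ?L) (at (jet_change C' C (jcoord C' p)))"
      using chart_has_derivative[OF assms(1,3) True] by (simp add: jcoord_change[OF assms(2,1,4,3)])
    from has_derivative_compose[OF J this]
    have "((\<lambda>z. f (jinv A C' z)) has_derivative (\<lambda>v. ?L (?J v))) (at (jcoord C' p))"
    proof (rule has_derivative_transform_within_open[OF _ open_jcoord_image[OF jopen_jdom[OF assms(1)] assms(2)] pS])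
      fix z assume "z \<in> ?S"
      then obtain q where q: "z = jcoord C' q" "q \<in> jdom A C" "q \<in> jdom A C'" by blast
      then show "f (jinv A C (jet_change C' C z)) = f (jinv A C' z)"
        using jcoord_change[OF assms(2,1) q(3,2)] jinv_jcoord[OF assms(1) q(2)] jinv_jcoord[OF assms(2) q(3)]
        by simp
    qed
    from coord_deriv_eqI[OF assms(4) True this]
    show ?thesis using True assms(3) by (simp add: coord_deriv_def)
  qed (simp add: coord_deriv_def)
qed

lemma tangent_in_chart:
  assumes "C \<in> jcharts A" "p \<in> jdom A C" "w \<in> tangent_space A p"
  obtains u where "w = coord_deriv A C u p"
  using assms coord_deriv_change[OF assms(1) _ assms(2)] unfolding tangent_space_def by blast

lemma tangent_space_jet: "w \<in> tangent_space A p \<Longrightarrow> p \<in> jet_space A"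
  by (auto simp: tangent_space_def jdom_def)

text \<open>Tangent vectors at \<open>p\<close> may stem from any chart; \<open>coord_deriv_change\<close> moves them into \<open>C\<close>, where the
  values on the coordinate functions are the components.\<close>

lemma tangent_expand:
  assumes "C \<in> jcharts A" "p \<in> jdom A C" "w \<in> tangent_space A p"
  shows "w f = (\<Sum>\<kappa>\<in>UNIV. w (co C \<kappa>) * pd C \<kappa> p f)"
proof -
  obtain u where "w = coord_deriv A C u p" using tangent_in_chart[OF assms] .
  then show ?thesis using coord_deriv_expand[OF assms(1), of u p f] coord_deriv_co[OF assms(1,2)] by simp
qed

lemma tangentI:
  assumes "C \<in> jcharts A" "p \<in> jdom A C" "\<And>f. w f = (\<Sum>\<kappa>\<in>UNIV. a \<kappa> * pd C \<kappa> p f)"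
  shows "w \<in> tangent_space A p"
proof -
  have "dir_coord \<kappa> (\<Sum>\<mu>\<in>UNIV. a \<mu> *\<^sub>R dir_vec \<mu>) = a \<kappa>" for \<kappa>
    by (simp add: linear_sum[OF bounded_linear.linear[OF bounded_linear_dir_coord]]
        linear_cmul[OF bounded_linear.linear[OF bounded_linear_dir_coord]] dir_coord_dir_vec if_distrib cong: if_cong)
  note coords = this
  have "w = coord_deriv A C (\<Sum>\<mu>\<in>UNIV. a \<mu> *\<^sub>R dir_vec \<mu>) p"
  proof
    fix f
    show "w f = coord_deriv A C (\<Sum>\<mu>\<in>UNIV. a \<mu> *\<^sub>R dir_vec \<mu>) p f"
      unfolding coord_deriv_expand[OF assms(1), of "\<Sum>\<mu>\<in>UNIV. a \<mu> *\<^sub>R dir_vec \<mu>"] coords assms(3) ..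
  qed
  then show ?thesis using assms(1,2) unfolding tangent_space_def by blast
qed

lemma pd_tangent: "C \<in> jcharts A \<Longrightarrow> p \<in> jdom A C \<Longrightarrow> pd C \<kappa> p \<in> tangent_space A p"
  unfolding tangent_space_def by blast

lemma tangent_comb:
  assumes "v \<in> tangent_space A p" "w \<in> tangent_space A p"
  shows "(\<lambda>f. a * v f + b * w f) \<in> tangent_space A p"
proof -
  obtain C where C: "C \<in> jcharts A" "p \<in> jdom A C"
    using tangent_space_jet[OF assms(1)] by (rule jet_space_covered)
  show ?thesis
  proof (rule tangentI[OF C])
    fix f
    show "a * v f + b * w f = (\<Sum>\<kappa>\<in>UNIV. (a * v (co C \<kappa>) + b * w (co C \<kappa>)) * pd C \<kappa> p f)"
      unfolding tangent_expand[OF C assms(1), of f] tangent_expand[OF C assms(2), of f]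
      by (simp add: sum_distrib_left sum.distrib algebra_simps)
  qed
qed

lemma tangent_germ:
  assumes "w \<in> tangent_space A p" "jopen A V" "p \<in> V" "\<And>q. q \<in> V \<Longrightarrow> f q = g q"
  shows "w f = w g"
  using assms(1) coord_deriv_germ[OF _ assms(2-4)] by (auto simp: tangent_space_def)

lemma tangent_not_smooth: "w \<in> tangent_space A p \<Longrightarrow> \<not> jsmooth_near A p f \<Longrightarrow> w f = 0"
  by (auto simp: tangent_space_def coord_deriv_def)

lemma
  assumes w: "w \<in> tangent_space A p" and f: "jsmooth_near A p f" and g: "jsmooth_near A p g"
  shows tangent_add: "w (\<lambda>q. f q + g q) = w f + w g"
    and tangent_mult: "w (\<lambda>q. f q * g q) = w f * g p + f p * w g"
proof -
  obtain C u where C: "C \<in> jcharts A" "p \<in> jdom A C" "w = coord_deriv A C u p"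
    using w by (auto simp: tangent_space_def)
  note df = chart_has_derivative[OF C(1,2) f] and dg = chart_has_derivative[OF C(1,2) g]
  show "w (\<lambda>q. f q + g q) = w f + w g"
    unfolding C(3) coord_deriv_eqI[OF C(2) jsmooth_near_add[OF f g] has_derivative_add[OF df dg]]
    using C f g by (simp add: coord_deriv_def)
  show "w (\<lambda>q. f q * g q) = w f * g p + f p * w g"
    unfolding C(3) coord_deriv_eqI[OF C(2) jsmooth_near_mult[OF f g] has_derivative_mult[OF df dg]]
    using C f g by (simp add: coord_deriv_def jinv_jcoord)
qed

lemma tangent_const:
  assumes "w \<in> tangent_space A p"
  shows "w (\<lambda>_. c) = 0"
proof -
  obtain C u where C: "C \<in> jcharts A" "p \<in> jdom A C" "w = coord_deriv A C u p"
    using assms by (auto simp: tangent_space_def)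
  show ?thesis
    unfolding C(3) coord_deriv_eqI[OF C(2) jsmooth_near_const[OF tangent_space_jet[OF assms]] has_derivative_const]
    by simp
qed

lemma tangent_cmult:
  assumes "w \<in> tangent_space A p" "jsmooth_near A p f"
  shows "w (\<lambda>q. c * f q) = c * w f"
  using tangent_mult[OF assms(1) jsmooth_near_const[OF tangent_space_jet[OF assms(1)]] assms(2)]
    tangent_const[OF assms(1)] by simp

lemma tangent_diff:
  assumes "w \<in> tangent_space A p" "jsmooth_near A p f" "jsmooth_near A p g"
  shows "w (\<lambda>q. f q - g q) = w f - w g"
proof -
  have "jsmooth_near A p (\<lambda>q. - 1 * g q)"
    by (rule jsmooth_near_mult[OF jsmooth_near_const[OF tangent_space_jet[OF assms(1)]] assms(3)])
  from tangent_add[OF assms(1,2) this] tangent_cmult[OF assms(1,3), of "- 1"] show ?thesis by simp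
qed

lemma tangent_sum:
  assumes "w \<in> tangent_space A p" "\<And>i. i \<in> I \<Longrightarrow> jsmooth_near A p (f i)"
  shows "w (\<lambda>q. \<Sum>i\<in>I. f i q) = (\<Sum>i\<in>I. w (f i))"
  using assms(2)
proof (induction I rule: infinite_finite_induct)
  case (insert x F)
  then show ?case
    by (simp add: tangent_add[OF assms(1)] jsmooth_near_sum[OF tangent_space_jet[OF assms(1)]])
qed (simp_all add: tangent_const[OF assms(1)])

lemma coord_deriv_commute:
  assumes C: "C \<in> jcharts A" "p \<in> jdom A C" and f: "jsmooth_near A p f"
  shows "coord_deriv A C u p (\<lambda>q. coord_deriv A C v q f) = coord_deriv A C v p (\<lambda>q. coord_deriv A C u q f)"
proof -
  obtain V where V: "jopen A V" "p \<in> V" "jsmooth_on A V f" using f by (auto simp: jsmooth_near_def)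
  let ?g = "\<lambda>z. f (jinv A C z)" and ?S = "jcoord C ` (V \<inter> jdom A C)"
  have S: "open ?S" "jcoord C p \<in> ?S" using open_jcoord_image[OF V(1) C(1)] V(2) C(2) by auto
  have sm: "smooth_on ?S ?g" by (rule jsmooth_onD[OF V(3) C(1)])
  have eq: "coord_deriv A C w q f = frechet_derivative ?g (at (jcoord C q)) w"
    if "q \<in> V \<inter> jdom A C" for q w
    using that jsmooth_nearI[OF V(1) _ V(3)] by (simp add: coord_deriv_def)
  have "jsmooth_on A (V \<inter> jdom A C) (\<lambda>q. coord_deriv A C w q f)" for w
    by (rule jsmooth_on_chartI[OF C(1) jopen_Int[OF V(1) jopen_jdom[OF C(1)]] Int_lower2
          smooth_on_frechet_derivative[OF sm] eq])
  then have near: "jsmooth_near A p (\<lambda>q. coord_deriv A C w q f)" for w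
    by (rule jsmooth_nearI[OF jopen_Int[OF V(1) jopen_jdom[OF C(1)]], rotated]) (use V(2) C(2) in blast)
  have "coord_deriv A C u p (\<lambda>q. coord_deriv A C v q f) =
      frechet_derivative (\<lambda>z. frechet_derivative ?g (at z) v) (at (jcoord C p)) u" for u v
  proof (rule coord_deriv_eqI[OF C(2) near])
    show "((\<lambda>z. coord_deriv A C v (jinv A C z) f) has_derivative
        frechet_derivative (\<lambda>z. frechet_derivative ?g (at z) v) (at (jcoord C p))) (at (jcoord C p))"
      by (rule has_derivative_transform_within_open[OF
            smooth_on_imp_has_derivative[OF smooth_on_frechet_derivative[OF sm] S(2)] S])
        (auto simp: eq jinv_jcoord[OF C(1)])
  qed
  then show ?thesis using frechet_derivative_commute[OF S(1) sm S(2)] by simp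
qed

section \<open>Vector fields\<close>

text \<open>Coordinate fields and adapted fields are smooth on the domain of their chart only, so they are not
  members of \<open>vector_fields A\<close>.\<close>

definition smooth_field_on :: "'m jet set \<Rightarrow> 'm jfield \<Rightarrow> bool" where
  "smooth_field_on V X \<longleftrightarrow> (\<forall>p\<in>V. X p \<in> tangent_space A p) \<and>
    (\<forall>W f. jopen A W \<longrightarrow> jsmooth_on A W f \<longrightarrow> jsmooth_on A (V \<inter> W) (\<lambda>p. X p f))"

lemma smooth_field_onD:
  assumes "smooth_field_on V X"
  shows "p \<in> V \<Longrightarrow> X p \<in> tangent_space A p"
    and "jopen A W \<Longrightarrow> jsmooth_on A W f \<Longrightarrow> jsmooth_on A (V \<inter> W) (\<lambda>p. X p f)"
  using assms by (auto simp: smooth_field_on_def)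

lemma smooth_field_near:
  assumes "smooth_field_on V X" "jopen A V" "p \<in> V" "jsmooth_near A p f"
  shows "jsmooth_near A p (\<lambda>q. X q f)"
proof -
  obtain W where "jopen A W" "p \<in> W" "jsmooth_on A W f" using assms(4) by (auto simp: jsmooth_near_def)
  then show ?thesis using smooth_field_onD(2)[OF assms(1)] jsmooth_nearI[OF jopen_Int[OF assms(2)]] assms(3) by blast
qed

lemma vector_field_smooth: "X \<in> vector_fields A \<Longrightarrow> smooth_field_on (jet_space A) X"
  unfolding vector_fields_def smooth_field_on_def
  using jopen_subset by (auto simp: Int_absorb1)

lemma vector_field_outside:
  assumes "X \<in> vector_fields A" "p \<notin> jet_space A"
  shows "X p f = 0"
proof -
  have "X p = (\<lambda>_. 0)" using assms unfolding vector_fields_def by blast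
  then show ?thesis by simp
qed

lemma vector_fieldI:
  assumes "smooth_field_on (jet_space A) X" "\<And>p f. p \<notin> jet_space A \<Longrightarrow> X p f = 0"
  shows "X \<in> vector_fields A"
  using assms jopen_subset unfolding vector_fields_def smooth_field_on_def
  by (auto simp: Int_absorb1 fun_eq_iff)

lemma smooth_field_pd: "C \<in> jcharts A \<Longrightarrow> smooth_field_on (jdom A C) (pd C \<kappa>)"
  unfolding smooth_field_on_def
proof (intro conjI ballI allI impI)
  fix W f assume C: "C \<in> jcharts A" and W: "jopen A W" "jsmooth_on A W f"
  have "jsmooth_on A (W \<inter> jdom A C) (\<lambda>q. pd C \<kappa> q f)"
    by (rule jsmooth_on_chartI[OF C jopen_Int[OF W(1) jopen_jdom[OF C]] Int_lower2
          smooth_on_frechet_derivative[OF jsmooth_onD[OF W(2) C]]])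
      (use jsmooth_nearI[OF W(1) _ W(2)] in \<open>auto simp: coord_deriv_def\<close>)
  then show "jsmooth_on A (jdom A C \<inter> W) (\<lambda>q. pd C \<kappa> q f)" by (simp add: Int_commute)
qed (auto simp: pd_tangent)

lemma smooth_field_comb:
  assumes "jopen A V" "smooth_field_on V X" "smooth_field_on V Y" "jsmooth_on A V g" "jsmooth_on A V h"
  shows "smooth_field_on V (\<lambda>p f. g p * X p f + h p * Y p f)"
  unfolding smooth_field_on_def
proof (intro conjI ballI allI impI)
  show "(\<lambda>f. g p * X p f + h p * Y p f) \<in> tangent_space A p" if "p \<in> V" for p
    by (rule tangent_comb[OF smooth_field_onD(1)[OF assms(2) that] smooth_field_onD(1)[OF assms(3) that]])
  fix W f assume W: "jopen A W" "jsmooth_on A W f"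
  note VW = jopen_Int[OF assms(1) W(1)]
  show "jsmooth_on A (V \<inter> W) (\<lambda>p. g p * X p f + h p * Y p f)"
    by (rule jsmooth_on_add[OF VW jsmooth_on_mult[OF VW jsmooth_on_subset[OF assms(4) Int_lower1]
            smooth_field_onD(2)[OF assms(2) W]]
          jsmooth_on_mult[OF VW jsmooth_on_subset[OF assms(5) Int_lower1] smooth_field_onD(2)[OF assms(3) W]]])
qed

lemma smooth_field_scale:
  assumes "jopen A V" "smooth_field_on V X" "jsmooth_on A V g"
  shows "smooth_field_on V (\<lambda>p f. g p * X p f)"
  using smooth_field_comb[OF assms(1,2,2,3) jsmooth_on_const[of _ 0]] by simp

lemma smooth_field_add:
  assumes "jopen A V" "smooth_field_on V X" "smooth_field_on V Y"
  shows "smooth_field_on V (\<lambda>p f. X p f + Y p f)"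
  using smooth_field_comb[OF assms jsmooth_on_const[of _ 1] jsmooth_on_const[of _ 1]] by simp

lemma vector_field_scale:
  assumes "X \<in> vector_fields A" "jsmooth_on A (jet_space A) g"
  shows "(\<lambda>p f. g p * X p f) \<in> vector_fields A"
  by (rule vector_fieldI[OF smooth_field_scale[OF jopen_jet_space vector_field_smooth[OF assms(1)] assms(2)]])
    (simp add: vector_field_outside[OF assms(1)])

lemma vector_field_add:
  assumes "X \<in> vector_fields A" "Y \<in> vector_fields A"
  shows "(\<lambda>p f. X p f + Y p f) \<in> vector_fields A"
  by (rule vector_fieldI[OF smooth_field_add[OF jopen_jet_space vector_field_smooth[OF assms(1)]
          vector_field_smooth[OF assms(2)]]])
    (simp add: vector_field_outside[OF assms(1)] vector_field_outside[OF assms(2)])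

text \<open>A smooth function whose support, being disjoint from an open set that covers the complement of the
  domain, is a closed subset of the domain of \<open>C\<close>. Multiplication by it turns functions and fields on
  that domain into global ones.\<close>

definition cutoff :: "('m, 'n) jchart \<Rightarrow> ('m jet \<Rightarrow> real) \<Rightarrow> bool" where
  "cutoff C b \<longleftrightarrow> jsmooth_on A (jet_space A) b \<and>
    (\<exists>Z. jopen A Z \<and> Z \<union> jdom A C = jet_space A \<and> (\<forall>q\<in>Z. b q = 0)) \<and> (\<forall>q. q \<notin> jdom A C \<longrightarrow> b q = 0)"

lemma cutoff_exists:
  assumes "C \<in> jcharts A" "p \<in> jdom A C" "jopen A V" "p \<in> V"
  obtains b W where "cutoff C b" "jopen A W" "p \<in> W" "W \<subseteq> V" "W \<subseteq> jdom A C"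
    "\<And>q. q \<in> W \<Longrightarrow> b q = 1" "\<And>q. q \<notin> V \<Longrightarrow> b q = 0"
proof -
  have V: "jopen A (V \<inter> jdom A C)" "p \<in> V \<inter> jdom A C" "V \<inter> jdom A C \<subseteq> jdom A C"
    using jopen_Int[OF assms(3) jopen_jdom[OF assms(1)]] assms by auto
  from jet_bump[OF assms(1) V] obtain b W where b: "jsmooth_on A (jet_space A) b" "jopen A W" "p \<in> W"
    "W \<subseteq> V \<inter> jdom A C" "\<And>q. q \<in> W \<Longrightarrow> b q = 1" "\<And>q. q \<notin> V \<inter> jdom A C \<Longrightarrow> b q = 0"
    "\<exists>Z. jopen A Z \<and> Z \<union> jdom A C = jet_space A \<and> (\<forall>q\<in>Z. b q = 0)"
    by metis
  show thesis by (rule that[of b W]) (use b in \<open>auto simp: cutoff_def\<close>)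
qed

lemma cutoff_function:
  assumes C: "C \<in> jcharts A" and b: "cutoff C b" and g: "jsmooth_on A (jdom A C) g"
  shows "jsmooth_on A (jet_space A) (\<lambda>p. b p * g p)"
proof (rule jsmooth_on_local)
  obtain Z where Z: "jopen A Z" "Z \<union> jdom A C = jet_space A" "\<And>q. q \<in> Z \<Longrightarrow> b q = 0"
    using b by (auto simp: cutoff_def)
  have "jsmooth_on A Z (\<lambda>p. b p * g p)"
    by (rule jsmooth_on_cong[OF Z(1) _ jsmooth_on_const[of _ 0]]) (simp add: Z(3))
  moreover have "jdom A C \<subseteq> jet_space A" using Z(2) by auto
  with b have "jsmooth_on A (jdom A C) b" unfolding cutoff_def using jsmooth_on_subset by blast
  then have "jsmooth_on A (jdom A C) (\<lambda>p. b p * g p)" by (rule jsmooth_on_mult[OF jopen_jdom[OF C] _ g])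
  moreover fix p assume "p \<in> jet_space A"
  then have "p \<in> Z \<or> p \<in> jdom A C" using Z(2) by auto
  ultimately show "\<exists>W. jopen A W \<and> p \<in> W \<and> jsmooth_on A W (\<lambda>p. b p * g p)"
    using Z(1) jopen_jdom[OF C] by blast
qed

lemma zero_tangent: "p \<in> jet_space A \<Longrightarrow> (\<lambda>f. 0) \<in> tangent_space A p"
  by (erule jet_space_covered, rule tangentI[where a = "\<lambda>_. 0"]) auto

lemma cutoff_field:
  assumes C: "C \<in> jcharts A" and b: "cutoff C b" and X: "smooth_field_on (jdom A C) X"
  shows "(\<lambda>p f. b p * X p f) \<in> vector_fields A"
proof (rule vector_fieldI)
  obtain Z where Z: "jopen A Z" "Z \<union> jdom A C = jet_space A" "\<And>q. q \<in> Z \<Longrightarrow> b q = 0"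
    using b by (auto simp: cutoff_def)
  have sub: "jdom A C \<subseteq> jet_space A" using Z(2) by auto
  have out: "q \<notin> jdom A C \<Longrightarrow> b q = 0" for q using b unfolding cutoff_def by blast
  show "b p * X p f = 0" if "p \<notin> jet_space A" for p f
    using that out[of p] sub by auto
  have bC: "jsmooth_on A (jdom A C) b" using b jsmooth_on_subset[OF _ sub] unfolding cutoff_def by blast
  show "smooth_field_on (jet_space A) (\<lambda>p f. b p * X p f)"
    unfolding smooth_field_on_def
  proof (intro conjI ballI allI impI)
    fix p assume p: "p \<in> jet_space A"
    show "(\<lambda>f. b p * X p f) \<in> tangent_space A p"
    proof (cases "p \<in> jdom A C")
      case True
      then show ?thesis using smooth_field_onD(1)[OF smooth_field_scale[OF jopen_jdom[OF C] X bC]] by blast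
    next
      case False
      then show ?thesis using zero_tangent[OF p] out by simp
    qed
  next
    fix W f assume W: "jopen A W" "jsmooth_on A W f"
    show "jsmooth_on A (jet_space A \<inter> W) (\<lambda>p. b p * X p f)"
    proof (rule jsmooth_on_local)
      fix p assume p: "p \<in> jet_space A \<inter> W"
      have "jsmooth_on A (Z \<inter> W) (\<lambda>p. b p * X p f)"
        by (rule jsmooth_on_cong[OF jopen_Int[OF Z(1) W(1)] _ jsmooth_on_const[of _ 0]]) (simp add: Z(3))
      moreover have "jsmooth_on A (jdom A C \<inter> W) (\<lambda>p. b p * X p f)"
        by (rule smooth_field_onD(2)[OF smooth_field_scale[OF jopen_jdom[OF C] X bC] W])
      moreover have "p \<in> Z \<inter> W \<or> p \<in> jdom A C \<inter> W" using Z(2) p by auto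
      ultimately show "\<exists>W. jopen A W \<and> p \<in> W \<and> jsmooth_on A W (\<lambda>p. b p * X p f)"
        using jopen_Int[OF Z(1) W(1)] jopen_Int[OF jopen_jdom[OF C] W(1)] by blast
    qed
  qed
qed

text \<open>A cutoff that is \<open>1\<close> near \<open>p\<close> exhibits an extension, so the choice made by \<open>global_ext\<close> is one.\<close>

lemma global_ext:
  assumes C: "C \<in> jcharts A" "p \<in> jdom A C" and X: "smooth_field_on (jdom A C) X"
  shows "global_ext A p X \<in> vector_fields A"
    and "\<exists>V. jopen A V \<and> p \<in> V \<and> (\<forall>q\<in>V. global_ext A p X q = X q)"
proof -
  obtain b W where b: "cutoff C b" "jopen A W" "p \<in> W" "\<And>q. q \<in> W \<Longrightarrow> b q = 1"
    using cutoff_exists[OF C jopen_jdom[OF C(1)] C(2)] by metis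
  have "\<exists>X'. X' \<in> vector_fields A \<and> (\<exists>V. jopen A V \<and> p \<in> V \<and> (\<forall>q\<in>V. X' q = X q))"
    by (rule exI[of _ "\<lambda>p f. b p * X p f"]) (use cutoff_field[OF C(1) b(1) X] b in auto)
  then have "global_ext A p X \<in> vector_fields A \<and>
      (\<exists>V. jopen A V \<and> p \<in> V \<and> (\<forall>q\<in>V. global_ext A p X q = X q))"
    unfolding global_ext_def by (rule someI_ex)
  then show "global_ext A p X \<in> vector_fields A"
    "\<exists>V. jopen A V \<and> p \<in> V \<and> (\<forall>q\<in>V. global_ext A p X q = X q)" by auto
qed

end

section \<open>The torsion of a linear connection is a tensor\<close>

locale jet_connection = smooth_manifold A for A :: "('m::t2_space, real^'n) chart set" +
  fixes D :: "'m jfield \<Rightarrow> 'm jfield \<Rightarrow> 'm jfield"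
  assumes connection: "linear_connection A D"
begin

lemma
  assumes "X \<in> vector_fields A" "Y \<in> vector_fields A"
  shows D_field: "D X Y \<in> vector_fields A"
    and D_add_left: "Z \<in> vector_fields A \<Longrightarrow> D (\<lambda>p f. X p f + Y p f) Z = (\<lambda>p f. D X Z p f + D Y Z p f)"
    and D_add_right: "Z \<in> vector_fields A \<Longrightarrow> D X (\<lambda>p f. Y p f + Z p f) = (\<lambda>p f. D X Y p f + D X Z p f)"
    and D_scale_left: "jsmooth_on A (jet_space A) g \<Longrightarrow> D (\<lambda>p f. g p * X p f) Y = (\<lambda>p f. g p * D X Y p f)"
    and D_scale_right: "jsmooth_on A (jet_space A) g \<Longrightarrow>
      D X (\<lambda>p f. g p * Y p f) = (\<lambda>p f. X p g * Y p f + g p * D X Y p f)"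
  using connection assms unfolding linear_connection_def by blast+

text \<open>Multiply by a cutoff that is \<open>1\<close> near \<open>p\<close> and vanishes outside \<open>V\<close>: the products agree
  everywhere, the rules for \<open>D\<close> take the factor out again, and the derivative term of the cutoff in the
  second argument is the same for \<open>Y\<close> and \<open>Y'\<close>.\<close>

lemma D_local:
  assumes X: "X \<in> vector_fields A" "X' \<in> vector_fields A" and Y: "Y \<in> vector_fields A" "Y' \<in> vector_fields A"
    and V: "jopen A V" "p \<in> V" "\<And>q. q \<in> V \<Longrightarrow> X q = X' q" "\<And>q. q \<in> V \<Longrightarrow> Y q = Y' q"
  shows "D X Y p = D X' Y' p"
proof
  fix f
  have "p \<in> jet_space A" using jopen_subset[OF V(1)] V(2) by blast
  then obtain C where C: "C \<in> jcharts A" "p \<in> jdom A C" by (rule jet_space_covered)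
  obtain b W where b: "cutoff C b" "p \<in> W" "\<And>q. q \<in> W \<Longrightarrow> b q = 1" "\<And>q. q \<notin> V \<Longrightarrow> b q = 0"
    using cutoff_exists[OF C V(1,2)] by metis
  have bs: "jsmooth_on A (jet_space A) b" using b(1) unfolding cutoff_def by blast
  have b1: "b p = 1" using b(2,3) by blast
  have "b q * X q f = b q * X' q f" "b q * Y q f = b q * Y' q f" for q f
    using V(3,4)[of q] b(4)[of q] by (cases "q \<in> V"; simp)+
  then have eq: "(\<lambda>q f. b q * X q f) = (\<lambda>q f. b q * X' q f)" "(\<lambda>q f. b q * Y q f) = (\<lambda>q f. b q * Y' q f)"
    by (simp_all add: fun_eq_iff)
  have "D X Y p f = D X' Y p f"
    using fun_cong[OF fun_cong[OF D_scale_left[OF X(1) Y(1) bs]], of p f]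
      fun_cong[OF fun_cong[OF D_scale_left[OF X(2) Y(1) bs]], of p f] by (simp add: eq b1)
  also have "D X' Y p f = D X' Y' p f"
    using fun_cong[OF fun_cong[OF D_scale_right[OF X(2) Y(1) bs]], of p f]
      fun_cong[OF fun_cong[OF D_scale_right[OF X(2) Y(2) bs]], of p f] by (simp add: eq b1 V(4)[OF V(2)])
  finally show "D X Y p f = D X' Y' p f" .
qed

text \<open>By locality the choice made in \<open>global_ext\<close> does not matter.\<close>

lemma localized_eq:
  assumes C: "C \<in> jcharts A" "p \<in> jdom A C"
    and X: "smooth_field_on (jdom A C) X" "X' \<in> vector_fields A"
    and Y: "smooth_field_on (jdom A C) Y" "Y' \<in> vector_fields A"
    and V: "jopen A V" "p \<in> V" "\<And>q. q \<in> V \<Longrightarrow> X' q = X q" "\<And>q. q \<in> V \<Longrightarrow> Y' q = Y q"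
  shows "localized A D X Y p = D X' Y' p"
proof -
  obtain V1 where V1: "jopen A V1" "p \<in> V1" "\<And>q. q \<in> V1 \<Longrightarrow> global_ext A p X q = X q"
    using global_ext(2)[OF C X(1)] by blast
  obtain V2 where V2: "jopen A V2" "p \<in> V2" "\<And>q. q \<in> V2 \<Longrightarrow> global_ext A p Y q = Y q"
    using global_ext(2)[OF C Y(1)] by blast
  show ?thesis
    unfolding localized_def
    by (rule D_local[OF global_ext(1)[OF C X(1)] X(2) global_ext(1)[OF C Y(1)] Y(2)
          jopen_Int[OF jopen_Int[OF V1(1) V2(1)] V(1)]])
      (use V V1 V2 in auto)
qed

lemma lie_bracket_local:
  assumes V: "jopen A V" "p \<in> V" "\<And>q. q \<in> V \<Longrightarrow> X' q = X q" "\<And>q. q \<in> V \<Longrightarrow> Y' q = Y q"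
    and "X p \<in> tangent_space A p" "Y p \<in> tangent_space A p"
  shows "lie_bracket A X Y p = lie_bracket A X' Y' p"
proof
  fix f
  have "X p (\<lambda>q. Y q f) = X p (\<lambda>q. Y' q f)" "Y p (\<lambda>q. X q f) = Y p (\<lambda>q. X' q f)"
    by (rule tangent_germ[OF assms(5) V(1,2)]; simp add: V(4))
      (rule tangent_germ[OF assms(6) V(1,2)]; simp add: V(3))
  then show "lie_bracket A X Y p f = lie_bracket A X' Y' p f"
    by (simp add: lie_bracket_def V(3)[OF V(2)] V(4)[OF V(2)])
qed

lemma torsion_localized:
  assumes C: "C \<in> jcharts A" "p \<in> jdom A C"
    and X: "smooth_field_on (jdom A C) X" "X' \<in> vector_fields A"
    and Y: "smooth_field_on (jdom A C) Y" "Y' \<in> vector_fields A"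
    and V: "jopen A V" "p \<in> V" "\<And>q. q \<in> V \<Longrightarrow> X' q = X q" "\<And>q. q \<in> V \<Longrightarrow> Y' q = Y q"
  shows "torsion A (localized A D) X Y p = torsion A D X' Y' p"
proof
  fix f
  have 1: "localized A D X Y p = D X' Y' p" by (rule localized_eq[OF assms])
  have 2: "localized A D Y X p = D Y' X' p" by (rule localized_eq[OF C Y X V(1,2,4,3)])
  have 3: "lie_bracket A X Y p = lie_bracket A X' Y' p"
    using smooth_field_onD(1)[OF X(1) C(2)] smooth_field_onD(1)[OF Y(1) C(2)] V
    by (intro lie_bracket_local[where V = V]) auto
  show "torsion A (localized A D) X Y p f = torsion A D X' Y' p f"
    by (simp only: torsion_def 1 2 3)
qed

lemma vector_field_tangent: "X \<in> vector_fields A \<Longrightarrow> p \<in> jet_space A \<Longrightarrow> X p \<in> tangent_space A p"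
  by (rule smooth_field_onD(1)[OF vector_field_smooth])

lemma vector_field_near:
  "X \<in> vector_fields A \<Longrightarrow> jsmooth_near A p f \<Longrightarrow> jsmooth_near A p (\<lambda>q. X q f)"
  using smooth_field_near[OF vector_field_smooth jopen_jet_space] jopen_subset
  unfolding jsmooth_near_def by blast

lemma jsmooth_near_jet_space: "jsmooth_near A p f \<Longrightarrow> p \<in> jet_space A"
  using jopen_subset by (auto simp: jsmooth_near_def)

lemma torsion_antisym: "torsion A D Y X p f = - torsion A D X Y p f"
  by (simp add: torsion_def lie_bracket_def)

lemma torsion_add_left:
  assumes X: "X \<in> vector_fields A" "X' \<in> vector_fields A" and Y: "Y \<in> vector_fields A"
  shows "torsion A D (\<lambda>p f. X p f + X' p f) Y p f = torsion A D X Y p f + torsion A D X' Y p f"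
proof -
  have "lie_bracket A (\<lambda>p f. X p f + X' p f) Y p f = lie_bracket A X Y p f + lie_bracket A X' Y p f"
  proof (cases "jsmooth_near A p f")
    case True
    then show ?thesis
      using tangent_add[OF vector_field_tangent[OF Y jsmooth_near_jet_space[OF True]]
          vector_field_near[OF X(1) True] vector_field_near[OF X(2) True]]
      by (simp add: lie_bracket_def)
  qed (simp add: lie_bracket_def)
  then show ?thesis
    by (simp add: torsion_def D_add_left[OF X Y] D_add_right[OF Y X])
qed

text \<open>The derivative of \<open>g\<close> along \<open>Y\<close> enters through \<open>D Y (g X)\<close> and through the bracket, and cancels.\<close>

lemma torsion_scale_left:
  assumes X: "X \<in> vector_fields A" and Y: "Y \<in> vector_fields A" and g: "jsmooth_on A (jet_space A) g"
  shows "torsion A D (\<lambda>p f. g p * X p f) Y p f = g p * torsion A D X Y p f"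
proof (cases "jsmooth_near A p f")
  case True
  note p = jsmooth_near_jet_space[OF True]
  have "jsmooth_near A p g" by (rule jsmooth_nearI[OF jopen_jet_space p g])
  from tangent_mult[OF vector_field_tangent[OF Y p] this vector_field_near[OF X True]]
  show ?thesis
    using True by (simp add: torsion_def lie_bracket_def D_scale_left[OF X Y g] D_scale_right[OF Y X g] algebra_simps)
next
  case False
  have "X p f = 0"
    using tangent_not_smooth[OF vector_field_tangent[OF X] False] vector_field_outside[OF X] by blast
  then show ?thesis
    using False by (simp add: torsion_def lie_bracket_def D_scale_left[OF X Y g] D_scale_right[OF Y X g] algebra_simps)
qed

lemma field_comb:
  assumes "\<And>i. i \<in> I \<Longrightarrow> F i \<in> vector_fields A" "\<And>i. i \<in> I \<Longrightarrow> jsmooth_on A (jet_space A) (g i)"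
  shows "(\<lambda>p f. \<Sum>i\<in>I. g i p * F i p f) \<in> vector_fields A"
  using assms
proof (induction I rule: infinite_finite_induct)
  case (insert i I)
  have "(\<lambda>p f. g i p * F i p f + (\<Sum>i\<in>I. g i p * F i p f)) \<in> vector_fields A"
    by (intro vector_field_add vector_field_scale insert.IH) (use insert.prems in auto)
  with insert.hyps show ?case by simp
qed (use zero_tangent in \<open>auto intro!: vector_fieldI simp: smooth_field_on_def jsmooth_on_const\<close>)

lemma torsion_comb_left:
  assumes "finite I" "\<And>i. i \<in> I \<Longrightarrow> F i \<in> vector_fields A"
    "\<And>i. i \<in> I \<Longrightarrow> jsmooth_on A (jet_space A) (g i)" and Y: "Y \<in> vector_fields A"
  shows "torsion A D (\<lambda>p f. \<Sum>i\<in>I. g i p * F i p f) Y p f = (\<Sum>i\<in>I. g i p * torsion A D (F i) Y p f)"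
  using assms(1-3)
proof (induction I rule: finite_induct)
  case empty
  show ?case using torsion_scale_left[OF Y Y jsmooth_on_const[of _ 0], of p f] by simp
next
  case (insert i I)
  have "torsion A D (\<lambda>p f. g i p * F i p f + (\<Sum>i\<in>I. g i p * F i p f)) Y p f =
      torsion A D (\<lambda>p f. g i p * F i p f) Y p f + torsion A D (\<lambda>p f. \<Sum>i\<in>I. g i p * F i p f) Y p f"
    by (rule torsion_add_left[OF vector_field_scale field_comb Y]) (use insert.prems in auto)
  moreover have "torsion A D (\<lambda>p f. g i p * F i p f) Y p f = g i p * torsion A D (F i) Y p f"
    by (rule torsion_scale_left[OF _ Y]) (use insert.prems in auto)
  moreover have "torsion A D (\<lambda>p f. \<Sum>i\<in>I. g i p * F i p f) Y p f = (\<Sum>i\<in>I. g i p * torsion A D (F i) Y p f)"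
    by (rule insert.IH) (use insert.prems in auto)
  ultimately show ?case using insert.hyps by simp
qed

text \<open>On the chart \<open>X\<close> is a combination of the coordinate fields whose coefficients vanish at \<open>p\<close>. Two
  cutoff factors, one for the coefficients and one for the coordinate fields, make this a combination of
  global fields with global coefficients, from which function-linearity takes the coefficients out.\<close>

lemma torsion_vanish:
  assumes X: "X \<in> vector_fields A" and Y: "Y \<in> vector_fields A" and p: "p \<in> jet_space A"
    and 0: "\<And>f. X p f = 0"
  shows "torsion A D X Y p f = 0"
proof -
  obtain C where C: "C \<in> jcharts A" "p \<in> jdom A C" using p by (rule jet_space_covered)
  obtain b W where b: "cutoff C b" "p \<in> W" "\<And>q. q \<in> W \<Longrightarrow> b q = 1" "\<And>q. q \<notin> jdom A C \<Longrightarrow> b q = 0"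
    using cutoff_exists[OF C jopen_jdom[OF C(1)] C(2)] by metis
  have bs: "jsmooth_on A (jet_space A) b" using b(1) unfolding cutoff_def by blast
  have b1: "b p = 1" using b(2,3) by blast
  have sub: "jdom A C \<subseteq> jet_space A" by (rule jopen_subset[OF jopen_jdom[OF C(1)]])
  have "jsmooth_on A (jet_space A \<inter> jdom A C) (\<lambda>q. X q (co C \<kappa>))" for \<kappa>
    by (rule smooth_field_onD(2)[OF vector_field_smooth[OF X] jopen_jdom[OF C(1)] jsmooth_on_co[OF C(1)]])
  then have g: "jsmooth_on A (jet_space A) (\<lambda>q. b q * X q (co C \<kappa>))" for \<kappa>
    using cutoff_function[OF C(1) b(1)] sub by (simp add: Int_absorb1)
  have F: "(\<lambda>q f. b q * pd C \<kappa> q f) \<in> vector_fields A" for \<kappa>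
    by (rule cutoff_field[OF C(1) b(1) smooth_field_pd[OF C(1)]])
  have eq: "(\<lambda>q f. b q * (b q * X q f)) = (\<lambda>q f. \<Sum>\<kappa>\<in>UNIV. (b q * X q (co C \<kappa>)) * (b q * pd C \<kappa> q f))"
  proof (intro ext)
    fix q f
    show "b q * (b q * X q f) = (\<Sum>\<kappa>\<in>UNIV. (b q * X q (co C \<kappa>)) * (b q * pd C \<kappa> q f))"
    proof (cases "q \<in> jdom A C")
      case True
      then have "X q \<in> tangent_space A q" using vector_field_tangent[OF X] sub by blast
      from tangent_expand[OF C(1) True this, of f] show ?thesis
        by (simp add: sum_distrib_left mult_ac)
    qed (simp add: b(4))
  qed
  have "torsion A D (\<lambda>q f. b q * (b q * X q f)) Y p f = torsion A D X Y p f"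
    unfolding torsion_scale_left[OF vector_field_scale[OF X bs] Y bs] torsion_scale_left[OF X Y bs]
    by (simp add: b1)
  moreover have "torsion A D (\<lambda>q f. b q * (b q * X q f)) Y p f = 0"
    unfolding eq torsion_comb_left[OF finite F g Y] by (simp add: 0)
  ultimately show ?thesis by simp
qed

lemma torsion_pointwise:
  assumes X: "X \<in> vector_fields A" "X' \<in> vector_fields A" and Y: "Y \<in> vector_fields A" "Y' \<in> vector_fields A"
    and p: "p \<in> jet_space A" and eq: "\<And>f. X p f = X' p f" "\<And>f. Y p f = Y' p f"
  shows "torsion A D X Y p f = torsion A D X' Y' p f"
proof -
  have left: "torsion A D X Y p f = torsion A D X' Y p f"
    if X: "X \<in> vector_fields A" "X' \<in> vector_fields A" and Y: "Y \<in> vector_fields A"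
      and eq: "\<And>f. X p f = X' p f" for X X' Y
  proof -
    have X'': "(\<lambda>q f. - 1 * X' q f) \<in> vector_fields A"
      by (rule vector_field_scale[OF X(2) jsmooth_on_const])
    have "torsion A D (\<lambda>q f. X q f + - 1 * X' q f) Y p f = 0"
      by (rule torsion_vanish[OF vector_field_add[OF X(1) X''] Y p]) (simp add: eq)
    then show ?thesis
      unfolding torsion_add_left[OF X(1) X'' Y] torsion_scale_left[OF X(2) Y jsmooth_on_const] by simp
  qed
  have "torsion A D X Y p f = torsion A D X' Y p f" by (rule left[OF X Y(1) eq(1)])
  also have "\<dots> = - torsion A D Y X' p f" by (rule torsion_antisym)
  also have "\<dots> = - torsion A D Y' X' p f" using left[OF Y X(2) eq(2)] by simp
  also have "\<dots> = torsion A D X' Y' p f" using torsion_antisym[of Y' X' p f] by simp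
  finally show ?thesis .
qed

text \<open>The fields may be replaced by combinations with constant coefficients of extended frame
  fields, since only their values at \<open>p\<close> matter.\<close>

lemma torsion_expand:
  fixes E :: "'k::finite \<Rightarrow> 'm jfield"
  assumes C: "C \<in> jcharts A" "p \<in> jdom A C" and E: "\<And>\<kappa>. smooth_field_on (jdom A C) (E \<kappa>)"
    and X: "X \<in> vector_fields A" "\<And>f. X p f = (\<Sum>\<kappa>\<in>UNIV. a \<kappa> * E \<kappa> p f)"
    and Y: "Y \<in> vector_fields A" "\<And>f. Y p f = (\<Sum>\<kappa>\<in>UNIV. b \<kappa> * E \<kappa> p f)"
  shows "torsion A D X Y p f =
    (\<Sum>\<alpha>\<in>UNIV. \<Sum>\<beta>\<in>UNIV. a \<alpha> * b \<beta> * torsion A (localized A D) (E \<alpha>) (E \<beta>) p f)"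
proof -
  obtain c W where c: "cutoff C c" "jopen A W" "p \<in> W" "\<And>q. q \<in> W \<Longrightarrow> c q = 1"
    using cutoff_exists[OF C jopen_jdom[OF C(1)] C(2)] by metis
  define F where "F \<kappa> = (\<lambda>q f. c q * E \<kappa> q f)" for \<kappa>
  have F: "F \<kappa> \<in> vector_fields A" for \<kappa> unfolding F_def by (rule cutoff_field[OF C(1) c(1) E])
  have FE: "F \<kappa> q = E \<kappa> q" if "q \<in> W" for q \<kappa> using c(4)[OF that] by (simp add: F_def)
  have loc: "torsion A (localized A D) (E \<alpha>) (E \<beta>) p = torsion A D (F \<alpha>) (F \<beta>) p" for \<alpha> \<beta>
    by (rule torsion_localized[OF C E F E F c(2,3) FE FE])
  have comb: "(\<lambda>q f. \<Sum>\<kappa>\<in>UNIV. a \<kappa> * F \<kappa> q f) \<in> vector_fields A" for a :: "'k \<Rightarrow> real"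
    by (rule field_comb[OF F jsmooth_on_const])
  have left: "torsion A D (\<lambda>q f. \<Sum>\<kappa>\<in>UNIV. a \<kappa> * F \<kappa> q f) Z p f = (\<Sum>\<kappa>\<in>UNIV. a \<kappa> * torsion A D (F \<kappa>) Z p f)"
    if "Z \<in> vector_fields A" for a Z
    by (rule torsion_comb_left[OF finite F jsmooth_on_const that])
  have p: "p \<in> jet_space A" using C(2) jopen_subset[OF jopen_jdom[OF C(1)]] by blast
  have "torsion A D X Y p f =
      torsion A D (\<lambda>q f. \<Sum>\<kappa>\<in>UNIV. a \<kappa> * F \<kappa> q f) (\<lambda>q f. \<Sum>\<kappa>\<in>UNIV. b \<kappa> * F \<kappa> q f) p f"
    by (rule torsion_pointwise[OF X(1) comb Y(1) comb p]) (simp_all add: X(2) Y(2) FE[OF c(3)])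
  also have "\<dots> = (\<Sum>\<alpha>\<in>UNIV. a \<alpha> * torsion A D (F \<alpha>) (\<lambda>q f. \<Sum>\<kappa>\<in>UNIV. b \<kappa> * F \<kappa> q f) p f)"
    by (rule left[OF comb])
  also have "\<dots> = (\<Sum>\<alpha>\<in>UNIV. a \<alpha> * (\<Sum>\<beta>\<in>UNIV. b \<beta> * torsion A D (F \<alpha>) (F \<beta>) p f))"
  proof (rule sum.cong[OF refl])
    fix \<alpha>
    have "torsion A D (F \<alpha>) (\<lambda>q f. \<Sum>\<kappa>\<in>UNIV. b \<kappa> * F \<kappa> q f) p f =
        - (\<Sum>\<beta>\<in>UNIV. b \<beta> * torsion A D (F \<beta>) (F \<alpha>) p f)"
      unfolding torsion_antisym[of "F \<alpha>"] left[OF F] ..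
    also have "\<dots> = (\<Sum>\<beta>\<in>UNIV. b \<beta> * torsion A D (F \<alpha>) (F \<beta>) p f)"
      by (simp add: torsion_antisym[of "F \<alpha>"] sum_negf)
    finally show "a \<alpha> * torsion A D (F \<alpha>) (\<lambda>q f. \<Sum>\<kappa>\<in>UNIV. b \<kappa> * F \<kappa> q f) p f =
        a \<alpha> * (\<Sum>\<beta>\<in>UNIV. b \<beta> * torsion A D (F \<alpha>) (F \<beta>) p f)" by simp
  qed
  finally show ?thesis by (simp add: loc sum_distrib_left mult.assoc)
qed

lemma jsmooth_on_torsion:
  assumes X: "X \<in> vector_fields A" and Y: "Y \<in> vector_fields A" and V: "jopen A V" "jsmooth_on A V f"
  shows "jsmooth_on A V (\<lambda>p. torsion A D X Y p f)"
proof -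
  have sm: "jsmooth_on A V (\<lambda>p. Z p h)" if "Z \<in> vector_fields A" "jsmooth_on A V h" for Z h
    using smooth_field_onD(2)[OF vector_field_smooth[OF that(1)] V(1) that(2)] jopen_subset[OF V(1)]
    by (simp add: Int_absorb1)
  show ?thesis
  proof (rule jsmooth_on_cong[OF V(1)])
    show "jsmooth_on A V (\<lambda>p. D X Y p f - D Y X p f - (X p (\<lambda>q. Y q f) - Y p (\<lambda>q. X q f)))"
      by (intro jsmooth_on_diff[OF V(1)] sm[OF X sm[OF Y V(2)]] sm[OF Y sm[OF X V(2)]]
          sm[OF D_field[OF X Y] V(2)] sm[OF D_field[OF Y X] V(2)])
  qed (use jsmooth_nearI[OF V(1) _ V(2)] in \<open>simp add: torsion_def lie_bracket_def\<close>)
qed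

end

section \<open>Adapted frames\<close>

declare dir_vec.simps [simp del]

fun same_summand :: "'n dir \<Rightarrow> 'n dir \<Rightarrow> bool" where
  "same_summand Time Time = True"
| "same_summand (Place _) (Place _) = True"
| "same_summand (Fibre _) (Fibre _) = True"
| "same_summand _ _ = False"

lemma (in smooth_manifold) smooth_field_sum:
  assumes V: "jopen A V" and "\<And>i. i \<in> I \<Longrightarrow> smooth_field_on V (F i)" "\<And>i. i \<in> I \<Longrightarrow> jsmooth_on A V (g i)"
  shows "smooth_field_on V (\<lambda>p f. \<Sum>i\<in>I. g i p * F i p f)"
  using assms(2,3)
proof (induction I rule: infinite_finite_induct)
  case (insert i I)
  have "smooth_field_on V (\<lambda>p f. g i p * F i p f + (\<Sum>i\<in>I. g i p * F i p f))"
    by (intro smooth_field_add[OF V] smooth_field_scale[OF V] insert.IH) (use insert.prems in auto)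
  with insert.hyps show ?case by simp
qed (use zero_tangent jopen_subset[OF V] in \<open>auto simp: smooth_field_on_def jsmooth_on_const\<close>)

locale adapted_frame = smooth_manifold A for A :: "('m::t2_space, real^'n) chart set" +
  fixes M :: "('m, 'n) jchart \<Rightarrow> 'n \<Rightarrow> 'm jet \<Rightarrow> real"
    and N :: "('m, 'n) jchart \<Rightarrow> 'n \<Rightarrow> 'n \<Rightarrow> 'm jet \<Rightarrow> real"
  assumes nonlinear: "nonlinear_connection A (M, N)"
begin

text \<open>\<open>M\<close> and \<open>N\<close> as one family, completed by zero in the fibre directions, so that one formula defines
  the three kinds of adapted fields.\<close>

definition nl :: "('m, 'n) jchart \<Rightarrow> 'n dir \<Rightarrow> 'n \<Rightarrow> 'm jet \<Rightarrow> real" where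
  "nl C \<kappa> j = (case \<kappa> of Time \<Rightarrow> M C j | Place i \<Rightarrow> N C j i | Fibre i \<Rightarrow> (\<lambda>_. 0))"

lemma nl_simps [simp]: "nl C Time j = M C j" "nl C (Place i) j = N C j i" "nl C (Fibre i) j = (\<lambda>_. 0)"
  by (simp_all add: nl_def)

definition fr :: "('m, 'n) jchart \<Rightarrow> 'n dir \<Rightarrow> 'm jfield" where
  "fr C \<kappa> = (\<lambda>p f. pd C \<kappa> p f - (\<Sum>j\<in>UNIV. nl C \<kappa> j p * pd C (Fibre j) p f))"

lemma fr_simps: "delta_t A (M, N) C = fr C Time" "delta_x A (M, N) C i = fr C (Place i)" "pd_y A C i = fr C (Fibre i)"
  by (simp_all add: delta_t_def delta_x_def fr_def pd_simps)

lemma jsmooth_on_nl: "C \<in> jcharts A \<Longrightarrow> jsmooth_on A (jdom A C) (nl C \<kappa> j)"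
  using nonlinear by (cases \<kappa>) (auto simp: nonlinear_connection_def jsmooth_on_const)

lemma smooth_field_fr:
  assumes "C \<in> jcharts A"
  shows "smooth_field_on (jdom A C) (fr C \<kappa>)"
proof -
  note V = jopen_jdom[OF assms]
  have "smooth_field_on (jdom A C) (\<lambda>p f. pd C \<kappa> p f + (\<Sum>j\<in>UNIV. - nl C \<kappa> j p * pd C (Fibre j) p f))"
    by (rule smooth_field_add[OF V smooth_field_pd[OF assms] smooth_field_sum[OF V smooth_field_pd[OF assms]
            jsmooth_on_minus[OF V jsmooth_on_nl[OF assms]]]])
  then show ?thesis by (simp add: fr_def sum_negf)
qed

lemma fr_tangent: "C \<in> jcharts A \<Longrightarrow> p \<in> jdom A C \<Longrightarrow> fr C \<kappa> p \<in> tangent_space A p"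
  by (rule smooth_field_onD(1)[OF smooth_field_fr])

text \<open>The dual coframe \<open>dt\<close>, \<open>dx\<^sup>i\<close>, \<open>dy\<^sup>j + M\<^sup>j dt + N\<^sup>j\<^sub>i dx\<^sup>i\<close>: the component of \<open>w\<close> along \<open>fr C \<kappa>\<close>.\<close>

definition cf :: "('m, 'n) jchart \<Rightarrow> 'n dir \<Rightarrow> 'm jet \<Rightarrow> 'm jvec \<Rightarrow> real" where
  "cf C \<kappa> p w = w (co C \<kappa>) +
    (case \<kappa> of Fibre j \<Rightarrow> (\<Sum>\<mu>\<in>UNIV. nl C \<mu> j p * w (co C \<mu>)) | _ \<Rightarrow> 0)"

lemma cf_sum: "cf C \<kappa> p (\<lambda>f. \<Sum>\<mu>\<in>I. a \<mu> * v \<mu> f) = (\<Sum>\<mu>\<in>I. a \<mu> * cf C \<kappa> p (v \<mu>))"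
proof (cases \<kappa>)
  case (Fibre j)
  have "(\<Sum>\<nu>\<in>UNIV. nl C \<nu> j p * (\<Sum>\<mu>\<in>I. a \<mu> * v \<mu> (co C \<nu>))) =
      (\<Sum>\<mu>\<in>I. a \<mu> * (\<Sum>\<nu>\<in>UNIV. nl C \<nu> j p * v \<mu> (co C \<nu>)))"
    unfolding sum_distrib_left by (subst sum.swap) (simp add: mult_ac)
  then show ?thesis
    unfolding cf_def Fibre dir.case by (simp only: distrib_left sum.distrib)
qed (simp_all add: cf_def)

lemma fr_co:
  assumes "C \<in> jcharts A" "p \<in> jdom A C"
  shows "fr C \<kappa> p (co C \<mu>) = (if \<kappa> = \<mu> then 1 else 0) - (case \<mu> of Fibre j \<Rightarrow> nl C \<kappa> j p | _ \<Rightarrow> 0)"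
proof -
  have "(\<Sum>j\<in>UNIV. nl C \<kappa> j p * (if Fibre j = \<mu> then 1 else 0)) = (case \<mu> of Fibre j \<Rightarrow> nl C \<kappa> j p | _ \<Rightarrow> 0)"
    by (cases \<mu>) (simp_all add: if_distrib cong: if_cong)
  then show ?thesis
    unfolding fr_def pd_co[OF assms] by (simp add: eq_commute[of \<mu>])
qed

lemma cf_fr:
  assumes "C \<in> jcharts A" "p \<in> jdom A C"
  shows "cf C \<mu> p (fr C \<kappa> p) = (if \<kappa> = \<mu> then 1 else 0)"
proof (cases \<mu>)
  case (Fibre j)
  have "(\<Sum>\<nu>\<in>UNIV. nl C \<nu> j p * ((if \<kappa> = \<nu> then 1 else 0) - (case \<nu> of Fibre k \<Rightarrow> nl C \<kappa> k p | _ \<Rightarrow> 0))) =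
      (\<Sum>\<nu>\<in>UNIV. nl C \<nu> j p * (if \<kappa> = \<nu> then 1 else 0))"
    by (rule sum.cong[OF refl]) (simp split: dir.split)
  then show ?thesis
    unfolding cf_def Fibre dir.case fr_co[OF assms] by (simp add: if_distrib cong: if_cong)
qed (simp_all add: cf_def fr_co[OF assms] del: co.simps)

lemma cf_comb:
  assumes "C \<in> jcharts A" "p \<in> jdom A C"
  shows "cf C \<mu> p (\<lambda>f. \<Sum>\<kappa>\<in>UNIV. a \<kappa> * fr C \<kappa> p f) = a \<mu>"
  unfolding cf_sum cf_fr[OF assms] by (simp add: if_distrib cong: if_cong)

lemma fr_expand:
  assumes "C \<in> jcharts A" "p \<in> jdom A C" "w \<in> tangent_space A p"
  shows "w f = (\<Sum>\<kappa>\<in>UNIV. cf C \<kappa> p w * fr C \<kappa> p f)"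
proof -
  define S where "S j = (\<Sum>\<mu>\<in>UNIV. nl C \<mu> j p * w (co C \<mu>))" for j
  have "cf C \<kappa> p w * nl C \<kappa> j p = w (co C \<kappa>) * nl C \<kappa> j p" for \<kappa> j
    by (cases \<kappa>) (simp_all add: cf_def)
  then have "(\<Sum>\<kappa>\<in>UNIV. cf C \<kappa> p w * (\<Sum>j\<in>UNIV. nl C \<kappa> j p * pd C (Fibre j) p f)) =
      (\<Sum>\<kappa>\<in>UNIV. \<Sum>j\<in>UNIV. w (co C \<kappa>) * nl C \<kappa> j p * pd C (Fibre j) p f)"
    by (simp only: sum_distrib_left mult.assoc[symmetric])
  also have "\<dots> = (\<Sum>j\<in>UNIV. S j * pd C (Fibre j) p f)"
    unfolding S_def sum_distrib_right by (subst sum.swap) (simp add: mult_ac)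
  finally have 1: "(\<Sum>\<kappa>\<in>UNIV. cf C \<kappa> p w * (\<Sum>j\<in>UNIV. nl C \<kappa> j p * pd C (Fibre j) p f)) =
      (\<Sum>j\<in>UNIV. S j * pd C (Fibre j) p f)" .
  have "cf C \<kappa> p w = w (co C \<kappa>) + (case \<kappa> of Fibre j \<Rightarrow> S j | _ \<Rightarrow> 0)" for \<kappa>
    by (cases \<kappa>) (simp_all add: cf_def S_def)
  then have "(\<Sum>\<kappa>\<in>UNIV. cf C \<kappa> p w * pd C \<kappa> p f) =
      (\<Sum>\<kappa>\<in>UNIV. w (co C \<kappa>) * pd C \<kappa> p f) + (\<Sum>\<kappa>\<in>UNIV. (case \<kappa> of Fibre j \<Rightarrow> S j | _ \<Rightarrow> 0) * pd C \<kappa> p f)"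
    by (simp only: distrib_right sum.distrib)
  also have "(\<Sum>\<kappa>\<in>UNIV. (case \<kappa> of Fibre j \<Rightarrow> S j | _ \<Rightarrow> 0) * pd C \<kappa> p f) = (\<Sum>j\<in>UNIV. S j * pd C (Fibre j) p f)"
    by (simp add: sum_dir)
  also have "(\<Sum>\<kappa>\<in>UNIV. w (co C \<kappa>) * pd C \<kappa> p f) = w f"
    by (rule tangent_expand[OF assms, symmetric])
  finally have 2: "(\<Sum>\<kappa>\<in>UNIV. cf C \<kappa> p w * pd C \<kappa> p f) = w f + (\<Sum>j\<in>UNIV. S j * pd C (Fibre j) p f)" .
  show ?thesis
    unfolding fr_def right_diff_distrib sum_subtractf 1 2 by simp
qed

section \<open>Change of the adapted frame\<close>

text \<open>The entries of the Jacobian of a change of coordinates are computed along the coordinate lines,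
  where \<open>jet_change\<close> is explicit.\<close>

lemma pd_change_line:
  assumes C: "C \<in> jcharts A" "p \<in> jdom A C" and C': "C' \<in> jcharts A" "p \<in> jdom A C'"
  shows "((\<lambda>h. dir_coord \<mu> (jet_change C C' (jcoord C p + h *\<^sub>R dir_vec \<kappa>))) has_vector_derivative
    pd C \<kappa> p (co C' \<mu>)) (at 0)"
proof -
  let ?S = "jcoord C ` (jdom A C' \<inter> jdom A C)"
  let ?g = "\<lambda>z. dir_coord \<mu> (jet_change C C' z)"
  define L where "L = (\<lambda>v. dir_coord \<mu> (frechet_derivative (jet_change C C') (at (jcoord C p)) v))"
  have S: "open ?S" "jcoord C p \<in> ?S" using open_jcoord_image[OF jopen_jdom[OF C'(1)] C(1)] C(2) C'(2) by auto
  have g: "(?g has_derivative L) (at (jcoord C p))"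
    unfolding L_def
    by (rule bounded_linear.has_derivative[OF bounded_linear_dir_coord
          smooth_on_imp_has_derivative[OF smooth_on_jet_change[OF C(1) C'(1)] S(2)]])
  then have "((\<lambda>z. co C' \<mu> (jinv A C z)) has_derivative L) (at (jcoord C p))"
    by (rule has_derivative_transform_within_open[OF _ S])
      (auto simp: jinv_jcoord[OF C(1)] co_eq jcoord_change[OF C(1) C'(1)])
  from coord_deriv_eqI[OF C(2) jsmooth_nearI[OF jopen_jdom[OF C'(1)] C'(2) jsmooth_on_co[OF C'(1)]] this]
  have eq: "pd C \<kappa> p (co C' \<mu>) = L (dir_vec \<kappa>)" .
  have "((\<lambda>h. jcoord C p + h *\<^sub>R dir_vec \<kappa>) has_derivative (\<lambda>h. h *\<^sub>R dir_vec \<kappa>)) (at 0)"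
    by (auto intro!: derivative_eq_intros)
  moreover have "(?g has_derivative L) (at (jcoord C p + 0 *\<^sub>R dir_vec \<kappa>))" using g by simp
  ultimately have "((\<lambda>h. ?g (jcoord C p + h *\<^sub>R dir_vec \<kappa>)) has_derivative (\<lambda>h. L (h *\<^sub>R dir_vec \<kappa>))) (at 0)"
    by (rule has_derivative_compose)
  from has_derivative_imp_has_vector_derivative[OF this] show ?thesis by (simp add: eq)
qed

text \<open>The vanishing blocks reflect that \<open>t'\<close> is a function of \<open>t\<close> alone and \<open>x'\<close> of \<open>x\<close> alone, and the
  fibre block that \<open>y'\<close> is linear in \<open>y\<close>.\<close>

lemma
  assumes C: "C \<in> jcharts A" "p \<in> jdom A C" and C': "C' \<in> jcharts A" "p \<in> jdom A C'"
  shows pd_tco: "pd C (Place i) p (tco C') = 0" "pd C (Fibre i) p (tco C') = 0"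
    and pd_xco: "pd C Time p (xco C' k) = 0" "pd C (Fibre i) p (xco C' k) = 0"
    and pd_Fibre_yco: "pd C (Fibre i) p (yco C' k) = pd C (Place i) p (xco C' k) * pd C' Time p (tco C)"
proof -
  note line = pd_change_line[OF assms]
  have const: "c = 0" if "((\<lambda>h. a) has_vector_derivative c) (at (0::real))" for a c :: real
    using vector_derivative_unique_at[OF that has_vector_derivative_const] .
  show "pd C (Place i) p (tco C') = 0"
    by (rule const) (use line[of Time "Place i"] in \<open>simp add: jet_change_def dir_vec.simps\<close>)
  show "pd C (Fibre i) p (tco C') = 0"
    by (rule const) (use line[of Time "Fibre i"] in \<open>simp add: jet_change_def dir_vec.simps\<close>)
  show "pd C Time p (xco C' k) = 0"
    by (rule const) (use line[of "Place k" Time] in \<open>simp add: jet_change_def dir_vec.simps\<close>)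
  show "pd C (Fibre i) p (xco C' k) = 0"
    by (rule const) (use line[of "Place k" "Fibre i"] in \<open>simp add: jet_change_def dir_vec.simps\<close>)
  obtain I \<tau> U \<phi> where C_eq: "C = ((I, \<tau>), (U, \<phi>))" "(I, \<tau>) \<in> time_charts" "(U, \<phi>) \<in> A"
    using C(1) by (rule jchartsD)
  obtain I' \<tau>' U' \<phi>' where C'_eq: "C' = ((I', \<tau>'), (U', \<phi>'))" "(I', \<tau>') \<in> time_charts" "(U', \<phi>') \<in> A"
    using C'(1) by (rule jchartsD)
  have fs: "fst C = (I, \<tau>)" "snd C = (U, \<phi>)" "fst C' = (I', \<tau>')" "snd C' = (U', \<phi>')"
    by (simp_all add: C_eq(1) C'_eq(1))
  have p: "fst p \<in> I" "fst p \<in> I'" "jet_point p \<in> U" "jet_point p \<in> U'"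
    using C(2) C'(2) by (auto simp: jdom_def fs)
  note jc = jcoord_eq[OF C, unfolded fs snd_conv] and jc' = jcoord_eq[OF C', unfolded fs snd_conv]
  let ?s = "fst p" and ?x = "\<phi> (jet_point p)"
  let ?c = "clock_rate (I', \<tau>') ?s * inverse (clock_rate (I, \<tau>) ?s)"
  let ?P = "frechet_derivative (place_change C C') (at ?x)"
  have s: "time_of C (\<tau> ?s) = ?s" "time_of C' (\<tau>' ?s) = ?s"
    using inv_into_f_f[OF is_chartD(3)[OF time_chartD(1)[OF C_eq(2)]] p(1)]
      inv_into_f_f[OF is_chartD(3)[OF time_chartD(1)[OF C'_eq(2)]] p(2)]
    by (simp_all add: time_of_def fs)
  have "?x \<in> \<phi> ` (U \<inter> U')" using p by blast
  moreover have "place_change C C' = (\<lambda>z. \<phi>' (inv_into U \<phi> z))" by (simp add: fun_eq_iff place_change_def fs)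
  ultimately have P: "(place_change C C' has_derivative ?P) (at ?x)"
    using smooth_on_imp_has_derivative[OF chart_change_smooth[OF C_eq(3) C'_eq(3)]] by simp
  note linP = has_derivative_linear[OF P]
  have time: "pd C' Time p (tco C) = ?c"
  proof (rule vector_derivative_unique_at)
    show "((\<lambda>h. \<tau> (time_of C' (\<tau>' ?s + h))) has_vector_derivative pd C' Time p (tco C)) (at 0)"
      using pd_change_line[OF C' C, of Time Time] by (simp add: jet_change_def dir_vec.simps jc' fs)
    have "((\<lambda>h. \<tau>' ?s + h) has_vector_derivative 1) (at 0)"
      by (auto intro!: derivative_eq_intros)
    moreover have "(time_of C' has_vector_derivative clock_rate (I', \<tau>') ?s) (at (\<tau>' ?s + 0))"
      using has_vector_derivative_clock(1)[OF C'_eq(2) p(2)] by (simp add: time_of_def fs)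
    ultimately have 1: "((time_of C' \<circ> (\<lambda>h. \<tau>' ?s + h)) has_vector_derivative 1 *\<^sub>R clock_rate (I', \<tau>') ?s) (at 0)"
      by (rule vector_diff_chain_at)
    have "(\<tau> has_vector_derivative inverse (clock_rate (I, \<tau>) ?s)) (at ((time_of C' \<circ> (\<lambda>h. \<tau>' ?s + h)) 0))"
      using has_vector_derivative_clock(2)[OF C_eq(2) p(1)] by (simp add: s)
    from vector_diff_chain_at[OF 1 this]
    show "((\<lambda>h. \<tau> (time_of C' (\<tau>' ?s + h))) has_vector_derivative ?c) (at 0)" by (simp add: o_def)
  qed
  have place: "pd C (Place i) p (xco C' k) = ?P (axis i 1) $ k"
  proof (rule vector_derivative_unique_at)
    show "((\<lambda>h. place_change C C' (?x + h *\<^sub>R axis i 1) $ k) has_vector_derivative pd C (Place i) p (xco C' k)) (at 0)"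
      using line[of "Place k" "Place i"] by (simp add: jet_change_def dir_vec.simps jc)
    have "((\<lambda>h. ?x + h *\<^sub>R axis i 1) has_derivative (\<lambda>h. h *\<^sub>R axis i 1)) (at 0)"
      by (auto intro!: derivative_eq_intros)
    moreover have "(place_change C C' has_derivative ?P) (at (?x + 0 *\<^sub>R axis i 1))" using P by simp
    ultimately have "((\<lambda>h. place_change C C' (?x + h *\<^sub>R axis i 1)) has_derivative (\<lambda>h. ?P (h *\<^sub>R axis i 1))) (at 0)"
      by (rule has_derivative_compose)
    from bounded_linear.has_derivative[OF bounded_linear_vec_nth[of k] this]
    show "((\<lambda>h. place_change C C' (?x + h *\<^sub>R axis i 1) $ k) has_vector_derivative ?P (axis i 1) $ k) (at 0)"
      using has_derivative_imp_has_vector_derivative by fastforce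
  qed
  show "pd C (Fibre i) p (yco C' k) = pd C (Place i) p (xco C' k) * pd C' Time p (tco C)"
    unfolding time place
  proof (rule vector_derivative_unique_at)
    let ?y = "clock_rate (I, \<tau>) ?s *\<^sub>R velocity (U, \<phi>) p"
    show "((\<lambda>h. ?c * (?P ?y $ k + h * (?P (axis i 1) $ k))) has_vector_derivative pd C (Fibre i) p (yco C' k)) (at 0)"
      using line[of "Fibre k" "Fibre i"]
      by (simp add: jet_change_def dir_vec.simps jc s fs linear_add[OF linP] linear_cmul[OF linP])
    show "((\<lambda>h. ?c * (?P ?y $ k + h * (?P (axis i 1) $ k))) has_vector_derivative ?P (axis i 1) $ k * ?c) (at 0)"
      unfolding has_real_derivative_iff_has_vector_derivative[symmetric]
      by (auto intro!: derivative_eq_intros)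
  qed
qed

lemma pd_inverse:
  assumes C: "C \<in> jcharts A" "p \<in> jdom A C" and C': "C' \<in> jcharts A" "p \<in> jdom A C'"
  shows "pd C Time p (tco C') * pd C' Time p (tco C) = 1"
    and "(\<Sum>l\<in>UNIV. pd C (Place i) p (xco C' l) * pd C' (Place l) p (xco C k)) = (if k = i then 1 else 0)"
proof -
  have "pd C Time p (co C Time) = (\<Sum>\<mu>\<in>UNIV. pd C Time p (co C' \<mu>) * pd C' \<mu> p (co C Time))"
    by (rule tangent_expand[OF C' pd_tangent[OF C]])
  then show "pd C Time p (tco C') * pd C' Time p (tco C) = 1"
    unfolding pd_co[OF C] by (simp add: sum_dir pd_xco[OF assms] pd_tco[OF C' C])
  have "pd C (Place i) p (co C (Place k)) = (\<Sum>\<mu>\<in>UNIV. pd C (Place i) p (co C' \<mu>) * pd C' \<mu> p (co C (Place k)))"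
    by (rule tangent_expand[OF C' pd_tangent[OF C]])
  then show "(\<Sum>l\<in>UNIV. pd C (Place i) p (xco C' l) * pd C' (Place l) p (xco C k)) = (if k = i then 1 else 0)"
    unfolding pd_co[OF C] by (simp add: sum_dir pd_tco[OF assms] pd_xco[OF C' C])
qed

fun frame_change :: "('m, 'n) jchart \<Rightarrow> ('m, 'n) jchart \<Rightarrow> 'm jet \<Rightarrow> 'n dir \<Rightarrow> 'n dir \<Rightarrow> real" where
  "frame_change C C' p Time Time = pd C Time p (tco C')"
| "frame_change C C' p (Place i) (Place k) = pd C (Place i) p (xco C' k)"
| "frame_change C C' p (Fibre i) (Fibre k) = pd C (Place i) p (xco C' k) * pd C' Time p (tco C)"
| "frame_change C C' p _ _ = 0"

text \<open>The coordinate fields \<open>\<partial>/\<partial>t\<close> and \<open>\<partial>/\<partial>x\<^sup>i\<close> acquire vertical terms \<open>\<partial>y'/\<partial>t\<close> and \<open>\<partial>y'/\<partial>x\<^sup>i\<close> under a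
  change of coordinates. The transformation law of \<open>M\<close> and \<open>N\<close> says exactly that the corrections in
  the adapted fields absorb them, so that the frame changes by a block diagonal matrix.\<close>

lemma fr_change:
  assumes C: "C \<in> jcharts A" "p \<in> jdom A C" and C': "C' \<in> jcharts A" "p \<in> jdom A C'"
  shows "fr C \<kappa> p f = (\<Sum>\<mu>\<in>UNIV. frame_change C C' p \<kappa> \<mu> * fr C' \<mu> p f)"
proof -
  note J = pd_tco[OF assms] pd_xco[OF assms] pd_Fibre_yco[OF assms]
  let ?b = "pd C' Time p (tco C)"
  let ?X = "\<lambda>j k. pd C (Place j) p (xco C' k)"
  have fr_C': "fr C \<kappa> p (tco C') = pd C \<kappa> p (tco C')" "fr C \<kappa> p (xco C' k) = pd C \<kappa> p (xco C' k)"
    "fr C \<kappa> p (yco C' k) = pd C \<kappa> p (yco C' k) - (\<Sum>j\<in>UNIV. nl C \<kappa> j p * (?X j k * ?b))" for \<kappa> k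
    by (simp_all add: fr_def J)
  have cf_Fibre: "cf C' (Fibre k) p (fr C \<kappa> p) =
      pd C \<kappa> p (yco C' k) - (\<Sum>j\<in>UNIV. nl C \<kappa> j p * (?X j k * ?b)) +
      (M C' k p * pd C \<kappa> p (tco C') + (\<Sum>l\<in>UNIV. N C' k l p * pd C \<kappa> p (xco C' l)))" for \<kappa> k
    by (simp add: cf_def sum_dir fr_C')
  have law: "M C' k p = (\<Sum>j\<in>UNIV. M C j p * ?b\<^sup>2 * ?X j k) - ?b * pd C Time p (yco C' k)"
    "N C' k l p = (\<Sum>i\<in>UNIV. \<Sum>j\<in>UNIV. N C j i p * ?b * pd C' (Place l) p (xco C i) * ?X j k)
      - (\<Sum>i\<in>UNIV. pd C' (Place l) p (xco C i) * pd C (Place i) p (yco C' k))" for k l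
    using nonlinear C C' unfolding nonlinear_connection_def pd_simps by blast+
  note ab = pd_inverse(1)[OF assms]
  have Time_0: "cf C' (Fibre k) p (fr C Time p) = 0" for k
  proof -
    have "M C' k p * pd C Time p (tco C') =
        (\<Sum>j\<in>UNIV. M C j p * ?b\<^sup>2 * ?X j k) * pd C Time p (tco C') - ?b * pd C Time p (yco C' k) * pd C Time p (tco C')"
      unfolding law by (rule left_diff_distrib)
    also have "?b * pd C Time p (yco C' k) * pd C Time p (tco C') =
        pd C Time p (yco C' k) * (pd C Time p (tco C') * ?b)" by (simp add: mult_ac)
    also have "(\<Sum>j\<in>UNIV. M C j p * ?b\<^sup>2 * ?X j k) * pd C Time p (tco C') =
        (\<Sum>j\<in>UNIV. M C j p * (?X j k * ?b) * (pd C Time p (tco C') * ?b))"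
      unfolding sum_distrib_right by (rule sum.cong) (simp_all add: power2_eq_square mult_ac)
    finally show ?thesis
      unfolding cf_Fibre by (simp add: ab J)
  qed
  have Place_0: "cf C' (Fibre k) p (fr C (Place i) p) = 0" for i k
  proof -
    define c where "c i' = (\<Sum>j\<in>UNIV. N C j i' p * (?X j k * ?b)) - pd C (Place i') p (yco C' k)" for i'
    have "N C' k l p = (\<Sum>i'\<in>UNIV. pd C' (Place l) p (xco C i') * c i')" for l
      unfolding law c_def right_diff_distrib sum_subtractf sum_distrib_left by (simp add: mult_ac)
    then have "(\<Sum>l\<in>UNIV. N C' k l p * ?X i l) =
        (\<Sum>l\<in>UNIV. \<Sum>i'\<in>UNIV. pd C' (Place l) p (xco C i') * c i' * ?X i l)"
      by (simp add: sum_distrib_right)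
    also have "\<dots> = (\<Sum>i'\<in>UNIV. c i' * (\<Sum>l\<in>UNIV. ?X i l * pd C' (Place l) p (xco C i')))"
      by (subst sum.swap) (simp add: sum_distrib_left mult_ac)
    also have "\<dots> = c i"
      unfolding pd_inverse(2)[OF assms] by (simp add: if_distrib cong: if_cong)
    finally show ?thesis
      unfolding cf_Fibre by (simp add: J c_def)
  qed
  have "cf C' \<mu> p (fr C \<kappa> p) = frame_change C C' p \<kappa> \<mu>" for \<mu>
  proof (cases \<mu>)
    case Time
    then show ?thesis by (cases \<kappa>) (simp_all add: cf_def fr_C' J)
  next
    case (Place k)
    then show ?thesis by (cases \<kappa>) (simp_all add: cf_def fr_C' J)
  next
    case (Fibre k)
    show ?thesis
    proof (cases \<kappa>)
      case (Fibre i)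
      have "cf C' (Fibre k) p (fr C (Fibre i) p) = frame_change C C' p (Fibre i) (Fibre k)"
        unfolding cf_Fibre by (simp add: J)
      then show ?thesis using \<open>\<mu> = Fibre k\<close> Fibre by simp
    qed (simp_all add: \<open>\<mu> = Fibre k\<close> Time_0 Place_0)
  qed
  then show ?thesis
    using fr_expand[OF C' fr_tangent[OF C], of \<kappa> f] by simp
qed

lemma frame_change_block: "\<not> same_summand \<kappa> \<mu> \<Longrightarrow> frame_change C C' p \<kappa> \<mu> = 0"
  by (cases \<kappa>; cases \<mu>) simp_all

section \<open>The three projections\<close>

text \<open>The summands are defined through all charts at once. Block diagonality makes each of them the
  span of its part of the frame of the single chart \<open>C\<close>, and then the decomposition is unique because
  the components in a frame are.\<close>

lemma parts_frame:
  assumes C: "C \<in> jcharts A" "p \<in> jdom A C"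
  shows "parts A (M, N) p (\<lambda>f. \<Sum>\<kappa>\<in>UNIV. a \<kappa> * fr C \<kappa> p f) =
    ((\<lambda>f. a Time * fr C Time p f), (\<lambda>f. \<Sum>i\<in>UNIV. a (Place i) * fr C (Place i) p f),
     (\<lambda>f. \<Sum>i\<in>UNIV. a (Fibre i) * fr C (Fibre i) p f))"
proof -
  have R: "\<exists>a. w = (\<lambda>f. a * fr C Time p f)" if w: "w \<in> summand_R A (M, N) p" for w
  proof -
    obtain C' b where C': "C' \<in> jcharts A" "p \<in> jdom A C'" "w = (\<lambda>f. b * fr C' Time p f)"
      using w unfolding summand_R_def fr_simps by blast
    have "w f = (b * frame_change C' C p Time Time) * fr C Time p f" for f
      unfolding C'(3) fr_change[OF C'(1,2) C, of Time f] by (simp add: sum_dir)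
    then show ?thesis by blast
  qed
  have Mw: "\<exists>a. w = (\<lambda>f. \<Sum>i\<in>UNIV. a i * fr C (Place i) p f)" if w: "w \<in> summand_M A (M, N) p" for w
  proof -
    obtain C' b where C': "C' \<in> jcharts A" "p \<in> jdom A C'" "w = (\<lambda>f. \<Sum>i\<in>UNIV. b i * fr C' (Place i) p f)"
      using w unfolding summand_M_def fr_simps by blast
    have "w f = (\<Sum>k\<in>UNIV. (\<Sum>i\<in>UNIV. b i * frame_change C' C p (Place i) (Place k)) * fr C (Place k) p f)" for f
      unfolding C'(3) fr_change[OF C'(1,2) C, of "Place i" f for i] sum_dir
      by (simp add: sum_distrib_left sum_distrib_right mult_ac) (rule sum.swap)
    note eq = this
    show ?thesis by (rule exI, rule ext, rule eq)
  qed
  have Vw: "\<exists>a. w = (\<lambda>f. \<Sum>i\<in>UNIV. a i * fr C (Fibre i) p f)" if w: "w \<in> summand_V A p" for w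
  proof -
    obtain C' b where C': "C' \<in> jcharts A" "p \<in> jdom A C'" "w = (\<lambda>f. \<Sum>i\<in>UNIV. b i * fr C' (Fibre i) p f)"
      using w unfolding summand_V_def fr_simps by blast
    have "w f = (\<Sum>k\<in>UNIV. (\<Sum>i\<in>UNIV. b i * frame_change C' C p (Fibre i) (Fibre k)) * fr C (Fibre k) p f)" for f
      unfolding C'(3) fr_change[OF C'(1,2) C, of "Fibre i" f for i] sum_dir
      by (simp add: sum_distrib_left sum_distrib_right mult_ac) (rule sum.swap)
    note eq = this
    show ?thesis by (rule exI, rule ext, rule eq)
  qed
  let ?P = "\<lambda>(w1, w2, w3). w1 \<in> summand_R A (M, N) p \<and> w2 \<in> summand_M A (M, N) p \<and>
     w3 \<in> summand_V A p \<and> (\<lambda>f. \<Sum>\<kappa>\<in>UNIV. a \<kappa> * fr C \<kappa> p f) = (\<lambda>f. w1 f + w2 f + w3 f)"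
  show ?thesis
    unfolding parts_def
  proof (rule the_equality)
    show "?P ((\<lambda>f. a Time * fr C Time p f), (\<lambda>f. \<Sum>i\<in>UNIV. a (Place i) * fr C (Place i) p f),
     (\<lambda>f. \<Sum>i\<in>UNIV. a (Fibre i) * fr C (Fibre i) p f))"
    proof (simp only: prod.case, intro conjI)
      show "(\<lambda>f. a Time * fr C Time p f) \<in> summand_R A (M, N) p"
        unfolding summand_R_def fr_simps using C by blast
      show "(\<lambda>f. \<Sum>i\<in>UNIV. a (Place i) * fr C (Place i) p f) \<in> summand_M A (M, N) p"
        unfolding summand_M_def fr_simps mem_Collect_eq using C
        by (intro exI[of _ C] exI[of _ "\<lambda>i. a (Place i)"]) simp
      show "(\<lambda>f. \<Sum>i\<in>UNIV. a (Fibre i) * fr C (Fibre i) p f) \<in> summand_V A p"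
        unfolding summand_V_def fr_simps mem_Collect_eq using C
        by (intro exI[of _ C] exI[of _ "\<lambda>i. a (Fibre i)"]) simp
    qed (simp add: sum_dir)
    fix w assume w: "?P w"
    obtain w1 w2 w3 where w_eq: "w = (w1, w2, w3)" by (cases w)
    obtain a1 a2 a3 where eq: "w1 = (\<lambda>f. a1 * fr C Time p f)" "w2 = (\<lambda>f. \<Sum>i\<in>UNIV. a2 i * fr C (Place i) p f)"
      "w3 = (\<lambda>f. \<Sum>i\<in>UNIV. a3 i * fr C (Fibre i) p f)"
      using w R Mw Vw unfolding w_eq by blast
    define a' where "a' \<kappa> = (case \<kappa> of Time \<Rightarrow> a1 | Place i \<Rightarrow> a2 i | Fibre i \<Rightarrow> a3 i)" for \<kappa>
    have "(\<lambda>f. \<Sum>\<kappa>\<in>UNIV. a \<kappa> * fr C \<kappa> p f) = (\<lambda>f. \<Sum>\<kappa>\<in>UNIV. a' \<kappa> * fr C \<kappa> p f)"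
      using w unfolding w_eq eq by (simp add: sum_dir a'_def)
    then have "a \<kappa> = a' \<kappa>" for \<kappa> using cf_comb[OF C, of \<kappa> a] cf_comb[OF C, of \<kappa> a'] by simp
    then show "w = ((\<lambda>f. a Time * fr C Time p f), (\<lambda>f. \<Sum>i\<in>UNIV. a (Place i) * fr C (Place i) p f),
     (\<lambda>f. \<Sum>i\<in>UNIV. a (Fibre i) * fr C (Fibre i) p f))"
      unfolding w_eq eq by (simp add: a'_def)
  qed
qed

definition proj :: "'n dir \<Rightarrow> 'm jfield \<Rightarrow> 'm jfield" where
  "proj \<beta> = (case \<beta> of Time \<Rightarrow> h_R A (M, N) | Place _ \<Rightarrow> h_M A (M, N) | Fibre _ \<Rightarrow> v_proj A (M, N))"

lemma proj_frame:
  assumes C: "C \<in> jcharts A" "p \<in> jdom A C" and X: "X p = (\<lambda>f. \<Sum>\<kappa>\<in>UNIV. a \<kappa> * fr C \<kappa> p f)"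
  shows "proj \<beta> X p = (\<lambda>f. \<Sum>\<kappa>\<in>UNIV. (if same_summand \<kappa> \<beta> then a \<kappa> else 0) * fr C \<kappa> p f)"
proof -
  have "p \<in> jet_space A" using C(2) jopen_subset[OF jopen_jdom[OF C(1)]] by blast
  then show ?thesis
    by (cases \<beta>) (simp_all only: proj_def dir.case h_R_def h_M_def v_proj_def if_True X parts_frame[OF C] fst_conv snd_conv,
        simp_all add: sum_dir)
qed

lemma proj_outside: "p \<notin> jet_space A \<Longrightarrow> proj \<beta> X p = (\<lambda>_. 0)"
  by (cases \<beta>) (simp_all add: proj_def h_R_def h_M_def v_proj_def)

end

section \<open>Adapted components of connection and torsion\<close>

lemma comp1_unique:
  assumes "\<And>a. c (\<lambda>f. a * e f) = a"
  shows "comp1 e (\<lambda>f. a * e f) = a"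
  unfolding comp1_def
proof (rule the_equality)
  show "(\<lambda>f. a * e f) = (\<lambda>f. a * e f)" ..
  fix b assume eq: "(\<lambda>f. a * e f) = (\<lambda>f. b * e f)"
  have "b = c (\<lambda>f. b * e f)" by (rule assms[symmetric])
  also have "\<dots> = c (\<lambda>f. a * e f)" unfolding eq ..
  also have "\<dots> = a" by (rule assms)
  finally show "b = a" .
qed

lemma compn_unique:
  fixes e :: "'n::finite \<Rightarrow> 'm jvec"
  assumes "\<And>a k. c k (\<lambda>f. \<Sum>k\<in>UNIV. a k * e k f) = a k"
  shows "compn e (\<lambda>f. \<Sum>k\<in>UNIV. a k * e k f) = a"
  unfolding compn_def
proof (rule the_equality)
  show "(\<lambda>f. \<Sum>k\<in>UNIV. a k * e k f) = (\<lambda>f. \<Sum>k\<in>UNIV. a k * e k f)" ..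
  fix b assume eq: "(\<lambda>f. \<Sum>k\<in>UNIV. a k * e k f) = (\<lambda>f. \<Sum>k\<in>UNIV. b k * e k f)"
  show "b = a"
  proof
    fix k
    have "b k = c k (\<lambda>f. \<Sum>k\<in>UNIV. b k * e k f)" by (rule assms[symmetric])
    also have "\<dots> = c k (\<lambda>f. \<Sum>k\<in>UNIV. a k * e k f)" unfolding eq ..
    also have "\<dots> = a k" by (rule assms)
    finally show "b k = a k" .
  qed
qed

locale gamma_connection = adapted_frame A M N + jet_connection A D
  for A :: "('m::t2_space, real^'n) chart set"
    and M :: "('m, 'n) jchart \<Rightarrow> 'n \<Rightarrow> 'm jet \<Rightarrow> real"
    and N :: "('m, 'n) jchart \<Rightarrow> 'n \<Rightarrow> 'n \<Rightarrow> 'm jet \<Rightarrow> real"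
    and D :: "'m jfield \<Rightarrow> 'm jfield \<Rightarrow> 'm jfield" +
  assumes gamma_linear: "gamma_linear_connection A (M, N) D"
begin

lemma D_proj: "X \<in> vector_fields A \<Longrightarrow> Y \<in> vector_fields A \<Longrightarrow> D X (proj \<beta> Y) = proj \<beta> (D X Y)"
  using gamma_linear unfolding gamma_linear_connection_def by (cases \<beta>) (auto simp: proj_def)

text \<open>Cutoff multiples of the frame fields lie in one summand on all of the jet space. The projections
  fix them globally, not only near \<open>p\<close>, so \<open>D_proj\<close> turns the global identity \<open>proj \<kappa> (E \<kappa>) = E \<kappa>\<close> into
  one for derivatives of \<open>E \<kappa>\<close>.\<close>

lemma frame_extension:
  assumes C: "C \<in> jcharts A" "p \<in> jdom A C"
  obtains E W where "\<And>\<kappa>. E \<kappa> \<in> vector_fields A" "jopen A W" "p \<in> W" "W \<subseteq> jdom A C"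
    "\<And>q \<kappa>. q \<in> W \<Longrightarrow> E \<kappa> q = fr C \<kappa> q" "\<And>\<kappa>. proj \<kappa> (E \<kappa>) = E \<kappa>"
proof -
  obtain b W where b: "cutoff C b" "jopen A W" "p \<in> W" "W \<subseteq> jdom A C" "\<And>q. q \<in> W \<Longrightarrow> b q = 1"
    "\<And>q. q \<notin> jdom A C \<Longrightarrow> b q = 0"
    using cutoff_exists[OF C jopen_jdom[OF C(1)] C(2)] by metis
  define E where "E \<kappa> = (\<lambda>q f. b q * fr C \<kappa> q f)" for \<kappa>
  show thesis
  proof
    show "E \<kappa> \<in> vector_fields A" for \<kappa>
      unfolding E_def by (rule cutoff_field[OF C(1) b(1) smooth_field_fr[OF C(1)]])
    show "E \<kappa> q = fr C \<kappa> q" if "q \<in> W" for q \<kappa> using b(5)[OF that] by (simp add: E_def)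
    show "proj \<kappa> (E \<kappa>) = E \<kappa>" for \<kappa>
    proof
      fix q
      show "proj \<kappa> (E \<kappa>) q = E \<kappa> q"
      proof (cases "q \<in> jet_space A")
        case False
        moreover have "q \<notin> jdom A C" using False jopen_subset[OF jopen_jdom[OF C(1)]] by blast
        ultimately show ?thesis by (simp add: proj_outside E_def b(6))
      next
        case q: True
        show ?thesis
        proof (cases "q \<in> jdom A C")
          case True
          have "E \<kappa> q = (\<lambda>f. \<Sum>\<mu>\<in>UNIV. (if \<mu> = \<kappa> then b q else 0) * fr C \<mu> q f)"
            by (simp add: E_def if_distrib if_distribR cong: if_cong)
          from proj_frame[where X = "E \<kappa>", OF C(1) True this, of \<kappa>]
          have "proj \<kappa> (E \<kappa>) q = (\<lambda>f. \<Sum>\<mu>\<in>UNIV. (if same_summand \<mu> \<kappa> then if \<mu> = \<kappa> then b q else 0 else 0) * fr C \<mu> q f)" .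
          also have "\<dots> = (\<lambda>f. \<Sum>\<mu>\<in>UNIV. (if \<mu> = \<kappa> then b q else 0) * fr C \<mu> q f)"
            by (intro ext sum.cong refl) (cases \<kappa>; simp)
          finally show ?thesis using \<open>E \<kappa> q = _\<close> by simp
        next
          case False
          obtain C' where C': "C' \<in> jcharts A" "q \<in> jdom A C'" using q by (rule jet_space_covered)
          have "E \<kappa> q = (\<lambda>f. \<Sum>\<mu>\<in>UNIV. 0 * fr C' \<mu> q f)" by (simp add: E_def b(6)[OF False])
          from proj_frame[where X = "E \<kappa>", OF C' this] show ?thesis
            by (simp add: E_def b(6)[OF False])
        qed
      qed
    qed
  qed (fact b)+
qed

definition conn :: "('m, 'n) jchart \<Rightarrow> 'n dir \<Rightarrow> 'n dir \<Rightarrow> 'n dir \<Rightarrow> 'm jet \<Rightarrow> real" where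
  "conn C \<gamma> \<alpha> \<beta> p = cf C \<gamma> p (localized A D (fr C \<alpha>) (fr C \<beta>) p)"

text \<open>\<open>D (E \<alpha>) (E \<beta>) = D (E \<alpha>) (proj \<beta> (E \<beta>)) = proj \<beta> (D (E \<alpha>) (E \<beta>))\<close>, so the derivative has components in the
  summand of \<open>\<beta>\<close> only.\<close>

lemma localized_frame:
  assumes C: "C \<in> jcharts A" "p \<in> jdom A C"
  shows "localized A D (fr C \<alpha>) (fr C \<beta>) p = (\<lambda>f. \<Sum>\<gamma>\<in>UNIV. conn C \<gamma> \<alpha> \<beta> p * fr C \<gamma> p f)"
    and "\<not> same_summand \<gamma> \<beta> \<Longrightarrow> conn C \<gamma> \<alpha> \<beta> p = 0"
proof -
  obtain E W where E: "\<And>\<kappa>. E \<kappa> \<in> vector_fields A" "jopen A W" "p \<in> W" "W \<subseteq> jdom A C"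
    "\<And>q \<kappa>. q \<in> W \<Longrightarrow> E \<kappa> q = fr C \<kappa> q" "\<And>\<kappa>. proj \<kappa> (E \<kappa>) = E \<kappa>"
    using frame_extension[OF C] by blast
  have loc: "localized A D (fr C \<alpha>) (fr C \<beta>) p = D (E \<alpha>) (E \<beta>) p"
    by (rule localized_eq[OF C smooth_field_fr[OF C(1)] E(1) smooth_field_fr[OF C(1)] E(1) E(2,3) E(5) E(5)])
  have p: "p \<in> jet_space A" using C(2) jopen_subset[OF jopen_jdom[OF C(1)]] by blast
  have "D (E \<alpha>) (E \<beta>) p \<in> tangent_space A p" by (rule vector_field_tangent[OF D_field[OF E(1) E(1)] p])
  from fr_expand[OF C this]
  show 1: "localized A D (fr C \<alpha>) (fr C \<beta>) p = (\<lambda>f. \<Sum>\<gamma>\<in>UNIV. conn C \<gamma> \<alpha> \<beta> p * fr C \<gamma> p f)"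
    unfolding conn_def loc by blast
  have "D (E \<alpha>) (E \<beta>) = proj \<beta> (D (E \<alpha>) (E \<beta>))" using D_proj[OF E(1) E(1), of \<alpha> \<beta> \<beta>] E(6)[of \<beta>] by simp
  then have "D (E \<alpha>) (E \<beta>) p = proj \<beta> (D (E \<alpha>) (E \<beta>)) p" by (rule fun_cong)
  also have "\<dots> = (\<lambda>f. \<Sum>\<gamma>\<in>UNIV. (if same_summand \<gamma> \<beta> then conn C \<gamma> \<alpha> \<beta> p else 0) * fr C \<gamma> p f)"
    by (rule proj_frame[OF C]) (use 1 loc in simp)
  finally have "cf C \<gamma> p (D (E \<alpha>) (E \<beta>) p) = (if same_summand \<gamma> \<beta> then conn C \<gamma> \<alpha> \<beta> p else 0)"
    using cf_comb[OF C] by simp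
  then show "conn C \<gamma> \<alpha> \<beta> p = 0" if "\<not> same_summand \<gamma> \<beta>" using that by (simp add: conn_def loc)
qed

lemma comp_frame:
  assumes C: "C \<in> jcharts A" "p \<in> jdom A C"
  shows "comp1 (fr C Time p) (localized A D (fr C \<alpha>) (fr C Time) p) = conn C Time \<alpha> Time p"
    and "compn (\<lambda>r. fr C (Place r) p) (localized A D (fr C \<alpha>) (fr C (Place i)) p) k = conn C (Place k) \<alpha> (Place i) p"
    and "compn (\<lambda>r. fr C (Fibre r) p) (localized A D (fr C \<alpha>) (fr C (Fibre i)) p) k = conn C (Fibre k) \<alpha> (Fibre i) p"
proof -
  have T: "cf C Time p (\<lambda>f. a * fr C Time p f) = a" for a
    using cf_comb[OF C, of Time "\<lambda>\<kappa>. case \<kappa> of Time \<Rightarrow> a | _ \<Rightarrow> 0"] by (simp add: sum_dir)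
  have P: "cf C (Place k) p (\<lambda>f. \<Sum>k\<in>UNIV. a k * fr C (Place k) p f) = a k" for a k
    using cf_comb[OF C, of "Place k" "\<lambda>\<kappa>. case \<kappa> of Place i \<Rightarrow> a i | _ \<Rightarrow> 0"] by (simp add: sum_dir)
  have F: "cf C (Fibre k) p (\<lambda>f. \<Sum>k\<in>UNIV. a k * fr C (Fibre k) p f) = a k" for a k
    using cf_comb[OF C, of "Fibre k" "\<lambda>\<kappa>. case \<kappa> of Fibre i \<Rightarrow> a i | _ \<Rightarrow> 0"] by (simp add: sum_dir)
  note loc = localized_frame[OF C]
  have "localized A D (fr C \<alpha>) (fr C Time) p = (\<lambda>f. conn C Time \<alpha> Time p * fr C Time p f)"
    unfolding loc(1) by (simp add: sum_dir loc(2))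
  then show "comp1 (fr C Time p) (localized A D (fr C \<alpha>) (fr C Time) p) = conn C Time \<alpha> Time p"
    using comp1_unique[where c = "cf C Time p", OF T] by simp
  have "localized A D (fr C \<alpha>) (fr C (Place i)) p =
      (\<lambda>f. \<Sum>k\<in>UNIV. conn C (Place k) \<alpha> (Place i) p * fr C (Place k) p f)"
    unfolding loc(1) by (simp add: sum_dir loc(2))
  then show "compn (\<lambda>r. fr C (Place r) p) (localized A D (fr C \<alpha>) (fr C (Place i)) p) k = conn C (Place k) \<alpha> (Place i) p"
    using compn_unique[where c = "\<lambda>k. cf C (Place k) p", OF P] by simp
  have "localized A D (fr C \<alpha>) (fr C (Fibre i)) p =
      (\<lambda>f. \<Sum>k\<in>UNIV. conn C (Fibre k) \<alpha> (Fibre i) p * fr C (Fibre k) p f)"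
    unfolding loc(1) by (simp add: sum_dir loc(2))
  then show "compn (\<lambda>r. fr C (Fibre r) p) (localized A D (fr C \<alpha>) (fr C (Fibre i)) p) k = conn C (Fibre k) \<alpha> (Fibre i) p"
    using compn_unique[where c = "\<lambda>k. cf C (Fibre k) p", OF F] by simp
qed

text \<open>In \<open>conn\<close> the direction of differentiation precedes the differentiated field, whereas the
  coefficients carry the index of the differentiated field first.\<close>

lemma coef_conn:
  assumes "C \<in> jcharts A" "p \<in> jdom A C"
  shows "coef_G A (M, N) D C k i p = conn C (Place k) Time (Place i) p"
    "coef_Gv A (M, N) D C k i p = conn C (Fibre k) Time (Fibre i) p"
    "coef_Lbar A (M, N) D C j p = conn C Time (Place j) Time p"
    "coef_L A (M, N) D C k i j p = conn C (Place k) (Place j) (Place i) p"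
    "coef_Lv A (M, N) D C k i j p = conn C (Fibre k) (Place j) (Fibre i) p"
    "coef_Cbar A (M, N) D C j p = conn C Time (Fibre j) Time p"
    "coef_C A (M, N) D C k i j p = conn C (Place k) (Fibre j) (Place i) p"
    "coef_Cv A D C k i j p = conn C (Fibre k) (Fibre j) (Fibre i) p"
  by (simp_all only: coef_G_def coef_Gv_def coef_Lbar_def coef_L_def coef_Lv_def coef_Cbar_def
      coef_C_def coef_Cv_def fr_simps comp_frame[OF assms])

text \<open>The brackets of the frame are vertical: the second order terms cancel because the coordinate
  fields commute, and only derivatives of \<open>M\<close> and \<open>N\<close> survive.\<close>

lemma bracket_frame:
  assumes C: "C \<in> jcharts A" "p \<in> jdom A C"
  shows "lie_bracket A (fr C \<alpha>) (fr C \<beta>) p f =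
    (\<Sum>j\<in>UNIV. (fr C \<beta> p (nl C \<alpha> j) - fr C \<alpha> p (nl C \<beta> j)) * pd C (Fibre j) p f)"
proof (cases "jsmooth_near A p f")
  case True
  note V = jopen_jdom[OF C(1)]
  have near_pd: "jsmooth_near A p (\<lambda>q. pd C \<kappa> q f)" for \<kappa>
    by (rule smooth_field_near[OF smooth_field_pd[OF C(1)] V C(2) True])
  have near_nl: "jsmooth_near A p (nl C \<kappa> j)" for \<kappa> j
    by (rule jsmooth_nearI[OF V C(2) jsmooth_on_nl[OF C(1)]])
  have near_prod: "jsmooth_near A p (\<lambda>q. nl C \<kappa> j q * pd C (Fibre j) q f)" for \<kappa> j
    by (rule jsmooth_near_mult[OF near_nl near_pd])
  define P where "P \<kappa> \<mu> = pd C \<kappa> p (\<lambda>q. pd C \<mu> q f)" for \<kappa> \<mu>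
  have P_sym: "P \<kappa> \<mu> = P \<mu> \<kappa>" for \<kappa> \<mu> unfolding P_def by (rule coord_deriv_commute[OF C True])
  define Q where "Q \<kappa> \<mu> = (\<Sum>j\<in>UNIV. nl C \<kappa> j p * P (Fibre j) \<mu>)" for \<kappa> \<mu>
  have second: "fr C \<alpha> p (\<lambda>q. fr C \<beta> q f) =
      P \<alpha> \<beta> - Q \<alpha> \<beta> - Q \<beta> \<alpha> + (\<Sum>j\<in>UNIV. nl C \<beta> j p * Q \<alpha> (Fibre j))
      - (\<Sum>j\<in>UNIV. fr C \<alpha> p (nl C \<beta> j) * pd C (Fibre j) p f)" for \<alpha> \<beta>
  proof -
    note w = fr_tangent[OF C, of \<alpha>]
    have w_pd: "fr C \<alpha> p (\<lambda>q. pd C \<mu> q f) = P \<alpha> \<mu> - Q \<alpha> \<mu>" for \<mu>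
      by (simp add: fr_def P_def Q_def)
    have "fr C \<alpha> p (\<lambda>q. fr C \<beta> q f) =
        fr C \<alpha> p (\<lambda>q. pd C \<beta> q f - (\<Sum>j\<in>UNIV. nl C \<beta> j q * pd C (Fibre j) q f))"
      by (simp add: fr_def[of C \<beta>])
    also have "\<dots> = fr C \<alpha> p (\<lambda>q. pd C \<beta> q f) - fr C \<alpha> p (\<lambda>q. \<Sum>j\<in>UNIV. nl C \<beta> j q * pd C (Fibre j) q f)"
      by (rule tangent_diff[OF w near_pd jsmooth_near_sum[OF tangent_space_jet[OF w] near_prod]])
    also have "fr C \<alpha> p (\<lambda>q. \<Sum>j\<in>UNIV. nl C \<beta> j q * pd C (Fibre j) q f) =
        (\<Sum>j\<in>UNIV. fr C \<alpha> p (\<lambda>q. nl C \<beta> j q * pd C (Fibre j) q f))"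
      by (rule tangent_sum[OF w near_prod])
    also have "\<dots> = (\<Sum>j\<in>UNIV. fr C \<alpha> p (nl C \<beta> j) * pd C (Fibre j) p f
        + nl C \<beta> j p * (P \<alpha> (Fibre j) - Q \<alpha> (Fibre j)))"
      by (simp only: tangent_mult[OF w near_nl near_pd] w_pd)
    also have "\<dots> = (\<Sum>j\<in>UNIV. fr C \<alpha> p (nl C \<beta> j) * pd C (Fibre j) p f) + Q \<beta> \<alpha>
        - (\<Sum>j\<in>UNIV. nl C \<beta> j p * Q \<alpha> (Fibre j))"
      by (simp only: right_diff_distrib sum.distrib sum_subtractf Q_def[of \<beta>] P_sym[of \<alpha>])
    finally show ?thesis by (simp add: w_pd)
  qed
  have Q_sym: "(\<Sum>j\<in>UNIV. nl C \<beta> j p * Q \<alpha> (Fibre j)) = (\<Sum>j\<in>UNIV. nl C \<alpha> j p * Q \<beta> (Fibre j))"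
  proof -
    have "(\<Sum>j\<in>UNIV. nl C \<beta> j p * Q \<alpha> (Fibre j)) =
        (\<Sum>j\<in>UNIV. \<Sum>i\<in>UNIV. nl C \<beta> j p * (nl C \<alpha> i p * P (Fibre i) (Fibre j)))"
      unfolding Q_def sum_distrib_left ..
    also have "\<dots> = (\<Sum>i\<in>UNIV. \<Sum>j\<in>UNIV. nl C \<alpha> i p * (nl C \<beta> j p * P (Fibre j) (Fibre i)))"
      by (subst sum.swap) (simp add: P_sym mult_ac)
    also have "\<dots> = (\<Sum>j\<in>UNIV. nl C \<alpha> j p * Q \<beta> (Fibre j))"
      unfolding Q_def sum_distrib_left ..
    finally show ?thesis .
  qed
  show ?thesis
    using True by (simp only: lie_bracket_def if_True second[of \<alpha> \<beta>] second[of \<beta> \<alpha>] Q_sym P_sym[of \<alpha> \<beta>]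
        left_diff_distrib sum_subtractf)
next
  case False
  then show ?thesis using tangent_not_smooth[OF pd_tangent[OF C] False] by (simp add: lie_bracket_def)
qed

text \<open>The last term is minus the component of the bracket, which has vertical components only.\<close>

definition tors :: "('m, 'n) jchart \<Rightarrow> 'n dir \<Rightarrow> 'n dir \<Rightarrow> 'n dir \<Rightarrow> 'm jet \<Rightarrow> real" where
  "tors C \<gamma> \<alpha> \<beta> p = conn C \<gamma> \<alpha> \<beta> p - conn C \<gamma> \<beta> \<alpha> p +
    (case \<gamma> of Fibre j \<Rightarrow> fr C \<alpha> p (nl C \<beta> j) - fr C \<beta> p (nl C \<alpha> j) | _ \<Rightarrow> 0)"

lemma torsion_frame:
  assumes C: "C \<in> jcharts A" "p \<in> jdom A C"
  shows "torsion A (localized A D) (fr C \<alpha>) (fr C \<beta>) p = (\<lambda>f. \<Sum>\<gamma>\<in>UNIV. tors C \<gamma> \<alpha> \<beta> p * fr C \<gamma> p f)"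
proof
  fix f
  define R where "R j = fr C \<alpha> p (nl C \<beta> j) - fr C \<beta> p (nl C \<alpha> j)" for j
  have "fr C (Fibre j) = pd C (Fibre j)" for j by (simp add: fr_def)
  then have "lie_bracket A (fr C \<alpha>) (fr C \<beta>) p f = - (\<Sum>j\<in>UNIV. R j * fr C (Fibre j) p f)"
    unfolding bracket_frame[OF C] R_def by (simp add: sum_negf[symmetric] algebra_simps)
  also have "(\<Sum>j\<in>UNIV. R j * fr C (Fibre j) p f) = (\<Sum>\<gamma>\<in>UNIV. (case \<gamma> of Fibre j \<Rightarrow> R j | _ \<Rightarrow> 0) * fr C \<gamma> p f)"
    by (simp add: sum_dir)
  finally have "torsion A (localized A D) (fr C \<alpha>) (fr C \<beta>) p f =
      (\<Sum>\<gamma>\<in>UNIV. conn C \<gamma> \<alpha> \<beta> p * fr C \<gamma> p f) - (\<Sum>\<gamma>\<in>UNIV. conn C \<gamma> \<beta> \<alpha> p * fr C \<gamma> p f)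
      + (\<Sum>\<gamma>\<in>UNIV. (case \<gamma> of Fibre j \<Rightarrow> R j | _ \<Rightarrow> 0) * fr C \<gamma> p f)"
    by (simp add: torsion_def localized_frame(1)[OF C])
  also have "\<dots> = (\<Sum>\<gamma>\<in>UNIV. tors C \<gamma> \<alpha> \<beta> p * fr C \<gamma> p f)"
    unfolding tors_def R_def by (simp only: left_diff_distrib distrib_right sum.distrib sum_subtractf)
  finally show "torsion A (localized A D) (fr C \<alpha>) (fr C \<beta>) p f = (\<Sum>\<gamma>\<in>UNIV. tors C \<gamma> \<alpha> \<beta> p * fr C \<gamma> p f)" .
qed

lemma torsion_adapted:
  assumes C: "C \<in> jcharts A" "p \<in> jdom A C"
    and X: "X \<in> vector_fields A" "\<And>f. X p f = (\<Sum>\<kappa>\<in>UNIV. a \<kappa> * fr C \<kappa> p f)"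
    and Y: "Y \<in> vector_fields A" "\<And>f. Y p f = (\<Sum>\<kappa>\<in>UNIV. b \<kappa> * fr C \<kappa> p f)"
  shows "torsion A D X Y p f =
    (\<Sum>\<gamma>\<in>UNIV. (\<Sum>\<alpha>\<in>UNIV. \<Sum>\<beta>\<in>UNIV. a \<alpha> * b \<beta> * tors C \<gamma> \<alpha> \<beta> p) * fr C \<gamma> p f)"
proof -
  have "torsion A D X Y p f =
      (\<Sum>\<alpha>\<in>UNIV. \<Sum>\<beta>\<in>UNIV. a \<alpha> * b \<beta> * (\<Sum>\<gamma>\<in>UNIV. tors C \<gamma> \<alpha> \<beta> p * fr C \<gamma> p f))"
    using torsion_expand[OF C smooth_field_fr[OF C(1)] X Y] by (simp only: torsion_frame[OF C])
  also have "\<dots> = (\<Sum>\<alpha>\<in>UNIV. \<Sum>\<gamma>\<in>UNIV. \<Sum>\<beta>\<in>UNIV. a \<alpha> * b \<beta> * tors C \<gamma> \<alpha> \<beta> p * fr C \<gamma> p f)"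
    unfolding sum_distrib_left by (subst sum.swap[of _ UNIV UNIV]) (simp only: mult.assoc)
  also have "\<dots> = (\<Sum>\<gamma>\<in>UNIV. \<Sum>\<alpha>\<in>UNIV. \<Sum>\<beta>\<in>UNIV. a \<alpha> * b \<beta> * tors C \<gamma> \<alpha> \<beta> p * fr C \<gamma> p f)"
    by (rule sum.swap)
  finally show ?thesis by (simp only: sum_distrib_right)
qed

text \<open>The torsion of two frame fields of \<open>C\<close> at \<open>p\<close> is expanded in the frame of \<open>C'\<close>, in its arguments
  and in its value.\<close>

lemma tors_change:
  assumes C: "C \<in> jcharts A" "p \<in> jdom A C" and C': "C' \<in> jcharts A" "p \<in> jdom A C'"
  shows "tors C \<gamma> \<alpha> \<beta> p = (\<Sum>\<gamma>'\<in>UNIV. \<Sum>\<alpha>'\<in>UNIV. \<Sum>\<beta>'\<in>UNIV. tors C' \<gamma>' \<alpha>' \<beta>' p *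
    (frame_change C' C p \<gamma>' \<gamma> * frame_change C C' p \<alpha> \<alpha>' * frame_change C C' p \<beta> \<beta>'))"
proof -
  obtain E W where E: "\<And>\<kappa>. E \<kappa> \<in> vector_fields A" "jopen A W" "p \<in> W" "W \<subseteq> jdom A C"
    "\<And>q \<kappa>. q \<in> W \<Longrightarrow> E \<kappa> q = fr C \<kappa> q" "\<And>\<kappa>. proj \<kappa> (E \<kappa>) = E \<kappa>"
    using frame_extension[OF C] by blast
  have Ep: "E \<kappa> p f = (\<Sum>\<mu>\<in>UNIV. frame_change C C' p \<kappa> \<mu> * fr C' \<mu> p f)" for \<kappa> f
    using fr_change[OF C C'] E(5)[OF E(3)] by simp
  define T where "T \<gamma>' = (\<Sum>\<alpha>'\<in>UNIV. \<Sum>\<beta>'\<in>UNIV.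
      frame_change C C' p \<alpha> \<alpha>' * frame_change C C' p \<beta> \<beta>' * tors C' \<gamma>' \<alpha>' \<beta>' p)" for \<gamma>'
  have "(\<lambda>f. \<Sum>\<gamma>\<in>UNIV. tors C \<gamma> \<alpha> \<beta> p * fr C \<gamma> p f) = torsion A D (E \<alpha>) (E \<beta>) p"
    unfolding torsion_frame[OF C, symmetric]
    by (rule torsion_localized[OF C smooth_field_fr[OF C(1)] E(1) smooth_field_fr[OF C(1)] E(1) E(2,3) E(5) E(5)])
  also have "\<dots> = (\<lambda>f. \<Sum>\<gamma>'\<in>UNIV. T \<gamma>' * fr C' \<gamma>' p f)"
    unfolding T_def by (rule ext, rule torsion_adapted[OF C' E(1) Ep E(1) Ep])
  finally have eq: "(\<lambda>f. \<Sum>\<gamma>\<in>UNIV. tors C \<gamma> \<alpha> \<beta> p * fr C \<gamma> p f) = (\<lambda>f. \<Sum>\<gamma>'\<in>UNIV. T \<gamma>' * fr C' \<gamma>' p f)" .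
  have "cf C \<gamma> p (fr C' \<gamma>' p) = frame_change C' C p \<gamma>' \<gamma>" for \<gamma>'
  proof -
    have "fr C' \<gamma>' p = (\<lambda>f. \<Sum>\<mu>\<in>UNIV. frame_change C' C p \<gamma>' \<mu> * fr C \<mu> p f)"
      by (rule ext) (rule fr_change[OF C' C])
    then show ?thesis using cf_comb[OF C] by simp
  qed
  note frame = this
  have "tors C \<gamma> \<alpha> \<beta> p = cf C \<gamma> p (\<lambda>f. \<Sum>\<gamma>'\<in>UNIV. T \<gamma>' * fr C' \<gamma>' p f)"
    unfolding eq[symmetric] by (rule cf_comb[OF C, symmetric])
  also have "\<dots> = (\<Sum>\<gamma>'\<in>UNIV. T \<gamma>' * frame_change C' C p \<gamma>' \<gamma>)"
    by (simp only: cf_sum frame)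
  finally show ?thesis
    unfolding T_def sum_distrib_right by (simp add: mult_ac)
qed

text \<open>Near each point the localized torsion is the torsion of two fixed global fields, whose components
  are smooth.\<close>

lemma jsmooth_on_tors:
  assumes C: "C \<in> jcharts A"
  shows "jsmooth_on A (jdom A C) (tors C \<gamma> \<alpha> \<beta>)"
proof (rule jsmooth_on_local)
  fix p assume p: "p \<in> jdom A C"
  obtain E W where E: "\<And>\<kappa>. E \<kappa> \<in> vector_fields A" "jopen A W" "p \<in> W" "W \<subseteq> jdom A C"
    "\<And>q \<kappa>. q \<in> W \<Longrightarrow> E \<kappa> q = fr C \<kappa> q" "\<And>\<kappa>. proj \<kappa> (E \<kappa>) = E \<kappa>"
    using frame_extension[OF C p] by blast
  have tors_eq: "tors C \<gamma> \<alpha> \<beta> q = cf C \<gamma> q (torsion A D (E \<alpha>) (E \<beta>) q)" if q: "q \<in> W" for q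
  proof -
    have "q \<in> jdom A C" using q E(4) by blast
    note Cq = C this
    have "torsion A D (E \<alpha>) (E \<beta>) q = torsion A (localized A D) (fr C \<alpha>) (fr C \<beta>) q"
      by (rule torsion_localized[OF Cq smooth_field_fr[OF C] E(1) smooth_field_fr[OF C] E(1) E(2) q E(5) E(5), symmetric])
    then show ?thesis using cf_comb[OF Cq] by (simp add: torsion_frame[OF Cq])
  qed
  have sm: "jsmooth_on A W (\<lambda>q. torsion A D (E \<alpha>) (E \<beta>) q (co C \<kappa>))" for \<kappa>
    by (rule jsmooth_on_torsion[OF E(1) E(1) E(2) jsmooth_on_subset[OF jsmooth_on_co[OF C] E(4)]])
  have "jsmooth_on A W (\<lambda>q. cf C \<gamma> q (torsion A D (E \<alpha>) (E \<beta>) q))"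
  proof (cases \<gamma>)
    case (Fibre j)
    show ?thesis
      unfolding cf_def Fibre dir.case
      by (rule jsmooth_on_add[OF E(2) sm jsmooth_on_sum[OF E(2)
            jsmooth_on_mult[OF E(2) jsmooth_on_subset[OF jsmooth_on_nl[OF C] E(4)] sm]]])
  qed (use sm[of \<gamma>] in \<open>simp_all add: cf_def\<close>)
  then have "jsmooth_on A W (tors C \<gamma> \<alpha> \<beta>)"
    by (rule jsmooth_on_cong[OF E(2), rotated]) (simp add: tors_eq)
  then show "\<exists>W. jopen A W \<and> p \<in> W \<and> jsmooth_on A W (tors C \<gamma> \<alpha> \<beta>)" using E(2,3) by blast
qed

end

section \<open>The torsion components form d-tensors\<close>

fun index_dir :: "index_kind \<Rightarrow> 'n option \<Rightarrow> 'n dir" where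
  "index_dir T_up i = Time"
| "index_dir T_lo i = Time"
| "index_dir H_up i = Place (the i)"
| "index_dir H_lo i = Place (the i)"
| "index_dir V_up i = Fibre (the i)"
| "index_dir V_lo i = Fibre (the i)"

fun contravariant :: "index_kind \<Rightarrow> bool" where
  "contravariant T_up = True"
| "contravariant H_up = True"
| "contravariant V_up = True"
| "contravariant _ = False"

lemma same_summand_commute: "same_summand \<kappa> \<mu> = same_summand \<mu> \<kappa>"
  by (cases \<kappa>; cases \<mu>) simp_all

lemma sum_index_dir:
  fixes g :: "'n::finite dir \<Rightarrow> 'b::comm_monoid_add"
  assumes "i \<in> index_range k" and "\<And>\<mu>. \<not> same_summand \<mu> (index_dir k i) \<Longrightarrow> g \<mu> = 0"
  shows "(\<Sum>\<mu>\<in>UNIV. g \<mu>) = (\<Sum>m\<in>index_range k. g (index_dir k m))"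
proof -
  have "inj (Some :: 'n \<Rightarrow> 'n option)" by simp
  then show ?thesis
    using assms(2) by (cases k) (simp_all add: sum_dir sum.reindex)
qed

lemma listset_3: "listset [X, Y, Z] = (\<lambda>(a, b, c). [a, b, c]) ` (X \<times> Y \<times> Z)"
  by (auto simp: set_Cons_def image_iff)

lemma sum_listset_3: "(\<Sum>ms\<in>listset [X, Y, Z]. F ms) = (\<Sum>a\<in>X. \<Sum>b\<in>Y. \<Sum>c\<in>Z. F [a, b, c])"
proof -
  have "inj_on (\<lambda>(a, b, c). [a, b, c]) (X \<times> Y \<times> Z)" by (auto simp: inj_on_def)
  then show ?thesis unfolding listset_3
    by (simp add: sum.reindex sum.cartesian_product case_prod_unfold)
qed

text \<open>Of the nine blocks of the double sum antisymmetry kills one and pairs up the mixed ones; the five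
  that remain are those in the expression for the torsion of two fields.\<close>

lemma antisymmetric_double_sum:
  fixes t :: "'n::finite dir \<Rightarrow> 'n dir \<Rightarrow> real"
  assumes anti: "\<And>\<alpha> \<beta>. t \<beta> \<alpha> = - t \<alpha> \<beta>"
  shows "(\<Sum>\<alpha>\<in>UNIV. \<Sum>\<beta>\<in>UNIV. case_dir a b c \<alpha> * case_dir a' b' c' \<beta> * t \<alpha> \<beta>) =
    (\<Sum>j\<in>UNIV. (b j * a' - a * b' j) * t (Place j) Time)
    + (\<Sum>j\<in>UNIV. \<Sum>i\<in>UNIV. b j * b' i * t (Place j) (Place i))
    + (\<Sum>j\<in>UNIV. (c j * a' - a * c' j) * t (Fibre j) Time)
    + (\<Sum>j\<in>UNIV. \<Sum>i\<in>UNIV. (c j * b' i - b i * c' j) * t (Fibre j) (Place i))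
    + (\<Sum>j\<in>UNIV. \<Sum>i\<in>UNIV. c j * c' i * t (Fibre j) (Fibre i))"
proof -
  have 0: "t Time Time = 0" using anti[of Time Time] by simp
  have TP: "(\<Sum>i\<in>UNIV. a * b' i * t Time (Place i)) = - (\<Sum>i\<in>UNIV. a * b' i * t (Place i) Time)"
    by (simp add: anti[of Time "Place _"] sum_negf)
  have TF: "(\<Sum>i\<in>UNIV. a * c' i * t Time (Fibre i)) = - (\<Sum>i\<in>UNIV. a * c' i * t (Fibre i) Time)"
    by (simp add: anti[of Time "Fibre _"] sum_negf)
  have PF: "(\<Sum>j\<in>UNIV. \<Sum>i\<in>UNIV. b j * c' i * t (Place j) (Fibre i)) =
      - (\<Sum>j\<in>UNIV. \<Sum>i\<in>UNIV. b i * c' j * t (Fibre j) (Place i))"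
    by (subst sum.swap) (simp add: anti[of "Place _" "Fibre _"] sum_negf)
  have "(\<Sum>\<alpha>\<in>UNIV. \<Sum>\<beta>\<in>UNIV. case_dir a b c \<alpha> * case_dir a' b' c' \<beta> * t \<alpha> \<beta>) =
      (\<Sum>i\<in>UNIV. a * b' i * t Time (Place i)) + (\<Sum>i\<in>UNIV. a * c' i * t Time (Fibre i))
      + (\<Sum>j\<in>UNIV. b j * a' * t (Place j) Time) + (\<Sum>j\<in>UNIV. \<Sum>i\<in>UNIV. b j * b' i * t (Place j) (Place i))
      + (\<Sum>j\<in>UNIV. \<Sum>i\<in>UNIV. b j * c' i * t (Place j) (Fibre i))
      + (\<Sum>j\<in>UNIV. c j * a' * t (Fibre j) Time) + (\<Sum>j\<in>UNIV. \<Sum>i\<in>UNIV. c j * b' i * t (Fibre j) (Place i))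
      + (\<Sum>j\<in>UNIV. \<Sum>i\<in>UNIV. c j * c' i * t (Fibre j) (Fibre i))"
    by (simp add: sum_dir sum.distrib 0)
  then show ?thesis
    unfolding TP TF PF by (simp add: left_diff_distrib sum_subtractf)
qed

context gamma_connection begin

lemma index_factor_frame:
  assumes "i \<in> index_range k" "m \<in> index_range k"
  shows "index_factor A C C' p k i m = (if contravariant k
    then frame_change C' C p (index_dir k m) (index_dir k i)
    else frame_change C C' p (index_dir k i) (index_dir k m))"
  by (cases k) (simp_all add: pd_simps)

text \<open>The factors in the d-tensor law are the diagonal blocks of the two frame changes, and the sums over
  all directions in \<open>tors_change\<close> reduce to the index ranges because the other blocks vanish. The first
  argument of the torsion is the last index of the d-tensor.\<close>

lemma d_tensor_tors:
  assumes kinds: "contravariant u" "\<not> contravariant l" "\<not> contravariant l'"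
    and T: "\<And>C p i j k. C \<in> jcharts A \<Longrightarrow> p \<in> jdom A C \<Longrightarrow>
      i \<in> index_range u \<Longrightarrow> j \<in> index_range l \<Longrightarrow> k \<in> index_range l' \<Longrightarrow>
      T C [i, j, k] p = tors C (index_dir u i) (index_dir l' k) (index_dir l j) p"
  shows "d_tensor A [u, l, l'] T"
  unfolding d_tensor_def
proof (intro conjI ballI)
  fix C and ix :: "'n option list" assume C: "C \<in> jcharts A" and "ix \<in> listset (map index_range [u, l, l'])"
  then obtain i j k where ix_eq: "ix = [i, j, k]" "i \<in> index_range u" "j \<in> index_range l" "k \<in> index_range l'"
    by (auto simp: set_Cons_def)
  show "jsmooth_on A (jdom A C) (T C ix)"
    by (rule jsmooth_on_cong[OF jopen_jdom[OF C] _ jsmooth_on_tors[OF C]])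
      (simp only: ix_eq(1) T[OF C _ ix_eq(2-4)])
next
  fix C C' p and ix :: "'n option list"
  assume C: "C \<in> jcharts A" and C': "C' \<in> jcharts A" and p: "p \<in> jdom A C \<inter> jdom A C'"
    and "ix \<in> listset (map index_range [u, l, l'])"
  then obtain i j k where ix_eq: "ix = [i, j, k]" and r: "i \<in> index_range u" "j \<in> index_range l" "k \<in> index_range l'"
    by (auto simp: set_Cons_def)
  note Cp = C IntD1[OF p] and Cp' = C' IntD2[OF p]
  let ?B = "frame_change C C' p" and ?B' = "frame_change C' C p"
  let ?u = "index_dir u i" and ?l = "index_dir l j" and ?l' = "index_dir l' k"
  have "T C ix p = tors C ?u ?l' ?l p" unfolding ix_eq by (rule T[OF Cp r])
  also have "\<dots> = (\<Sum>\<gamma>\<in>UNIV. \<Sum>\<alpha>\<in>UNIV. \<Sum>\<beta>\<in>UNIV. tors C' \<gamma> \<alpha> \<beta> p * (?B' \<gamma> ?u * ?B ?l' \<alpha> * ?B ?l \<beta>))"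
    by (rule tors_change[OF Cp Cp'])
  also have "\<dots> = (\<Sum>\<gamma>\<in>UNIV. \<Sum>\<beta>\<in>UNIV. \<Sum>\<alpha>\<in>UNIV. tors C' \<gamma> \<alpha> \<beta> p * (?B' \<gamma> ?u * ?B ?l' \<alpha> * ?B ?l \<beta>))"
    by (rule sum.cong[OF refl], rule sum.swap)
  also have "\<dots> = (\<Sum>i'\<in>index_range u. \<Sum>\<beta>\<in>UNIV. \<Sum>\<alpha>\<in>UNIV.
      tors C' (index_dir u i') \<alpha> \<beta> p * (?B' (index_dir u i') ?u * ?B ?l' \<alpha> * ?B ?l \<beta>))"
    by (rule sum_index_dir[OF r(1)]) (simp add: frame_change_block)
  also have "\<dots> = (\<Sum>i'\<in>index_range u. \<Sum>j'\<in>index_range l. \<Sum>\<alpha>\<in>UNIV.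
      tors C' (index_dir u i') \<alpha> (index_dir l j') p * (?B' (index_dir u i') ?u * ?B ?l' \<alpha> * ?B ?l (index_dir l j')))"
    by (rule sum.cong[OF refl], rule sum_index_dir[OF r(2)])
      (simp add: frame_change_block same_summand_commute)
  also have "\<dots> = (\<Sum>i'\<in>index_range u. \<Sum>j'\<in>index_range l. \<Sum>k'\<in>index_range l'.
      tors C' (index_dir u i') (index_dir l' k') (index_dir l j') p *
        (?B' (index_dir u i') ?u * ?B ?l' (index_dir l' k') * ?B ?l (index_dir l j')))"
    by (intro sum.cong[OF refl], rule sum_index_dir[OF r(3)])
      (simp add: frame_change_block same_summand_commute)
  also have "\<dots> = (\<Sum>i'\<in>index_range u. \<Sum>j'\<in>index_range l. \<Sum>k'\<in>index_range l'. T C' [i', j', k'] p *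
      (\<Prod>a<length [u, l, l']. index_factor A C C' p ([u, l, l'] ! a) (ix ! a) ([i', j', k'] ! a)))"
  proof (intro sum.cong[OF refl])
    fix i' j' k' :: "'n option" assume r': "i' \<in> index_range u" "j' \<in> index_range l" "k' \<in> index_range l'"
    have "(\<Prod>a<length [u, l, l']. index_factor A C C' p ([u, l, l'] ! a) (ix ! a) ([i', j', k'] ! a)) =
        index_factor A C C' p u i i' * index_factor A C C' p l j j' * index_factor A C C' p l' k k'"
      by (simp add: ix_eq lessThan_Suc mult_ac)
    then show "tors C' (index_dir u i') (index_dir l' k') (index_dir l j') p *
        (?B' (index_dir u i') ?u * ?B ?l' (index_dir l' k') * ?B ?l (index_dir l j')) = T C' [i', j', k'] p *
      (\<Prod>a<length [u, l, l']. index_factor A C C' p ([u, l, l'] ! a) (ix ! a) ([i', j', k'] ! a))"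
      using kinds
      by (simp add: index_factor_frame[OF r(1) r'(1)] index_factor_frame[OF r(2) r'(2)]
          index_factor_frame[OF r(3) r'(3)] T[OF Cp' r'])
  qed
  also have "\<dots> = (\<Sum>ms\<in>listset (map index_range [u, l, l']). T C' ms p *
      (\<Prod>a<length [u, l, l']. index_factor A C C' p ([u, l, l'] ! a) (ix ! a) (ms ! a)))"
    unfolding list.map sum_listset_3 ..
  finally show "T C ix p = (\<Sum>ms\<in>listset (map index_range [u, l, l']). T C' ms p *
      (\<Prod>a<length [u, l, l']. index_factor A C C' p ([u, l, l'] ! a) (ix ! a) (ms ! a)))" .
qed

lemma tors_antisym: "tors C \<gamma> \<beta> \<alpha> p = - tors C \<gamma> \<alpha> \<beta> p"
  by (cases \<gamma>) (simp_all add: tors_def)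

text \<open>A component is zero unless \<open>\<gamma>\<close> lies in the summand of \<open>\<alpha>\<close>, in that of \<open>\<beta>\<close>, or is vertical; in the last
  case the bracket contributes the derivatives of \<open>M\<close> and \<open>N\<close>.\<close>

lemma tors_values:
  assumes C: "C \<in> jcharts A" "p \<in> jdom A C"
  shows
    "tors C \<gamma> Time Time p = 0"
    "tors C Time (Place j) Time p = coef_Lbar A (M, N) D C j p"
    "tors C (Place r) (Place j) Time p = - coef_G A (M, N) D C r j p"
    "tors C (Fibre r) (Place j) Time p = fr C (Place j) p (M C r) - fr C Time p (N C r j)"
    "tors C Time (Place j) (Place i) p = 0"
    "tors C (Place r) (Place j) (Place i) p = coef_L A (M, N) D C r i j p - coef_L A (M, N) D C r j i p"
    "tors C (Fibre r) (Place j) (Place i) p = fr C (Place j) p (N C r i) - fr C (Place i) p (N C r j)"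
    "tors C Time (Fibre j) Time p = coef_Cbar A (M, N) D C j p"
    "tors C (Place r) (Fibre j) Time p = 0"
    "tors C (Fibre r) (Fibre j) Time p = fr C (Fibre j) p (M C r) - coef_Gv A (M, N) D C r j p"
    "tors C Time (Fibre j) (Place i) p = 0"
    "tors C (Place r) (Fibre j) (Place i) p = coef_C A (M, N) D C r i j p"
    "tors C (Fibre r) (Fibre j) (Place i) p = fr C (Fibre j) p (N C r i) - coef_Lv A (M, N) D C r j i p"
    "tors C Time (Fibre j) (Fibre i) p = 0"
    "tors C (Place r) (Fibre j) (Fibre i) p = 0"
    "tors C (Fibre r) (Fibre j) (Fibre i) p = coef_Cv A D C r i j p - coef_Cv A D C r j i p"
  using tors_antisym[of C \<gamma> Time Time p]
  by (simp_all add: tors_def coef_conn[OF C] localized_frame(2)[OF C] tangent_const[OF fr_tangent[OF C]])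

lemma proj_torsion:
  assumes C: "C \<in> jcharts A" "p \<in> jdom A C"
  shows "h_R A (M, N) (torsion A (localized A D) (fr C \<alpha>) (fr C \<beta>)) p = (\<lambda>f. tors C Time \<alpha> \<beta> p * fr C Time p f)"
    and "h_M A (M, N) (torsion A (localized A D) (fr C \<alpha>) (fr C \<beta>)) p =
      (\<lambda>f. \<Sum>r\<in>UNIV. tors C (Place r) \<alpha> \<beta> p * fr C (Place r) p f)"
    and "v_proj A (M, N) (torsion A (localized A D) (fr C \<alpha>) (fr C \<beta>)) p =
      (\<lambda>f. \<Sum>r\<in>UNIV. tors C (Fibre r) \<alpha> \<beta> p * fr C (Fibre r) p f)"
proof -
  note pr = proj_frame[where X = "torsion A (localized A D) (fr C \<alpha>) (fr C \<beta>)", OF C torsion_frame[OF C]]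
  show "h_R A (M, N) (torsion A (localized A D) (fr C \<alpha>) (fr C \<beta>)) p = (\<lambda>f. tors C Time \<alpha> \<beta> p * fr C Time p f)"
    using pr[of Time] by (simp add: proj_def sum_dir)
  show "h_M A (M, N) (torsion A (localized A D) (fr C \<alpha>) (fr C \<beta>)) p =
      (\<lambda>f. \<Sum>r\<in>UNIV. tors C (Place r) \<alpha> \<beta> p * fr C (Place r) p f)"
    \<comment> \<open>any index serves: \<open>proj\<close> only looks at the constructor\<close>
    using pr[of "Place undefined"] by (simp add: proj_def sum_dir)
  show "v_proj A (M, N) (torsion A (localized A D) (fr C \<alpha>) (fr C \<beta>)) p =
      (\<lambda>f. \<Sum>r\<in>UNIV. tors C (Fibre r) \<alpha> \<beta> p * fr C (Fibre r) p f)"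
    using pr[of "Fibre undefined"] by (simp add: proj_def sum_dir)
qed

lemma adapted_vec_eq:
  "adapted_vec A (M, N) C p a b c = (\<lambda>f. \<Sum>\<kappa>\<in>UNIV. case_dir a b c \<kappa> * fr C \<kappa> p f)"
  by (simp add: adapted_vec_def fr_simps sum_dir)

end

section \<open>The torsion d-tensors\<close>

theorem theorem3p2:
  fixes A :: "('m::{t2_space,second_countable_topology}, real^'n) chart set"
    and M :: "('m, 'n) jchart \<Rightarrow> 'n \<Rightarrow> 'm jet \<Rightarrow> real"
    and N :: "('m, 'n) jchart \<Rightarrow> 'n \<Rightarrow> 'n \<Rightarrow> 'm jet \<Rightarrow> real"
    and D :: "'m jfield \<Rightarrow> 'm jfield \<Rightarrow> 'm jfield"
    and \<Gamma> :: "('m, 'n) nlc"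
    and dt :: "('m, 'n) jchart \<Rightarrow> 'm jfield"
    and dx dy :: "('m, 'n) jchart \<Rightarrow> 'n \<Rightarrow> 'm jfield"
    and T :: "'m jfield \<Rightarrow> 'm jfield \<Rightarrow> 'm jfield"
    and Gbar :: "('m, 'n) jchart \<Rightarrow> 'm jet \<Rightarrow> real"
    and Lbar Cbar :: "('m, 'n) jchart \<Rightarrow> 'n \<Rightarrow> 'm jet \<Rightarrow> real"
    and G Gv :: "('m, 'n) jchart \<Rightarrow> 'n \<Rightarrow> 'n \<Rightarrow> 'm jet \<Rightarrow> real"
    and L Lv Cc Cv :: "('m, 'n) jchart \<Rightarrow> 'n \<Rightarrow> 'n \<Rightarrow> 'n \<Rightarrow> 'm jet \<Rightarrow> real"
    and Tbar Pbar :: "('m, 'n) jchart \<Rightarrow> 'n \<Rightarrow> 'm jet \<Rightarrow> real"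
    and T1 R1 P1 :: "('m, 'n) jchart \<Rightarrow> 'n \<Rightarrow> 'n \<Rightarrow> 'm jet \<Rightarrow> real"
    and Tx Rx Ph Pv S :: "('m, 'n) jchart \<Rightarrow> 'n \<Rightarrow> 'n \<Rightarrow> 'n \<Rightarrow> 'm jet \<Rightarrow> real"
  assumes "smooth_structure A"
    and "\<Gamma> = (M, N)"
    and "nonlinear_connection A \<Gamma>"
    and "gamma_linear_connection A \<Gamma> D"
    \<comment> \<open>notation: adapted basis and torsion of local vector fields\<close>
    and "dt = delta_t A \<Gamma>" and "dx = delta_x A \<Gamma>" and "dy = pd_y A"
    and "T = torsion A (localized A D)"
    \<comment> \<open>notation: adapted coefficients\<close>
    and "Gbar = coef_Gbar A \<Gamma> D" and "G = coef_G A \<Gamma> D" and "Gv = coef_Gv A \<Gamma> D"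
    and "Lbar = coef_Lbar A \<Gamma> D" and "L = coef_L A \<Gamma> D" and "Lv = coef_Lv A \<Gamma> D"
    and "Cbar = coef_Cbar A \<Gamma> D" and "Cc = coef_C A \<Gamma> D" and "Cv = coef_Cv A D"
    \<comment> \<open>notation: the torsion components, with upper index first\<close>
    and "\<And>C j p. Tbar C j p = Lbar C j p"
    and "\<And>C r j p. T1 C r j p = - G C r j p"
    and "\<And>C r i j p. Tx C r i j p = L C r i j p - L C r j i p"
    and "\<And>C j p. Pbar C j p = Cbar C j p"
    and "\<And>C r i j p. Ph C r i j p = Cc C r i j p"
    and "\<And>C r i j p. S C r i j p = Cv C r i j p - Cv C r j i p"
    and "\<And>C r j p. P1 C r j p = dy C j p (M C r) - Gv C r j p"
    and "\<And>C r i j p. Pv C r i j p = dy C j p (N C r i) - Lv C r j i p"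
    and "\<And>C r j p. R1 C r j p = dx C j p (M C r) - dt C p (N C r j)"
    and "\<And>C r i j p. Rx C r i j p = dx C j p (N C r i) - dx C i p (N C r j)"
  shows
    "(\<forall>C\<in>jcharts A. \<forall>p\<in>jdom A C. \<forall>i j.
        h_R A \<Gamma> (T (dt C) (dt C)) p = (\<lambda>_. 0) \<and>
        h_M A \<Gamma> (T (dt C) (dt C)) p = (\<lambda>_. 0) \<and>
        v_proj A \<Gamma> (T (dt C) (dt C)) p = (\<lambda>_. 0) \<and>

        h_R A \<Gamma> (T (dx C j) (dt C)) p = (\<lambda>f. Tbar C j p * dt C p f) \<and>
        h_M A \<Gamma> (T (dx C j) (dt C)) p = (\<lambda>f. \<Sum>r\<in>UNIV. T1 C r j p * dx C r p f) \<and>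
        v_proj A \<Gamma> (T (dx C j) (dt C)) p = (\<lambda>f. \<Sum>r\<in>UNIV. R1 C r j p * dy C r p f) \<and>

        h_R A \<Gamma> (T (dx C j) (dx C i)) p = (\<lambda>_. 0) \<and>
        h_M A \<Gamma> (T (dx C j) (dx C i)) p = (\<lambda>f. \<Sum>r\<in>UNIV. Tx C r i j p * dx C r p f) \<and>
        v_proj A \<Gamma> (T (dx C j) (dx C i)) p = (\<lambda>f. \<Sum>r\<in>UNIV. Rx C r i j p * dy C r p f) \<and>

        h_R A \<Gamma> (T (dy C j) (dt C)) p = (\<lambda>f. Pbar C j p * dt C p f) \<and>
        h_M A \<Gamma> (T (dy C j) (dt C)) p = (\<lambda>_. 0) \<and>
        v_proj A \<Gamma> (T (dy C j) (dt C)) p = (\<lambda>f. \<Sum>r\<in>UNIV. P1 C r j p * dy C r p f) \<and>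

        h_R A \<Gamma> (T (dy C j) (dx C i)) p = (\<lambda>_. 0) \<and>
        h_M A \<Gamma> (T (dy C j) (dx C i)) p = (\<lambda>f. \<Sum>r\<in>UNIV. Ph C r i j p * dx C r p f) \<and>
        v_proj A \<Gamma> (T (dy C j) (dx C i)) p = (\<lambda>f. \<Sum>r\<in>UNIV. Pv C r i j p * dy C r p f) \<and>

        h_R A \<Gamma> (T (dy C j) (dy C i)) p = (\<lambda>_. 0) \<and>
        h_M A \<Gamma> (T (dy C j) (dy C i)) p = (\<lambda>_. 0) \<and>
        v_proj A \<Gamma> (T (dy C j) (dy C i)) p = (\<lambda>f. \<Sum>r\<in>UNIV. S C r i j p * dy C r p f)) \<and>

     \<comment> \<open>these components are d-tensors\<close>
     d_tensor A [T_up, T_lo, H_lo] (\<lambda>C is. Tbar C (the (is ! 2))) \<and>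
     d_tensor A [H_up, T_lo, H_lo] (\<lambda>C is. T1 C (the (is ! 0)) (the (is ! 2))) \<and>
     d_tensor A [V_up, T_lo, H_lo] (\<lambda>C is. R1 C (the (is ! 0)) (the (is ! 2))) \<and>
     d_tensor A [H_up, H_lo, H_lo] (\<lambda>C is. Tx C (the (is ! 0)) (the (is ! 1)) (the (is ! 2))) \<and>
     d_tensor A [V_up, H_lo, H_lo] (\<lambda>C is. Rx C (the (is ! 0)) (the (is ! 1)) (the (is ! 2))) \<and>
     d_tensor A [T_up, T_lo, V_lo] (\<lambda>C is. Pbar C (the (is ! 2))) \<and>
     d_tensor A [V_up, T_lo, V_lo] (\<lambda>C is. P1 C (the (is ! 0)) (the (is ! 2))) \<and>
     d_tensor A [H_up, H_lo, V_lo] (\<lambda>C is. Ph C (the (is ! 0)) (the (is ! 1)) (the (is ! 2))) \<and>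
     d_tensor A [V_up, H_lo, V_lo] (\<lambda>C is. Pv C (the (is ! 0)) (the (is ! 1)) (the (is ! 2))) \<and>
     d_tensor A [V_up, V_lo, V_lo] (\<lambda>C is. S C (the (is ! 0)) (the (is ! 1)) (the (is ! 2))) \<and>

     \<comment> \<open>they determine the torsion tensor\<close>
     (\<forall>X\<in>vector_fields A. \<forall>Y\<in>vector_fields A. \<forall>C\<in>jcharts A. \<forall>p\<in>jdom A C. \<forall>a b c a' b' c'.
        X p = adapted_vec A \<Gamma> C p a b c \<and> Y p = adapted_vec A \<Gamma> C p a' b' c' \<longrightarrow>
        torsion A D X Y p = adapted_vec A \<Gamma> C p
          ((\<Sum>j\<in>UNIV. (b j * a' - a * b' j) * Tbar C j p)
           + (\<Sum>j\<in>UNIV. (c j * a' - a * c' j) * Pbar C j p))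
          (\<lambda>r. (\<Sum>j\<in>UNIV. (b j * a' - a * b' j) * T1 C r j p)
             + (\<Sum>j\<in>UNIV. \<Sum>i\<in>UNIV. b j * b' i * Tx C r i j p)
             + (\<Sum>j\<in>UNIV. \<Sum>i\<in>UNIV. (c j * b' i - b i * c' j) * Ph C r i j p))
          (\<lambda>r. (\<Sum>j\<in>UNIV. (b j * a' - a * b' j) * R1 C r j p)
             + (\<Sum>j\<in>UNIV. \<Sum>i\<in>UNIV. b j * b' i * Rx C r i j p)
             + (\<Sum>j\<in>UNIV. (c j * a' - a * c' j) * P1 C r j p)
             + (\<Sum>j\<in>UNIV. \<Sum>i\<in>UNIV. (c j * b' i - b i * c' j) * Pv C r i j p)
             + (\<Sum>j\<in>UNIV. \<Sum>i\<in>UNIV. c j * c' i * S C r i j p)))"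
proof -
  interpret gamma_connection A M N D
    using assms(1-4) by unfold_locales (simp_all add: gamma_linear_connection_def)
  have frame: "dt C = fr C Time" "dx C i = fr C (Place i)" "dy C i = fr C (Fibre i)" for C i
    by (simp_all add: assms(2,5-7) fr_simps)
  have comps: "Tbar C j p = tors C Time (Place j) Time p" "T1 C r j p = tors C (Place r) (Place j) Time p"
    "R1 C r j p = tors C (Fibre r) (Place j) Time p"
    "Tx C r i j p = tors C (Place r) (Place j) (Place i) p" "Rx C r i j p = tors C (Fibre r) (Place j) (Place i) p"
    "Pbar C j p = tors C Time (Fibre j) Time p" "P1 C r j p = tors C (Fibre r) (Fibre j) Time p"
    "Ph C r i j p = tors C (Place r) (Fibre j) (Place i) p" "Pv C r i j p = tors C (Fibre r) (Fibre j) (Place i) p"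
    "S C r i j p = tors C (Fibre r) (Fibre j) (Fibre i) p"
    if "C \<in> jcharts A" "p \<in> jdom A C" for C p r i j
    by (simp_all only: tors_values[OF that] assms(9-27) assms(2)) (simp_all only: frame)
  show ?thesis
  proof (intro conjI, goal_cases)
    case 1
    show ?case
    proof (intro ballI allI, goal_cases)
      case (1 C p i j)
      have zeros: "tors C Time Time Time p = 0" "tors C (Place r) Time Time p = 0" "tors C (Fibre r) Time Time p = 0"
        "tors C Time (Place j) (Place i) p = 0" "tors C (Place r) (Fibre j) Time p = 0"
        "tors C Time (Fibre j) (Place i) p = 0" "tors C Time (Fibre j) (Fibre i) p = 0"
        "tors C (Place r) (Fibre j) (Fibre i) p = 0" for r
        by (simp_all only: tors_values[OF 1])
      show ?case
        unfolding assms(2,8) frame proj_torsion[OF 1] comps[OF 1] zeros by simp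
    qed
  next
    case 12
    show ?case
    proof (intro ballI allI impI ext, elim conjE, goal_cases)
      case (1 X Y C p a b c a' b' c' f)
      note C = 1(3,4)
      have X: "X p f = (\<Sum>\<kappa>\<in>UNIV. case_dir a b c \<kappa> * fr C \<kappa> p f)"
        and Y: "Y p f = (\<Sum>\<kappa>\<in>UNIV. case_dir a' b' c' \<kappa> * fr C \<kappa> p f)" for f
        using 1(5,6) by (simp_all only: assms(2) adapted_vec_eq)
      show ?case
        unfolding torsion_adapted[OF C 1(1) X 1(2) Y] antisymmetric_double_sum[OF tors_antisym]
          assms(2) adapted_vec_eq comps[OF C]
      proof (rule sum.cong[OF refl], goal_cases)
        case (1 \<gamma>)
        show ?case by (cases \<gamma>) (simp_all add: tors_values(5,9,11,14,15)[OF C])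
      qed
    qed
  qed (rule d_tensor_tors; simp add: comps)+
qed

end
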